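(* Let $X_j=\sum_{k=0}^\infty a_k\zeta_{j-k}$, $j\in\mathbb{Z}$, be a linear process with real coefficients satisfying $\sum_{k=0}^\infty a_k^2<\infty$ and i.i.d. real random variables $\zeta_j$, $j\in\mathbb{Z}$, with $E\zeta_0=0$, $E\zeta_0^2=1$ and $E\zeta_0^4<\infty$. Suppose that, for some $|d|<1/2$, the spectral density of $\{X_j\}$ is $f_X(u)=|u|^{-2d}g(u)$, $|u|\le\pi$, where $g$ is continuous on $\Pi=[-\pi,\pi]$ and $0<C_1\le g(u)\le C_2<\infty$, $u\in\Pi$, for some constants $C_1,C_2$; and that the transfer function $A_X$ is differentiable in $(0,\pi)$ with derivative satisfying $|\dot A_X(u)|\le C|u|^{-1-d}$, $u\in\Pi$, for some $C<\infty$. Let $b_{n,j}$ be a triangular array of real weights. Then there is a constant $C$ not depending on $n$ such that $$E(R_n-ER_n)^2\le C b_n^2\log^3(n)\quad\text{and}\quad E(R_n-ER_n)^2\le C b_nB_n,$$ $$|ER_n|\le C b_n\log^2(n),\quad\text{and}\quad |ER_n|=o(B_n)\ \text{ if } b_n=o(B_n).$$ In particular, (a) $E(S_{n,X}-S_{n,\zeta})^2\le C b_n^2\log^4(n)$; (b) $E(S_{n,X}-S_{n,\zeta})^2=o(B_n^2)$ if $b_n=o(B_n)$. (All $o(\cdot)$ are as $n\to\infty$.)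
   Context: $[\cdot]$ denotes integer part, $\nu=[n/2]-1$, and $u_j=2\pi j/n$. The transfer function is $A_X(u)=\sum_{k=0}^\infty e^{-\mathrm{i}ku}a_k$, $u\in\Pi$ (an $L^2(\Pi)$ series; pointwise conditions refer to a fixed version), and $f_X(u)=|A_X(u)|^2/(2\pi)$. The periodograms are $I_{X,j}=(2\pi n)^{-1}\bigl|\sum_{t=1}^n e^{\mathrm{i}tu_j}X_t\bigr|^2$ and $I_{\zeta,j}=(2\pi n)^{-1}\bigl|\sum_{t=1}^n e^{\mathrm{i}tu_j}\zeta_t\bigr|^2$; $f_{X,j}=f_X(u_j)$. Define $$S_{n,X}=\sum_{j=1}^{\nu}b_{n,j}\frac{I_{X,j}}{f_{X,j}},\qquad S_{n,\zeta}=\sum_{j=1}^{\nu}b_{n,j}\,2\pi I_{\zeta,j},\qquad R_n=S_{n,X}-S_{n,\zeta},$$ $$b_n=\max_{1\le j\le\nu}|b_{n,j}|,\qquad B_n=\Bigl(\sum_{j=1}^{\nu}b_{n,j}^2\Bigr)^{1/2}.$$ *)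

theory Defs
  imports "HOL-Probability.Probability" "HOL-Library.Landau_Symbols"
begin

definition iid :: "'w measure \<Rightarrow> (int \<Rightarrow> 'w \<Rightarrow> real) \<Rightarrow> bool" where
  "iid M \<zeta> \<longleftrightarrow> prob_space.indep_vars M (\<lambda>_. borel) \<zeta> UNIV \<and>
     (\<forall>i j. distr M borel (\<zeta> i) = distr M borel (\<zeta> j))"

text \<open>
  The series defining \<open>X j\<close> converges in mean square. The \<open>L\<^sup>2\<close> distance is written with the
  nonnegative integral, which is infinite (not \<open>0\<close>) when the integrand is not integrable.
\<close>

definition linear_process ::
    "'w measure \<Rightarrow> (nat \<Rightarrow> real) \<Rightarrow> (int \<Rightarrow> 'w \<Rightarrow> real) \<Rightarrow> (int \<Rightarrow> 'w \<Rightarrow> real) \<Rightarrow> bool" where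
  "linear_process M a \<zeta> X \<longleftrightarrow>
     (\<forall>j. X j \<in> borel_measurable M \<and>
       (\<lambda>N. \<integral>\<^sup>+ w. ennreal ((X j w - (\<Sum>k<N. a k * \<zeta> (j - int k) w))\<^sup>2) \<partial>M) \<longlonglongrightarrow> 0)"

text \<open>
  \<open>A\<close> is some version (representative on \<open>[-\<pi>, \<pi>]\<close>) of the \<open>L\<^sup>2\<close> sum of
  \<open>a k * exp (- \<i> k u)\<close>. The series determines \<open>A\<close> only almost everywhere.
\<close>

definition transfer_function :: "(nat \<Rightarrow> real) \<Rightarrow> (real \<Rightarrow> complex) \<Rightarrow> bool" where
  "transfer_function a A \<longleftrightarrow>
     set_borel_measurable lebesgue {-pi..pi} A \<and>
     (\<lambda>N. \<integral>\<^sup>+ u\<in>{-pi..pi}. ennreal ((cmod (A u - (\<Sum>k<N. cis (- (real k * u)) * of_real (a k))))\<^sup>2)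
        \<partial>lebesgue) \<longlonglongrightarrow> 0"

definition spectral_density :: "(real \<Rightarrow> complex) \<Rightarrow> real \<Rightarrow> real" where
  "spectral_density A u = (cmod (A u))\<^sup>2 / (2 * pi)"

definition freq :: "nat \<Rightarrow> nat \<Rightarrow> real" where
  "freq n j = 2 * pi * real j / real n"

text \<open>
  For \<open>n < 2\<close> truncated subtraction gives \<open>0\<close> instead of \<open>-1\<close>; the range \<open>{1..\<nu> n}\<close> is empty
  either way. It is nonempty exactly for \<open>n \<ge> 4\<close>.
\<close>

definition \<nu> :: "nat \<Rightarrow> nat" where
  "\<nu> n = n div 2 - 1"

definition periodogram :: "(int \<Rightarrow> 'w \<Rightarrow> real) \<Rightarrow> nat \<Rightarrow> nat \<Rightarrow> 'w \<Rightarrow> real" where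
  "periodogram Y n j w =
     (cmod (\<Sum>t=1..n. cis (real t * freq n j) * of_real (Y (int t) w)))\<^sup>2 / (2 * pi * real n)"

definition S_X ::
    "(nat \<Rightarrow> nat \<Rightarrow> real) \<Rightarrow> (real \<Rightarrow> complex) \<Rightarrow> (int \<Rightarrow> 'w \<Rightarrow> real) \<Rightarrow> nat \<Rightarrow> 'w \<Rightarrow> real" where
  "S_X b A X n w = (\<Sum>j=1..\<nu> n. b n j * (periodogram X n j w / spectral_density A (freq n j)))"

definition S_\<zeta> :: "(nat \<Rightarrow> nat \<Rightarrow> real) \<Rightarrow> (int \<Rightarrow> 'w \<Rightarrow> real) \<Rightarrow> nat \<Rightarrow> 'w \<Rightarrow> real" where
  "S_\<zeta> b \<zeta> n w = (\<Sum>j=1..\<nu> n. b n j * (2 * pi * periodogram \<zeta> n j w))"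

text \<open>
  Only meaningful for \<open>n \<ge> 4\<close>: otherwise this is the unspecified \<open>Max {}\<close>.
\<close>

definition weight_max :: "(nat \<Rightarrow> nat \<Rightarrow> real) \<Rightarrow> nat \<Rightarrow> real" where
  "weight_max b n = Max ((\<lambda>j. \<bar>b n j\<bar>) ` {1..\<nu> n})"

definition weight_l2 :: "(nat \<Rightarrow> nat \<Rightarrow> real) \<Rightarrow> nat \<Rightarrow> real" where
  "weight_l2 b n = sqrt (\<Sum>j=1..\<nu> n. (b n j)\<^sup>2)"

end

theory Submission imports Defs begin

text \<open>
  Divided by \<open>A (u\<^sub>j)\<close>, the discrete Fourier transforms of \<open>X\<close> and of the noise at the frequency
  \<open>u\<^sub>j\<close> are linear forms in the noise with coefficient vectors \<open>c\<^sub>j\<close> and \<open>e\<^sub>j\<close>, and the \<open>e\<^sub>j\<close> are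
  orthonormal. A centered quadratic form in i.i.d. variables has variance at most a constant times the
  squared Frobenius norm of its kernel. For the kernel \<open>\<Sum> b\<^sub>j (c\<^sub>j c\<^sub>j\<^sup>* - e\<^sub>j e\<^sub>j\<^sup>*)\<close> of \<open>R\<close> that norm is
  controlled by the numbers \<open>\<rho>\<^sub>j = \<parallel>c\<^sub>j - e\<^sub>j\<parallel>\<^sup>2\<close>, while the mean of \<open>R\<close> is \<open>\<Sum> b\<^sub>j (\<parallel>c\<^sub>j\<parallel>\<^sup>2 - 1)\<close>. By Parseval
  both are integrals of powers of \<open>\<bar>A x / A (u\<^sub>j) - 1\<bar>\<close> against the Fejer kernel at \<open>u\<^sub>j\<close>, and the
  hypotheses on \<open>A\<close> give \<open>\<rho>\<^sub>j = O(1/j + 1/(n/2 - j))\<close>, with an additional factor \<open>1 + ln j\<close> for the mean.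
  The bounds by products of the maximum and the \<open>L\<^sup>2\<close> norm of the weights follow by applying
  Cauchy-Schwarz twice, which costs no logarithm. Since \<open>X\<close> is only a mean-square limit of finite moving
  averages, everything is done for the truncated filter and then passed to the limit, by Fatou for
  the variance.
\<close>

section \<open>Quadratic forms in white noise\<close>

text \<open>The gain lies in treating the two kernels together. With \<open>r = c - e\<close>,
  \<open>c c* - e e* = r r* + r e* + e r*\<close>. Orthonormality of the \<open>e j\<close> bounds
  the cross terms by the single sum of \<open>(b j)^2 * \<rho> j\<close>; the \<open>r j\<close> are
  not orthogonal and cost the square of the sum of \<open>\<bar>b j\<bar> * \<rho> j\<close>. The
  mean carries one more logarithm because |z|^2 - 1 is only of first order in z - 1. The Fejer
  kernel decays quadratically away from its center u, so a first-order zero leaves 1 / |x - u|, cut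
  off at distance 1 / n, while a second-order zero leaves a bounded function. Since \<open>A\<close>
  is differentiable only on (0, \<pi>), smoothness is exploited between u / 2 and 2 u. Elsewhere
  only the size of |A| enters, and |d| < 1/2 makes the resulting powers integrable at 0 and against
  1 / x^2 at infinity. The variance is in fact bounded with ln^2 n; ln^3 n follows since ln n >= 1
  for n >= 4. The little-o claims rest on bounding the square of the mean, like the variance, by a
  constant times the maximum of the weights times their L2 norm.\<close>

lemma integrable_mult_of_squares:
  fixes f g :: "'a \<Rightarrow> real"
  assumes [measurable]: "f \<in> borel_measurable M" "g \<in> borel_measurable M"
    and "integrable M (\<lambda>w. (f w)\<^sup>2)" "integrable M (\<lambda>w. (g w)\<^sup>2)"
  shows "integrable M (\<lambda>w. f w * g w)"
proof (rule Bochner_Integration.integrable_bound)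
  show "integrable M (\<lambda>w. (f w)\<^sup>2 + (g w)\<^sup>2)"
    using assms by simp
  have "\<bar>x * y\<bar> \<le> x\<^sup>2 + y\<^sup>2" for x y :: real
  proof -
    have "0 \<le> (\<bar>x\<bar> - \<bar>y\<bar>)\<^sup>2" "0 \<le> \<bar>x\<bar> * \<bar>y\<bar>" by simp_all
    then show ?thesis unfolding abs_mult power2_diff power2_abs by linarith
  qed
  then show "AE w in M. norm (f w * g w) \<le> norm ((f w)\<^sup>2 + (g w)\<^sup>2)"
    by simp
qed simp

lemma integrable_square_add:
  fixes f g :: "'a \<Rightarrow> real"
  assumes [measurable]: "f \<in> borel_measurable M" "g \<in> borel_measurable M"
    and "integrable M (\<lambda>w. (f w)\<^sup>2)" "integrable M (\<lambda>w. (g w)\<^sup>2)"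
  shows "integrable M (\<lambda>w. (f w + g w)\<^sup>2)"
  using assms integrable_mult_of_squares[OF assms]
  by (simp add: power2_sum mult.assoc)

lemma integrable_square_sum:
  fixes f :: "'i \<Rightarrow> 'a \<Rightarrow> real"
  assumes "finite I" and [measurable]: "\<And>i. i \<in> I \<Longrightarrow> f i \<in> borel_measurable M"
    and "\<And>i. i \<in> I \<Longrightarrow> integrable M (\<lambda>w. (f i w)\<^sup>2)"
  shows "integrable M (\<lambda>w. (\<Sum>i\<in>I. f i w)\<^sup>2)"
  using assms
proof (induction I)
  case (insert i I)
  then show ?case
    by (simp) (intro integrable_square_add borel_measurable_sum, auto)
qed simp

text \<open>The i.i.d. hypothesis is reduced to independence and the common moments that second
  moments of quadratic forms involve. The third moment is finite and may be nonzero.\<close>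

locale white_noise = prob_space M for M :: "'w measure" +
  fixes \<zeta> :: "int \<Rightarrow> 'w \<Rightarrow> real" and \<kappa> :: real
  assumes indep: "indep_vars (\<lambda>_. borel) \<zeta> UNIV"
    and mean_zero: "expectation (\<zeta> i) = 0"
    and variance_one: "expectation (\<lambda>w. (\<zeta> i w)\<^sup>2) = 1"
    and integrable_fourth: "integrable M (\<lambda>w. \<zeta> i w ^ 4)"
    and fourth_moment: "expectation (\<lambda>w. \<zeta> i w ^ 4) = \<kappa>"
begin

lemma noise_measurable [measurable]: "\<zeta> i \<in> borel_measurable M"
  using indep by (auto simp: indep_vars_def)

lemma integrable_power:
  assumes "k \<le> 4" shows "integrable M (\<lambda>w. \<zeta> i w ^ k)"
proof (rule Bochner_Integration.integrable_bound)
  show "integrable M (\<lambda>w. 1 + \<zeta> i w ^ 4)"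
    using integrable_fourth by simp
  have "\<bar>x\<bar> ^ k \<le> 1 + x ^ 4" for x :: real
  proof (cases "\<bar>x\<bar> \<le> 1")
    case True
    then have "\<bar>x\<bar> ^ k \<le> 1" by (simp add: power_le_one)
    then show ?thesis by (simp add: add_increasing2)
  next
    case False
    then have "\<bar>x\<bar> ^ k \<le> \<bar>x\<bar> ^ 4" using assms by (intro power_increasing) auto
    then show ?thesis by simp
  qed
  then show "AE w in M. norm (\<zeta> i w ^ k) \<le> norm (1 + \<zeta> i w ^ 4)"
    by (simp add: power_abs)
qed simp

lemma integrable_noise: "integrable M (\<zeta> i)" "integrable M (\<lambda>w. (\<zeta> i w)\<^sup>2)" "integrable M (\<lambda>w. \<zeta> i w ^ 3)"
  using integrable_power[of 1] integrable_power[of 2] integrable_power[of 3] by simp_all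

text \<open>\<open>\<kappa> - 1\<close> is the variance of the squared noise. The fact serves as
  \<open>2 \<le> 1 + \<kappa>\<close>, so that one factor \<open>1 + \<kappa>\<close> covers
  diagonal and off-diagonal terms.\<close>

lemma fourth_moment_ge_one: "1 \<le> \<kappa>"
proof -
  have "0 \<le> expectation (\<lambda>w. ((\<zeta> 0 w)\<^sup>2 - 1)\<^sup>2)" by simp
  also have "(\<lambda>w. ((\<zeta> 0 w)\<^sup>2 - 1)\<^sup>2) = (\<lambda>w. \<zeta> 0 w ^ 4 - 2 * (\<zeta> 0 w)\<^sup>2 + 1)"
    by (intro ext) (simp add: power2_diff flip: power_mult)
  also have "expectation \<dots> = \<kappa> - 1"
    using integrable_fourth[of 0] integrable_noise(2)[of 0] by (simp add: fourth_moment variance_one prob_space)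
  finally show ?thesis by simp
qed

text \<open>\<open>F\<close> acts on whole noise sequences but depends on the coordinates in
  \<open>I\<close> only; this is what \<open>restr\<close> says. Forms in the noise can thus be
  written with \<open>\<lambda>i. \<zeta> i w\<close>, while measurability refers to the finite
  product.\<close>

lemma indep_factor:
  fixes G :: "real \<Rightarrow> real" and F :: "(int \<Rightarrow> real) \<Rightarrow> real"
  assumes "finite I" "p \<notin> I"
    and G: "G \<in> borel_measurable borel" and F: "F \<in> borel_measurable (PiM I (\<lambda>_. borel))"
    and restr: "\<And>x. F (restrict x I) = F x"
    and "integrable M (\<lambda>w. G (\<zeta> p w))" "integrable M (\<lambda>w. F (\<lambda>i. \<zeta> i w))"
  shows "integrable M (\<lambda>w. G (\<zeta> p w) * F (\<lambda>i. \<zeta> i w))"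
    and "expectation (\<lambda>w. G (\<zeta> p w) * F (\<lambda>i. \<zeta> i w))
      = expectation (\<lambda>w. G (\<zeta> p w)) * expectation (\<lambda>w. F (\<lambda>i. \<zeta> i w))"
proof -
  have "indep_var borel ((\<lambda>x. G (x p)) \<circ> (\<lambda>w. restrict (\<lambda>i. \<zeta> i w) {p}))
          borel (F \<circ> (\<lambda>w. restrict (\<lambda>i. \<zeta> i w) I))"
    using assms(2) G F by (intro indep_var_compose[OF indep_var_restrict[OF indep]]) auto
  then have *: "indep_var borel (\<lambda>w. G (\<zeta> p w)) borel (\<lambda>w. F (\<lambda>i. \<zeta> i w))"
    by (simp add: comp_def restr)
  show "integrable M (\<lambda>w. G (\<zeta> p w) * F (\<lambda>i. \<zeta> i w))"
    by (rule indep_var_integrable[OF * assms(6,7)])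
  show "expectation (\<lambda>w. G (\<zeta> p w) * F (\<lambda>i. \<zeta> i w))
      = expectation (\<lambda>w. G (\<zeta> p w)) * expectation (\<lambda>w. F (\<lambda>i. \<zeta> i w))"
    by (rule indep_var_lebesgue_integral[OF * assms(6,7)])
qed

lemma linear_form:
  assumes "finite I"
  shows "integrable M (\<lambda>w. \<Sum>q\<in>I. c q * \<zeta> q w)"
    and "expectation (\<lambda>w. \<Sum>q\<in>I. c q * \<zeta> q w) = 0"
    and "integrable M (\<lambda>w. (\<Sum>q\<in>I. c q * \<zeta> q w)\<^sup>2)"
    and "expectation (\<lambda>w. (\<Sum>q\<in>I. c q * \<zeta> q w)\<^sup>2) = (\<Sum>q\<in>I. (c q)\<^sup>2)"
proof -
  have 1: "integrable M (\<lambda>w. \<Sum>q\<in>I. c q * \<zeta> q w)" for I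
    using integrable_noise by simp
  have 2: "expectation (\<lambda>w. \<Sum>q\<in>I. c q * \<zeta> q w) = 0" for I
    using integrable_noise by (simp add: mean_zero)
  have 3: "integrable M (\<lambda>w. (\<Sum>q\<in>I. c q * \<zeta> q w)\<^sup>2)" if "finite I" for I
    using that integrable_noise by (intro integrable_square_sum) (auto simp: power_mult_distrib)
  show "integrable M (\<lambda>w. \<Sum>q\<in>I. c q * \<zeta> q w)" "expectation (\<lambda>w. \<Sum>q\<in>I. c q * \<zeta> q w) = 0"
    "integrable M (\<lambda>w. (\<Sum>q\<in>I. c q * \<zeta> q w)\<^sup>2)"
    using 1 2 3 assms by auto
  show "expectation (\<lambda>w. (\<Sum>q\<in>I. c q * \<zeta> q w)\<^sup>2) = (\<Sum>q\<in>I. (c q)\<^sup>2)"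
    using assms
  proof (induction I)
    case (insert p I)
    define L where "L = (\<lambda>x :: int \<Rightarrow> real. \<Sum>q\<in>I. c q * x q)"
    have [measurable]: "L \<in> borel_measurable (PiM I (\<lambda>_. borel))"
      unfolding L_def by measurable
    have L: "L (restrict x I) = L x" for x
      unfolding L_def by (intro sum.cong) auto
    have zL: "integrable M (\<lambda>w. \<zeta> p w * L (\<lambda>i. \<zeta> i w))" "expectation (\<lambda>w. \<zeta> p w * L (\<lambda>i. \<zeta> i w)) = 0"
      using indep_factor[OF insert(1,2), of "\<lambda>x. x" L] L integrable_noise(1)[of p] 1[of I]
      by (simp_all add: mean_zero) (simp_all add: L_def)
    have L2: "integrable M (\<lambda>w. (L (\<lambda>i. \<zeta> i w))\<^sup>2)" "expectation (\<lambda>w. (L (\<lambda>i. \<zeta> i w))\<^sup>2) = (\<Sum>q\<in>I. (c q)\<^sup>2)"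
      using 3[OF insert(1)] insert.IH by (simp_all add: L_def)
    have "expectation (\<lambda>w. (\<Sum>q\<in>insert p I. c q * \<zeta> q w)\<^sup>2)
        = expectation (\<lambda>w. (c p)\<^sup>2 * (\<zeta> p w)\<^sup>2 + 2 * c p * (\<zeta> p w * L (\<lambda>i. \<zeta> i w)) + (L (\<lambda>i. \<zeta> i w))\<^sup>2)"
      using insert(1,2) by (simp add: L_def power2_sum power_mult_distrib algebra_simps)
    also have "\<dots> = (c p)\<^sup>2 + (\<Sum>q\<in>I. (c q)\<^sup>2)"
      using zL L2 integrable_noise(2)[of p] by (simp add: variance_one mean_zero)
    finally show ?case using insert(1,2) by simp
  qed simp
qed

text \<open>The subtracted trace is the expectation of the quadratic form, because the noise is
  uncorrelated with unit variance.\<close>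

definition centered_form :: "(int \<Rightarrow> int \<Rightarrow> real) \<Rightarrow> int set \<Rightarrow> (int \<Rightarrow> real) \<Rightarrow> real" where
  "centered_form Q I x = (\<Sum>p\<in>I. \<Sum>q\<in>I. Q p q * (x p * x q)) - (\<Sum>p\<in>I. Q p p)"

text \<open>The increment has mean zero given the coordinates in \<open>I\<close>: the linear factor
  and \<open>Q p p\<close> involve no \<open>x p\<close>, and both \<open>x p\<close> and
  \<open>(x p)^2 - 1\<close> are centered.\<close>

lemma centered_form_insert:
  assumes "finite I" "p \<notin> I"
  shows "centered_form Q (insert p I) x
    = centered_form Q I x + x p * (\<Sum>q\<in>I. (Q p q + Q q p) * x q) + Q p p * ((x p)\<^sup>2 - 1)"
  using assms by (simp add: centered_form_def sum.distrib algebra_simps sum_distrib_left power2_eq_square)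

text \<open>Adding the indices one at a time exhibits the form as a martingale, so the second
  moments of the increments add up. \<open>Q\<close> need not be symmetric; each new index
  contributes its row, its column and its diagonal entry.\<close>

lemma centered_form_bound:
  assumes "finite I"
  shows "integrable M (\<lambda>w. centered_form Q I (\<lambda>i. \<zeta> i w)) \<and>
    integrable M (\<lambda>w. (centered_form Q I (\<lambda>i. \<zeta> i w))\<^sup>2) \<and>
    expectation (\<lambda>w. centered_form Q I (\<lambda>i. \<zeta> i w)) = 0 \<and>
    expectation (\<lambda>w. (centered_form Q I (\<lambda>i. \<zeta> i w))\<^sup>2) \<le> (1 + \<kappa>) * (\<Sum>p\<in>I. \<Sum>q\<in>I. (Q p q)\<^sup>2)"
  using assms
proof (induction I)
  case empty
  then show ?case by (simp add: centered_form_def)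
next
  case (insert p I)
  define U where "U = centered_form Q I"
  define L where "L = (\<lambda>x :: int \<Rightarrow> real. \<Sum>q\<in>I. (Q p q + Q q p) * x q)"
  define c where "c = Q p p"
  let ?z = "\<zeta> p" and ?U = "\<lambda>w. U (\<lambda>i. \<zeta> i w)" and ?L = "\<lambda>w. L (\<lambda>i. \<zeta> i w)"
  have [measurable]: "L \<in> borel_measurable (PiM I (\<lambda>_. borel))" "U \<in> borel_measurable (PiM I (\<lambda>_. borel))"
    unfolding L_def U_def centered_form_def by measurable
  have L: "L (restrict x I) = L x" and U: "U (restrict x I) = U x" for x
    unfolding L_def U_def centered_form_def by (auto intro!: sum.cong)
  have Li: "integrable M ?L" "expectation ?L = 0" "integrable M (\<lambda>w. (?L w)\<^sup>2)"
    "expectation (\<lambda>w. (?L w)\<^sup>2) = (\<Sum>q\<in>I. (Q p q + Q q p)\<^sup>2)"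
    using linear_form[OF insert(1), of "\<lambda>q. Q p q + Q q p"] by (simp_all add: L_def)
  have Ui: "integrable M ?U" "expectation ?U = 0" "integrable M (\<lambda>w. (?U w)\<^sup>2)"
    using insert.IH by (simp_all add: U_def)
  have [measurable]: "?L \<in> borel_measurable M" "?U \<in> borel_measurable M"
    using Li(1) Ui(1) by auto
  have UL: "integrable M (\<lambda>w. ?U w * ?L w)"
    using Li Ui by (intro integrable_mult_of_squares) auto
  note fac = indep_factor[OF insert(1,2)]
  have zint: "integrable M (\<lambda>w. (?z w)\<^sup>2 - 1)" "integrable M (\<lambda>w. ?z w ^ 3 - ?z w)"
    "integrable M (\<lambda>w. ((?z w)\<^sup>2 - 1)\<^sup>2)"
    and zexp: "expectation (\<lambda>w. (?z w)\<^sup>2 - 1) = 0" "expectation (\<lambda>w. ((?z w)\<^sup>2 - 1)\<^sup>2) = \<kappa> - 1"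
  proof -
    have eq: "(\<lambda>w. ((?z w)\<^sup>2 - 1)\<^sup>2) = (\<lambda>w. ?z w ^ 4 - 2 * (?z w)\<^sup>2 + 1)"
      by (intro ext) (simp add: power2_diff flip: power_mult)
    show "integrable M (\<lambda>w. (?z w)\<^sup>2 - 1)" "integrable M (\<lambda>w. ?z w ^ 3 - ?z w)"
      "integrable M (\<lambda>w. ((?z w)\<^sup>2 - 1)\<^sup>2)"
      "expectation (\<lambda>w. (?z w)\<^sup>2 - 1) = 0" "expectation (\<lambda>w. ((?z w)\<^sup>2 - 1)\<^sup>2) = \<kappa> - 1"
      unfolding eq using integrable_noise[of p] integrable_fourth[of p]
      by (simp_all add: variance_one fourth_moment prob_space)
  qed
  have t1: "integrable M (\<lambda>w. (?z w)\<^sup>2 * (?L w)\<^sup>2)"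
      "expectation (\<lambda>w. (?z w)\<^sup>2 * (?L w)\<^sup>2) = expectation (\<lambda>w. (?L w)\<^sup>2)"
    using fac[of "\<lambda>x. x\<^sup>2" "\<lambda>x. (L x)\<^sup>2"] L Li integrable_noise[of p] by (simp_all add: variance_one)
  have t2: "integrable M (\<lambda>w. ?z w * (?U w * ?L w))"
      "expectation (\<lambda>w. ?z w * (?U w * ?L w)) = 0"
    using fac[of "\<lambda>x. x" "\<lambda>x. U x * L x"] L U UL integrable_noise[of p] by (simp_all add: mean_zero)
  have t3: "integrable M (\<lambda>w. ((?z w)\<^sup>2 - 1) * ?U w)"
      "expectation (\<lambda>w. ((?z w)\<^sup>2 - 1) * ?U w) = 0"
    using fac[of "\<lambda>x. x\<^sup>2 - 1" U] U Ui zint zexp by simp_all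
  \<comment> \<open>The third moment need not vanish; the term drops out because it is multiplied by
    the mean of \<open>L\<close>.\<close>
  have t4: "integrable M (\<lambda>w. (?z w ^ 3 - ?z w) * ?L w)"
      "expectation (\<lambda>w. (?z w ^ 3 - ?z w) * ?L w) = 0"
    using fac[of "\<lambda>x. x ^ 3 - x" L] L Li zint by simp_all
  have t5: "integrable M (\<lambda>w. ?z w * ?L w)" "expectation (\<lambda>w. ?z w * ?L w) = 0"
    using fac[of "\<lambda>x. x" L] L Li integrable_noise[of p] by (simp_all add: mean_zero)
  have form: "centered_form Q (insert p I) (\<lambda>i. \<zeta> i w) = ?U w + ?z w * ?L w + c * ((?z w)\<^sup>2 - 1)" for w
    using centered_form_insert[OF insert(1,2)] by (simp add: U_def L_def c_def)
  have form2: "(centered_form Q (insert p I) (\<lambda>i. \<zeta> i w))\<^sup>2 = (?U w)\<^sup>2 + (?z w)\<^sup>2 * (?L w)\<^sup>2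
      + c\<^sup>2 * ((?z w)\<^sup>2 - 1)\<^sup>2 + 2 * (?z w * (?U w * ?L w)) + (2 * c) * (((?z w)\<^sup>2 - 1) * ?U w)
      + (2 * c) * ((?z w ^ 3 - ?z w) * ?L w)" for w
    unfolding form by (simp add: power2_eq_square power3_eq_cube algebra_simps)
  have "expectation (\<lambda>w. (centered_form Q (insert p I) (\<lambda>i. \<zeta> i w))\<^sup>2)
    = expectation (\<lambda>w. (?U w)\<^sup>2) + (\<Sum>q\<in>I. (Q p q + Q q p)\<^sup>2) + c\<^sup>2 * (\<kappa> - 1)"
    unfolding form2 using t1 t2 t3 t4 Ui zint zexp Li by simp
  also have "\<dots> \<le> (1 + \<kappa>) * (\<Sum>p\<in>I. \<Sum>q\<in>I. (Q p q)\<^sup>2)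
      + (1 + \<kappa>) * (\<Sum>q\<in>I. (Q p q)\<^sup>2 + (Q q p)\<^sup>2) + (1 + \<kappa>) * c\<^sup>2"
  proof (intro add_mono)
    show "expectation (\<lambda>w. (?U w)\<^sup>2) \<le> (1 + \<kappa>) * (\<Sum>p\<in>I. \<Sum>q\<in>I. (Q p q)\<^sup>2)"
      using insert.IH by (simp add: U_def)
    have "(x + y)\<^sup>2 \<le> (1 + \<kappa>) * (x\<^sup>2 + y\<^sup>2)" for x y :: real
    proof -
      have "(x + y)\<^sup>2 \<le> 2 * (x\<^sup>2 + y\<^sup>2)"
        using sum_squares_bound[of x y] by (simp add: power2_sum)
      also have "\<dots> \<le> (1 + \<kappa>) * (x\<^sup>2 + y\<^sup>2)"
        using fourth_moment_ge_one by (intro mult_right_mono) auto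
      finally show ?thesis .
    qed
    then show "(\<Sum>q\<in>I. (Q p q + Q q p)\<^sup>2) \<le> (1 + \<kappa>) * (\<Sum>q\<in>I. (Q p q)\<^sup>2 + (Q q p)\<^sup>2)"
      unfolding sum_distrib_left by (intro sum_mono)
    show "c\<^sup>2 * (\<kappa> - 1) \<le> (1 + \<kappa>) * c\<^sup>2"
      by (simp add: algebra_simps)
  qed
  also have "\<dots> = (1 + \<kappa>) * (\<Sum>r\<in>insert p I. \<Sum>q\<in>insert p I. (Q r q)\<^sup>2)"
    using insert(1,2) by (simp add: sum.distrib c_def algebra_simps)
  finally show ?case
    unfolding form2 unfolding form using t1 t2 t3 t4 t5 Ui zint zexp Li UL integrable_noise[of p]
    by (auto simp: variance_one)
qed

end

section \<open>Mean-square limits\<close>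

lemma norm_add_power2_le:
  fixes x y :: "'a :: real_normed_vector"
  shows "(norm (x + y))\<^sup>2 \<le> 2 * (norm x)\<^sup>2 + 2 * (norm y)\<^sup>2"
proof -
  have "(norm (x + y))\<^sup>2 \<le> (norm x + norm y)\<^sup>2"
    by (intro power_mono norm_triangle_ineq norm_ge_zero)
  also have "\<dots> \<le> 2 * (norm x)\<^sup>2 + 2 * (norm y)\<^sup>2"
    using sum_squares_bound[of "norm x" "norm y"] by (simp add: power2_sum)
  finally show ?thesis .
qed

text \<open>Young's inequality with a free weight \<open>e\<close>. Choosing \<open>e\<close> in
  terms of the distance of the two functions later makes every term on the right tend to
  zero.\<close>

lemma abs_norm_power2_diff_le:
  fixes x y :: "'a :: real_normed_vector"
  assumes "0 < e"
  shows "\<bar>(norm x)\<^sup>2 - (norm y)\<^sup>2\<bar> \<le> (norm (x - y))\<^sup>2 + e * (norm y)\<^sup>2 + (norm (x - y))\<^sup>2 / e"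
proof -
  let ?h = "norm (x - y)"
  have h: "\<bar>norm x - norm y\<bar> \<le> ?h" by (rule norm_triangle_ineq3)
  have "\<bar>(norm x)\<^sup>2 - (norm y)\<^sup>2\<bar> = \<bar>norm x - norm y\<bar> * \<bar>(norm x - norm y) + 2 * norm y\<bar>"
  proof -
    have "a\<^sup>2 - b\<^sup>2 = (a - b) * ((a - b) + 2 * b)" for a b :: real
      by (simp add: power2_eq_square algebra_simps)
    then show ?thesis by (simp only: abs_mult)
  qed
  also have "\<dots> \<le> ?h * (?h + 2 * norm y)"
    using h by (intro mult_mono) auto
  also have "\<dots> = ?h\<^sup>2 + 2 * (?h / sqrt e) * (sqrt e * norm y)"
  proof -
    have "sqrt e * sqrt e = e" "sqrt e \<noteq> 0" using assms by auto
    then show ?thesis by (simp add: power2_eq_square distrib_left)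
  qed
  also have "\<dots> \<le> ?h\<^sup>2 + ((?h / sqrt e)\<^sup>2 + (sqrt e * norm y)\<^sup>2)"
    using sum_squares_bound[of "?h / sqrt e" "sqrt e * norm y"] by simp
  also have "\<dots> = ?h\<^sup>2 + e * (norm y)\<^sup>2 + ?h\<^sup>2 / e"
    using assms by (simp add: power_divide power_mult_distrib)
  finally show ?thesis .
qed

text \<open>Used on the probability space for the process and on [-\<pi>, \<pi>] for the transfer
  function, hence the Banach-valued form. An extended integral tending to 0 is eventually finite,
  and one such \<open>N\<close> already gives square integrability of \<open>G\<close>.\<close>

lemma L2_tendsto:
  fixes F :: "nat \<Rightarrow> 'a \<Rightarrow> 'b :: {second_countable_topology, banach}"
  assumes [measurable]: "\<And>N. F N \<in> borel_measurable M" "G \<in> borel_measurable M"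
    and F: "\<And>N. integrable M (\<lambda>w. (norm (F N w))\<^sup>2)"
    and lim: "(\<lambda>N. \<integral>\<^sup>+ w. ennreal ((norm (G w - F N w))\<^sup>2) \<partial>M) \<longlonglongrightarrow> 0"
  shows "integrable M (\<lambda>w. (norm (G w))\<^sup>2)"
    and "\<And>N. integrable M (\<lambda>w. (norm (G w - F N w))\<^sup>2)"
    and "(\<lambda>N. \<integral>w. (norm (G w - F N w))\<^sup>2 \<partial>M) \<longlonglongrightarrow> 0"
    and "(\<lambda>N. \<integral>w. (norm (F N w))\<^sup>2 \<partial>M) \<longlonglongrightarrow> (\<integral>w. (norm (G w))\<^sup>2 \<partial>M)"
proof -
  have "\<forall>\<^sub>F N in sequentially. (\<integral>\<^sup>+ w. ennreal ((norm (G w - F N w))\<^sup>2) \<partial>M) < \<infinity>"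
    using lim by (rule order_tendstoD) simp
  then obtain N0 where "(\<integral>\<^sup>+ w. ennreal ((norm (G w - F N0 w))\<^sup>2) \<partial>M) < \<infinity>"
    by (auto simp: eventually_sequentially)
  then have N0: "integrable M (\<lambda>w. (norm (G w - F N0 w))\<^sup>2)"
    by (intro integrableI_nonneg) auto
  show G: "integrable M (\<lambda>w. (norm (G w))\<^sup>2)"
  proof (rule Bochner_Integration.integrable_bound)
    show "integrable M (\<lambda>w. 2 * (norm (G w - F N0 w))\<^sup>2 + 2 * (norm (F N0 w))\<^sup>2)"
      using N0 F by simp
    show "AE w in M. norm ((norm (G w))\<^sup>2) \<le> norm (2 * (norm (G w - F N0 w))\<^sup>2 + 2 * (norm (F N0 w))\<^sup>2)"
      using norm_add_power2_le[of "G w - F N0 w" "F N0 w" for w] by (intro always_eventually) simp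
  qed simp
  show D: "integrable M (\<lambda>w. (norm (G w - F N w))\<^sup>2)" for N
  proof (rule Bochner_Integration.integrable_bound)
    show "integrable M (\<lambda>w. 2 * (norm (G w))\<^sup>2 + 2 * (norm (F N w))\<^sup>2)"
      using G F by simp
    show "AE w in M. norm ((norm (G w - F N w))\<^sup>2) \<le> norm (2 * (norm (G w))\<^sup>2 + 2 * (norm (F N w))\<^sup>2)"
      using norm_add_power2_le[of "G w" "- F N w" for w] by (intro always_eventually) simp
  qed simp
  define H where "H N = (\<integral>w. (norm (G w - F N w))\<^sup>2 \<partial>M)" for N
  have "(\<lambda>N. ennreal (H N)) \<longlonglongrightarrow> ennreal 0"
    using lim D by (simp add: H_def nn_integral_eq_integral)
  moreover have H0: "0 \<le> H N" for N by (simp add: H_def)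
  ultimately have H: "H \<longlonglongrightarrow> 0"
    by (subst (asm) tendsto_ennreal_iff) auto
  then show "(\<lambda>N. \<integral>w. (norm (G w - F N w))\<^sup>2 \<partial>M) \<longlonglongrightarrow> 0"
    unfolding H_def .
  \<comment> \<open>The root makes \<open>H N / e N\<close> at most \<open>sqrt (H N)\<close>; the
    reciprocal keeps the weight positive when \<open>H N = 0\<close>.\<close>
  define e where "e N = sqrt (H N) + inverse (real (Suc N))" for N
  have e0: "0 < e N" for N unfolding e_def using H0 by (intro add_nonneg_pos) auto
  have e: "e \<longlonglongrightarrow> 0"
    unfolding e_def using tendsto_add[OF tendsto_real_sqrt[OF H] LIMSEQ_inverse_real_of_nat] by simp
  define J where "J = (\<integral>w. (norm (G w))\<^sup>2 \<partial>M)"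
  have bound: "\<bar>(\<integral>w. (norm (F N w))\<^sup>2 \<partial>M) - J\<bar> \<le> H N + e N * J + sqrt (H N)" for N
  proof -
    have "\<bar>(\<integral>w. (norm (F N w))\<^sup>2 \<partial>M) - J\<bar> = \<bar>\<integral>w. (norm (F N w))\<^sup>2 - (norm (G w))\<^sup>2 \<partial>M\<bar>"
      using F G by (simp add: J_def)
    also have "\<dots> \<le> (\<integral>w. \<bar>(norm (F N w))\<^sup>2 - (norm (G w))\<^sup>2\<bar> \<partial>M)"
      by (rule integral_abs_bound)
    also have "\<dots> \<le> (\<integral>w. (norm (G w - F N w))\<^sup>2 + e N * (norm (G w))\<^sup>2 + (norm (G w - F N w))\<^sup>2 / e N \<partial>M)"
      using F G D abs_norm_power2_diff_le[OF e0, of "F N w" "G w" for N w]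
      by (intro integral_mono) (auto simp: norm_minus_commute)
    also have "\<dots> = H N + e N * J + H N / e N"
      using D G by (simp add: H_def J_def)
    also have "H N / e N \<le> sqrt (H N)"
    proof -
      have "H N = sqrt (H N) * sqrt (H N)" using H0 by simp
      also have "\<dots> \<le> sqrt (H N) * e N" using H0 by (intro mult_left_mono) (auto simp: e_def)
      finally show ?thesis using e0 by (simp add: divide_le_eq)
    qed
    finally show ?thesis by simp
  qed
  have "(\<lambda>N. H N + e N * J + sqrt (H N)) \<longlonglongrightarrow> 0 + 0 * J + sqrt 0"
    by (intro tendsto_intros H e)
  then have lim0: "(\<lambda>N. H N + e N * J + sqrt (H N)) \<longlonglongrightarrow> 0"
    by simp
  have "(\<lambda>N. (\<integral>w. (norm (F N w))\<^sup>2 \<partial>M) - J) \<longlonglongrightarrow> 0"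
  proof (rule Lim_null_comparison[OF always_eventually lim0], rule allI)
    fix N show "norm ((\<integral>w. (norm (F N w))\<^sup>2 \<partial>M) - J) \<le> H N + e N * J + sqrt (H N)"
      unfolding real_norm_def by (rule bound)
  qed
  then show "(\<lambda>N. \<integral>w. (norm (F N w))\<^sup>2 \<partial>M) \<longlonglongrightarrow> (\<integral>w. (norm (G w))\<^sup>2 \<partial>M)"
    unfolding J_def by (rule LIM_zero_cancel)
qed

section \<open>Frobenius norms\<close>

lemma sum_power2_orthonormal:
  fixes v :: "'j \<Rightarrow> complex"
  assumes "finite J" and orth: "\<And>j k. j \<in> J \<Longrightarrow> k \<in> J \<Longrightarrow> (\<Sum>q\<in>I. e j q * cnj (e k q)) = of_bool (j = k)"
  shows "(\<Sum>q\<in>I. (cmod (\<Sum>j\<in>J. v j * cnj (e j q)))\<^sup>2) = (\<Sum>j\<in>J. (cmod (v j))\<^sup>2)"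
proof -
  have "complex_of_real (\<Sum>q\<in>I. (cmod (\<Sum>j\<in>J. v j * cnj (e j q)))\<^sup>2)
      = (\<Sum>q\<in>I. \<Sum>j\<in>J. \<Sum>k\<in>J. v j * cnj (v k) * (e k q * cnj (e j q)))"
    unfolding of_real_sum complex_norm_square cnj_sum sum_product
    by (intro sum.cong refl) (simp add: mult_ac)
  also have "\<dots> = (\<Sum>j\<in>J. \<Sum>k\<in>J. \<Sum>q\<in>I. v j * cnj (v k) * (e k q * cnj (e j q)))"
    by (subst sum.swap) (rule sum.cong[OF refl sum.swap])
  also have "\<dots> = (\<Sum>j\<in>J. \<Sum>k\<in>J. v j * cnj (v k) * of_bool (k = j))"
    using orth by (simp flip: sum_distrib_left)
  also have "\<dots> = (\<Sum>j\<in>J. v j * cnj (v j))"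
    using assms(1) by (intro sum.cong refl) (simp add: of_bool_def sum.delta' if_distrib cong: if_cong)
  also have "\<dots> = complex_of_real (\<Sum>j\<in>J. (cmod (v j))\<^sup>2)"
    unfolding of_real_sum complex_norm_square ..
  finally show ?thesis by (simp only: of_real_eq_iff)
qed

text \<open>Cauchy-Schwarz in \<open>j\<close>, with the weight split as
  \<open>sqrt \<bar>b j\<bar> * sqrt \<bar>b j\<bar>\<close>, bounds each squared entry by a product
  \<open>w p * w q\<close>, so the double sum factors into a square.\<close>

lemma weighted_gram_bound:
  fixes b :: "'j \<Rightarrow> real" and r :: "'j \<Rightarrow> 'i \<Rightarrow> complex"
  shows "(\<Sum>p\<in>I. \<Sum>q\<in>I. (\<Sum>j\<in>J. b j * Re (r j p * cnj (r j q)))\<^sup>2)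
    \<le> (\<Sum>j\<in>J. \<bar>b j\<bar> * (\<Sum>p\<in>I. (cmod (r j p))\<^sup>2))\<^sup>2"
proof -
  define w where "w p = (\<Sum>j\<in>J. \<bar>b j\<bar> * (cmod (r j p))\<^sup>2)" for p
  have "(\<Sum>j\<in>J. b j * Re (r j p * cnj (r j q)))\<^sup>2 \<le> w p * w q" for p q
  proof -
    have "\<bar>\<Sum>j\<in>J. b j * Re (r j p * cnj (r j q))\<bar> \<le> (\<Sum>j\<in>J. \<bar>b j\<bar> * (cmod (r j p) * cmod (r j q)))"
    proof (intro order_trans[OF sum_abs] sum_mono)
      fix j
      have "\<bar>Re (r j p * cnj (r j q))\<bar> \<le> cmod (r j p) * cmod (r j q)"
        by (rule order_trans[OF abs_Re_le_cmod]) (simp add: norm_mult)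
      then show "\<bar>b j * Re (r j p * cnj (r j q))\<bar> \<le> \<bar>b j\<bar> * (cmod (r j p) * cmod (r j q))"
        unfolding abs_mult by (intro mult_left_mono) auto
    qed
    then have "(\<Sum>j\<in>J. b j * Re (r j p * cnj (r j q)))\<^sup>2 \<le> (\<Sum>j\<in>J. \<bar>b j\<bar> * (cmod (r j p) * cmod (r j q)))\<^sup>2"
      by (subst power2_abs[symmetric]) (intro power_mono, auto)
    also have "\<dots> = (\<Sum>j\<in>J. (sqrt \<bar>b j\<bar> * cmod (r j p)) * (sqrt \<bar>b j\<bar> * cmod (r j q)))\<^sup>2"
      by (intro arg_cong[where f = "\<lambda>x. x\<^sup>2"] sum.cong) (auto simp: algebra_simps)
    also have "\<dots> \<le> w p * w q"
      unfolding w_def by (rule order_trans[OF Cauchy_Schwarz_ineq_sum]) (simp add: power_mult_distrib)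
    finally show ?thesis .
  qed
  then have "(\<Sum>p\<in>I. \<Sum>q\<in>I. (\<Sum>j\<in>J. b j * Re (r j p * cnj (r j q)))\<^sup>2) \<le> (\<Sum>p\<in>I. \<Sum>q\<in>I. w p * w q)"
    by (intro sum_mono)
  also have "\<dots> = (\<Sum>p\<in>I. w p)\<^sup>2"
    by (simp add: power2_eq_square sum_product)
  also have "(\<Sum>p\<in>I. w p) = (\<Sum>j\<in>J. \<bar>b j\<bar> * (\<Sum>p\<in>I. (cmod (r j p))\<^sup>2))"
    unfolding w_def by (subst sum.swap) (simp add: sum_distrib_left)
  finally show ?thesis .
qed

text \<open>The constants come from \<open>(x + y + z)^2 \<le> 3 * (x^2 + y^2 + z^2)\<close>; the 6
  counts the two cross terms, which are transposes of each other and have the same norm.\<close>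

lemma frobenius_bound:
  fixes b :: "'j \<Rightarrow> real" and c e :: "'j \<Rightarrow> 'i \<Rightarrow> complex"
  assumes "finite J" and orth: "\<And>j k. j \<in> J \<Longrightarrow> k \<in> J \<Longrightarrow> (\<Sum>q\<in>I. e j q * cnj (e k q)) = of_bool (j = k)"
  defines "\<rho> \<equiv> \<lambda>j. \<Sum>p\<in>I. (cmod (c j p - e j p))\<^sup>2"
  shows "(\<Sum>p\<in>I. \<Sum>q\<in>I. (\<Sum>j\<in>J. b j * (Re (c j p * cnj (c j q)) - Re (e j p * cnj (e j q))))\<^sup>2)
    \<le> 3 * (\<Sum>j\<in>J. \<bar>b j\<bar> * \<rho> j)\<^sup>2 + 6 * (\<Sum>j\<in>J. (b j)\<^sup>2 * \<rho> j)"
proof -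
  define r where "r j p = c j p - e j p" for j p
  define P where "P p q = (\<Sum>j\<in>J. b j * Re (r j p * cnj (r j q)))" for p q
  define T where "T p q = (\<Sum>j\<in>J. b j * Re (r j p * cnj (e j q)))" for p q
  \<comment> \<open>Real parts are invariant under conjugation, so the term with \<open>e\<close> in
    front and \<open>r\<close> conjugated is the transpose of \<open>T\<close>.\<close>
  have split: "(\<Sum>j\<in>J. b j * (Re (c j p * cnj (c j q)) - Re (e j p * cnj (e j q)))) = P p q + T p q + T q p" for p q
    unfolding P_def T_def sum.distrib[symmetric] r_def by (intro sum.cong refl) (simp add: algebra_simps)
  have sq: "(x + y + z)\<^sup>2 \<le> 3 * (x\<^sup>2 + y\<^sup>2 + z\<^sup>2)" for x y z :: real
    using sum_squares_bound[of x y] sum_squares_bound[of x z] sum_squares_bound[of y z]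
    by (simp add: power2_eq_square algebra_simps)
  \<comment> \<open>In a fixed row \<open>p\<close>, the entries are real parts of the combination
    of the orthonormal vectors \<open>cnj (e j)\<close> with coefficients
    \<open>b j * r j p\<close>; Parseval in \<open>q\<close> leaves no mixed terms in
    \<open>j\<close>.\<close>
  have TT: "(\<Sum>p\<in>I. \<Sum>q\<in>I. (T p q)\<^sup>2) \<le> (\<Sum>j\<in>J. (b j)\<^sup>2 * \<rho> j)"
  proof -
    have "(\<Sum>q\<in>I. (T p q)\<^sup>2) \<le> (\<Sum>j\<in>J. (b j)\<^sup>2 * (cmod (r j p))\<^sup>2)" for p
    proof -
      have "T p q = Re (\<Sum>j\<in>J. (of_real (b j) * r j p) * cnj (e j q))" for q
        by (simp add: T_def mult.assoc)
      then have "(T p q)\<^sup>2 \<le> (cmod (\<Sum>j\<in>J. (of_real (b j) * r j p) * cnj (e j q)))\<^sup>2" for q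
        by (metis abs_Re_le_cmod power2_abs power_mono abs_ge_zero)
      then have "(\<Sum>q\<in>I. (T p q)\<^sup>2) \<le> (\<Sum>q\<in>I. (cmod (\<Sum>j\<in>J. (of_real (b j) * r j p) * cnj (e j q)))\<^sup>2)"
        by (intro sum_mono)
      also have "\<dots> = (\<Sum>j\<in>J. (cmod (of_real (b j) * r j p))\<^sup>2)"
        by (rule sum_power2_orthonormal[OF assms(1) orth])
      finally show ?thesis by (simp add: norm_mult power_mult_distrib)
    qed
    then have "(\<Sum>p\<in>I. \<Sum>q\<in>I. (T p q)\<^sup>2) \<le> (\<Sum>p\<in>I. \<Sum>j\<in>J. (b j)\<^sup>2 * (cmod (r j p))\<^sup>2)"
      by (intro sum_mono)
    also have "\<dots> = (\<Sum>j\<in>J. (b j)\<^sup>2 * \<rho> j)"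
      unfolding \<rho>_def r_def by (subst sum.swap) (simp add: sum_distrib_left)
    finally show ?thesis .
  qed
  have "(\<Sum>p\<in>I. \<Sum>q\<in>I. (P p q + T p q + T q p)\<^sup>2)
      \<le> (\<Sum>p\<in>I. \<Sum>q\<in>I. 3 * ((P p q)\<^sup>2 + (T p q)\<^sup>2 + (T q p)\<^sup>2))"
    by (intro sum_mono sq)
  also have "\<dots> = 3 * ((\<Sum>p\<in>I. \<Sum>q\<in>I. (P p q)\<^sup>2) + (\<Sum>p\<in>I. \<Sum>q\<in>I. (T p q)\<^sup>2) + (\<Sum>p\<in>I. \<Sum>q\<in>I. (T q p)\<^sup>2))"
    by (simp add: sum.distrib sum_distrib_left)
  also have "(\<Sum>p\<in>I. \<Sum>q\<in>I. (T q p)\<^sup>2) = (\<Sum>p\<in>I. \<Sum>q\<in>I. (T p q)\<^sup>2)"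
    by (rule sum.swap)
  also have "3 * ((\<Sum>p\<in>I. \<Sum>q\<in>I. (P p q)\<^sup>2) + (\<Sum>p\<in>I. \<Sum>q\<in>I. (T p q)\<^sup>2) + (\<Sum>p\<in>I. \<Sum>q\<in>I. (T p q)\<^sup>2))
      \<le> 3 * ((\<Sum>j\<in>J. \<bar>b j\<bar> * \<rho> j)\<^sup>2 + (\<Sum>j\<in>J. (b j)\<^sup>2 * \<rho> j) + (\<Sum>j\<in>J. (b j)\<^sup>2 * \<rho> j))"
    using weighted_gram_bound[of b r J I] TT by (simp add: P_def \<rho>_def r_def)
  finally show ?thesis unfolding split by simp
qed

section \<open>Parseval and convolutions\<close>

lemma integral_cis_int:
  fixes m :: int
  shows "integrable (lebesgue_on {-pi..pi}) (\<lambda>x. cis (real_of_int m * x))"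
    and "(\<integral>x. cis (real_of_int m * x) \<partial>lebesgue_on {-pi..pi}) = of_bool (m = 0) * of_real (2 * pi)"
proof -
  have cont: "continuous_on {-pi..pi} (\<lambda>x. cis (real_of_int m * x))"
    by (intro continuous_intros)
  show int: "integrable (lebesgue_on {-pi..pi}) (\<lambda>x. cis (real_of_int m * x))"
    by (rule continuous_imp_integrable_real[OF cont])
  have "((\<lambda>x. cis (real_of_int m * x)) has_integral of_bool (m = 0) * of_real (2 * pi)) {-pi..pi}"
  proof (cases "m = 0")
    case True
    then show ?thesis using has_integral_const_real[of "1 :: complex" "-pi" pi] by (simp add: scaleR_conv_of_real)
  next
    case False
    let ?F = "\<lambda>x. - \<i> / of_int m * cis (real_of_int m * x)"
    have "((\<lambda>x. cis (real_of_int m * x)) has_integral ?F pi - ?F (-pi)) {-pi..pi}"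
      using False
      by (intro fundamental_theorem_of_calculus)
        (auto simp: cis_conv_exp intro!: derivative_eq_intros has_vector_derivative_real_field)
    moreover have "cis (real_of_int m * (-pi)) = cis (real_of_int m * pi)"
      using sin_int_times_real by (simp add: complex_eq_iff mult.commute)
    ultimately show ?thesis using False by simp
  qed
  then show "(\<integral>x. cis (real_of_int m * x) \<partial>lebesgue_on {-pi..pi}) = of_bool (m = 0) * of_real (2 * pi)"
    using lebesgue_integral_eq_integral[OF int] by (simp add: integral_unique)
qed

lemma parseval_finite:
  fixes c :: "int \<Rightarrow> complex"
  assumes "finite I"
  shows "(\<integral>x. (cmod (\<Sum>p\<in>I. c p * cis (- (real_of_int p * x))))\<^sup>2 \<partial>lebesgue_on {-pi..pi})
    = 2 * pi * (\<Sum>p\<in>I. (cmod (c p))\<^sup>2)"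
proof -
  let ?L = "lebesgue_on {-pi..pi}"
  have eq: "complex_of_real ((cmod (\<Sum>p\<in>I. c p * cis (- (real_of_int p * x))))\<^sup>2)
      = (\<Sum>p\<in>I. \<Sum>q\<in>I. c p * cnj (c q) * cis (real_of_int (q - p) * x))" for x
  proof -
    have "(v * cis (- (real_of_int p * x))) * cnj (w * cis (- (real_of_int q * x)))
        = v * cnj w * cis (real_of_int (q - p) * x)" for v w p q
    proof -
      have "cis (- (real_of_int p * x)) * cis (real_of_int q * x) = cis (real_of_int (q - p) * x)"
        by (simp add: cis_mult algebra_simps)
      then show ?thesis by (simp add: cis_cnj mult_ac) 
    qed
    then show ?thesis
      unfolding complex_norm_square cnj_sum sum_product by (intro sum.cong refl)
  qed
  have "complex_of_real (\<integral>x. (cmod (\<Sum>p\<in>I. c p * cis (- (real_of_int p * x))))\<^sup>2 \<partial>?L)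
      = (\<integral>x. (\<Sum>p\<in>I. \<Sum>q\<in>I. c p * cnj (c q) * cis (real_of_int (q - p) * x)) \<partial>?L)"
    unfolding eq[symmetric] by (rule integral_complex_of_real[symmetric])
  also have "\<dots> = (\<Sum>p\<in>I. \<Sum>q\<in>I. c p * cnj (c q) * (of_bool (q - p = 0) * of_real (2 * pi)))"
    using integral_cis_int by (simp del: of_int_diff)
  also have "\<dots> = (\<Sum>p\<in>I. c p * cnj (c p) * of_real (2 * pi))"
  proof (intro sum.cong refl)
    fix p assume "p \<in> I"
    have "(\<Sum>q\<in>I. c p * cnj (c q) * (of_bool (q - p = 0) * of_real (2 * pi)))
        = (\<Sum>q\<in>I. if q = p then c p * cnj (c q) * of_real (2 * pi) else 0)"
      by (intro sum.cong refl) simp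
    also have "\<dots> = c p * cnj (c p) * of_real (2 * pi)"
      using assms \<open>p \<in> I\<close> by simp
    finally show "(\<Sum>q\<in>I. c p * cnj (c q) * (of_bool (q - p = 0) * of_real (2 * pi))) = c p * cnj (c p) * of_real (2 * pi)" .
  qed
  also have "\<dots> = complex_of_real (2 * pi * (\<Sum>p\<in>I. (cmod (c p))\<^sup>2))"
    unfolding of_real_mult of_real_sum complex_norm_square sum_distrib_left by (simp add: mult_ac)
  finally show ?thesis by (simp only: of_real_eq_iff)
qed

text \<open>The window \<open>{1 - int N..int n}\<close> contains every noise index
  \<open>t - k\<close> with \<open>1 \<le> t \<le> n\<close> and \<open>0 \<le> k < N\<close>. Being
  the same for all \<open>t\<close>, it lets all linear forms share one index set.\<close>

lemma sum_shift_support: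
  fixes h :: "int \<Rightarrow> 'a :: comm_monoid_add"
  assumes "t \<in> {1..n}" and supp: "\<And>k. k \<notin> {0..<int N} \<Longrightarrow> h k = 0"
  shows "(\<Sum>p\<in>{1 - int N..int n}. h (int t - p)) = (\<Sum>k<N. h (int k))"
proof -
  have "(\<Sum>p\<in>{1 - int N..int n}. h (int t - p)) = (\<Sum>p\<in>{int t - int N<..int t}. h (int t - p))"
    using assms by (intro sum.mono_neutral_right) auto
  also have "\<dots> = (\<Sum>k<N. h (int k))"
    by (rule sum.reindex_bij_witness[where i = "\<lambda>k. int t - int k" and j = "\<lambda>p. nat (int t - p)"]) auto
  finally show ?thesis .
qed

text \<open>Transforms turn convolutions into products. Transforming in \<open>p\<close> with
  \<open>cis (- p x)\<close> shifts the frequency \<open>u\<close> of the exponential sum to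
  \<open>u - x\<close>, which produces the Dirichlet kernel centered at \<open>u\<close>.\<close>

lemma convolution_transform:
  fixes \<alpha> :: "int \<Rightarrow> complex"
  assumes supp: "\<And>k. k \<notin> {0..<int N} \<Longrightarrow> \<alpha> k = 0"
  shows "(\<Sum>p\<in>{1 - int N..int n}. (\<Sum>t=1..n. cis (real t * u) * \<alpha> (int t - p)) * cis (- (real_of_int p * x)))
    = (\<Sum>t=1..n. cis (real t * (u - x))) * (\<Sum>k<N. \<alpha> (int k) * cis (real k * x))"
proof -
  have "(\<Sum>p\<in>{1 - int N..int n}. (\<Sum>t=1..n. cis (real t * u) * \<alpha> (int t - p)) * cis (- (real_of_int p * x)))
    = (\<Sum>p\<in>{1 - int N..int n}. \<Sum>t=1..n. cis (real t * (u - x)) * (\<alpha> (int t - p) * cis (real_of_int (int t - p) * x)))"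
    unfolding sum_distrib_right
  proof (intro sum.cong refl)
    fix p t
    have "cis (real t * u) * cis (- (real_of_int p * x)) = cis (real t * (u - x)) * cis (real_of_int (int t - p) * x)"
      by (simp add: cis_mult algebra_simps)
    then show "cis (real t * u) * \<alpha> (int t - p) * cis (- (real_of_int p * x))
        = cis (real t * (u - x)) * (\<alpha> (int t - p) * cis (real_of_int (int t - p) * x))"
      by (metis (no_types, lifting) mult.assoc mult.commute)
  qed
  also have "\<dots> = (\<Sum>t=1..n. cis (real t * (u - x)) * (\<Sum>p\<in>{1 - int N..int n}. \<alpha> (int t - p) * cis (real_of_int (int t - p) * x)))"
    by (subst sum.swap) (simp only: sum_distrib_left)
  also have "\<dots> = (\<Sum>t=1..n. cis (real t * (u - x)) * (\<Sum>k<N. \<alpha> (int k) * cis (real k * x)))"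
  proof (intro sum.cong refl arg_cong[where f = "(*) _"])
    fix t assume "t \<in> {1..n}"
    then show "(\<Sum>p\<in>{1 - int N..int n}. \<alpha> (int t - p) * cis (real_of_int (int t - p) * x)) = (\<Sum>k<N. \<alpha> (int k) * cis (real k * x))"
      using sum_shift_support[of t n N "\<lambda>k. \<alpha> k * cis (real_of_int k * x)"] supp by simp
  qed
  finally show ?thesis by (simp only: sum_distrib_right)
qed

section \<open>Weighted sums\<close>

text \<open>
  Cauchy-Schwarz is used twice, after bounding one factor \<open>sqrt (\<beta> j)\<close> by \<open>sqrt b\<close>. For
  \<open>l j = j powr (- 7 / 24)\<close> the sums of \<open>l j ^ 4\<close> converge, while \<open>l j ^ 3\<close> dominates \<open>ln j / j\<close>.
\<close>

lemma weighted_sum_interpolation: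
  fixes \<beta> l :: "'j \<Rightarrow> real"
  assumes "finite J" and \<beta>: "\<And>j. j \<in> J \<Longrightarrow> 0 \<le> \<beta> j \<and> \<beta> j \<le> b"
    and l: "\<And>j. j \<in> J \<Longrightarrow> 0 \<le> l j" and S: "(\<Sum>j\<in>J. l j ^ 4) \<le> S" and "0 \<le> b"
  shows "(\<Sum>j\<in>J. \<beta> j * l j ^ 3)\<^sup>2 \<le> S * sqrt S * b * sqrt (\<Sum>j\<in>J. (\<beta> j)\<^sup>2)"
proof -
  let ?B = "sqrt (\<Sum>j\<in>J. (\<beta> j)\<^sup>2)" and ?s = "\<Sum>j\<in>J. l j ^ 4"
  have s0: "0 \<le> ?s" by (intro sum_nonneg) simp
  have B0: "0 \<le> ?B" by (simp add: sum_nonneg)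
  have 1: "(\<Sum>j\<in>J. \<beta> j * (l j)\<^sup>2) \<le> ?B * sqrt S"
  proof -
    have "(\<Sum>j\<in>J. \<beta> j * (l j)\<^sup>2)\<^sup>2 \<le> (\<Sum>j\<in>J. (\<beta> j)\<^sup>2) * ?s"
      using Cauchy_Schwarz_ineq_sum[of \<beta> "\<lambda>j. (l j)\<^sup>2" J] by (simp flip: power_mult)
    also have "\<dots> \<le> (\<Sum>j\<in>J. (\<beta> j)\<^sup>2) * S"
      using S by (intro mult_left_mono sum_nonneg) auto
    finally show ?thesis
      by (simp add: real_le_rsqrt flip: real_sqrt_mult)
  qed
  have 2: "(\<Sum>j\<in>J. sqrt (\<beta> j) * l j ^ 3)\<^sup>2 \<le> (?B * sqrt S) * S"
  proof -
    have "(\<Sum>j\<in>J. sqrt (\<beta> j) * l j ^ 3)\<^sup>2 = (\<Sum>j\<in>J. (sqrt (\<beta> j) * l j) * (l j)\<^sup>2)\<^sup>2"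
      by (simp add: power2_eq_square power3_eq_cube mult.assoc)
    also have "\<dots> \<le> (\<Sum>j\<in>J. (sqrt (\<beta> j) * l j)\<^sup>2) * (\<Sum>j\<in>J. ((l j)\<^sup>2)\<^sup>2)"
      by (rule Cauchy_Schwarz_ineq_sum)
    also have "\<dots> = (\<Sum>j\<in>J. \<beta> j * (l j)\<^sup>2) * ?s"
      using \<beta> by (simp add: power_mult_distrib flip: power_mult)
    also have "\<dots> \<le> (?B * sqrt S) * S"
      using 1 S s0 B0 by (intro mult_mono) auto
    finally show ?thesis .
  qed
  have "(\<Sum>j\<in>J. \<beta> j * l j ^ 3) \<le> (\<Sum>j\<in>J. sqrt b * (sqrt (\<beta> j) * l j ^ 3))"
  proof (intro sum_mono)
    fix j assume j: "j \<in> J"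
    have "\<beta> j = sqrt (\<beta> j) * sqrt (\<beta> j)" using \<beta>[OF j] by simp
    also have "\<dots> \<le> sqrt b * sqrt (\<beta> j)" using \<beta>[OF j] by (intro mult_right_mono) auto
    finally show "\<beta> j * l j ^ 3 \<le> sqrt b * (sqrt (\<beta> j) * l j ^ 3)"
      using l[OF j] by (metis mult.assoc mult_right_mono zero_le_power)
  qed
  moreover have "0 \<le> (\<Sum>j\<in>J. \<beta> j * l j ^ 3)"
    using \<beta> l by (intro sum_nonneg) auto
  ultimately have "(\<Sum>j\<in>J. \<beta> j * l j ^ 3)\<^sup>2 \<le> (sqrt b * (\<Sum>j\<in>J. sqrt (\<beta> j) * l j ^ 3))\<^sup>2"
    by (intro power_mono) (auto simp: sum_distrib_left)
  also have "\<dots> = b * (\<Sum>j\<in>J. sqrt (\<beta> j) * l j ^ 3)\<^sup>2"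
    using \<open>0 \<le> b\<close> by (simp add: power_mult_distrib)
  also have "\<dots> \<le> b * ((?B * sqrt S) * S)"
    using 2 \<open>0 \<le> b\<close> by (intro mult_left_mono) auto
  finally show ?thesis by (simp add: mult_ac)
qed

text \<open>The order of the bias at the \<open>k\<close>-th frequency. The summand 1 keeps the
  function above \<open>1 / k\<close>, so that it also dominates the bound for \<rho>.\<close>

definition log_weight :: "nat \<Rightarrow> real" where
  "log_weight k = (1 + ln (real k)) / real k"

lemma log_weight_ge: "1 \<le> k \<Longrightarrow> 1 / real k \<le> log_weight k"
  unfolding log_weight_def by (intro divide_right_mono) auto

text \<open>For \<open>l = k powr (- s)\<close> one needs \<open>3 * s < 1\<close>, to leave room
  for the logarithm, and \<open>4 * s > 1\<close>, for convergence; 7/24 is the midpoint of 1/4 and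
  1/3. The room is \<open>1 - 7/8 = 1/8\<close>, and \<open>ln k \<le> 8 * k powr (1/8)\<close>
  gives \<open>9 = 1 + 8\<close>.\<close>

lemma log_weight_le_powr:
  assumes "1 \<le> k"
  shows "log_weight k \<le> 9 * (real k powr (- 7 / 24)) ^ 3"
proof -
  have "ln (real k) \<le> 8 * real k powr (1 / 8)"
    using ln_powr_bound[of "real k" "1 / 8"] assms by simp
  moreover have "1 \<le> real k powr (1 / 8)"
    using assms by (intro ge_one_powr_ge_zero) auto
  ultimately have "log_weight k \<le> (9 * real k powr (1 / 8)) / real k"
    unfolding log_weight_def by (intro divide_right_mono) auto
  also have "\<dots> = 9 * real k powr (1 / 8 - 1)"
    unfolding powr_diff using assms by simp
  also have "real k powr (1 / 8 - 1) = (real k powr (- 7 / 24)) ^ 3"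
    using assms by (simp add: powr_power)
  finally show ?thesis by simp
qed

text \<open>The reflected half is the other half for the reversed weights, which obey the same bound
  \<open>b\<close> and have the same L2 norm. \<open>K\<close> is independent of \<open>m\<close>
  because \<open>S\<close> is a full convergent series.\<close>

lemma log_weight_sum_bound:
  obtains K where "0 \<le> K"
    and "\<And>m \<beta> b. (\<And>j. j \<in> {1..m} \<Longrightarrow> 0 \<le> \<beta> j \<and> \<beta> j \<le> b) \<Longrightarrow> 0 \<le> b \<Longrightarrow>
      (\<Sum>j=1..m. \<beta> j * (log_weight j + log_weight (m + 1 - j)))\<^sup>2 \<le> K * b * sqrt (\<Sum>j=1..m. (\<beta> j)\<^sup>2)"
proof -
  define l where "l k = real k powr (- 7 / 24)" for k :: nat
  define S where "S = (\<Sum>k. real k powr (- 7 / 6))"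
  have l4: "l k ^ 4 = real k powr (- 7 / 6)" for k
    by (cases "k = 0") (simp_all add: l_def powr_power)
  have S: "(\<Sum>j=1..m. l j ^ 4) \<le> S" for m
    unfolding S_def l4 by (intro sum_le_suminf) (auto simp: summable_real_powr_iff)
  have S0: "0 \<le> S" using S[of 0] by simp
  have one: "(\<Sum>j=1..m. \<beta> j * log_weight j)\<^sup>2 \<le> 81 * (S * sqrt S * b * sqrt (\<Sum>j=1..m. (\<beta> j)\<^sup>2))"
    if \<beta>: "\<And>j. j \<in> {1..m} \<Longrightarrow> 0 \<le> \<beta> j \<and> \<beta> j \<le> b" and "0 \<le> b" for m \<beta> b
  proof -
    have "(\<Sum>j=1..m. \<beta> j * log_weight j) \<le> (\<Sum>j=1..m. \<beta> j * (9 * l j ^ 3))"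
      unfolding l_def using \<beta> log_weight_le_powr by (intro sum_mono mult_left_mono) auto
    moreover have "0 \<le> (\<Sum>j=1..m. \<beta> j * log_weight j)"
      unfolding log_weight_def using \<beta> by (intro sum_nonneg mult_nonneg_nonneg divide_nonneg_nonneg add_nonneg_nonneg) auto
    ultimately have "(\<Sum>j=1..m. \<beta> j * log_weight j)\<^sup>2 \<le> (\<Sum>j=1..m. \<beta> j * (9 * l j ^ 3))\<^sup>2"
      by (intro power_mono)
    also have "\<dots> = 81 * (\<Sum>j=1..m. \<beta> j * l j ^ 3)\<^sup>2"
      by (simp add: mult.left_commute[of _ 9] power_mult_distrib flip: sum_distrib_left)
    also have "\<dots> \<le> 81 * (S * sqrt S * b * sqrt (\<Sum>j=1..m. (\<beta> j)\<^sup>2))"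
      using \<beta> S \<open>0 \<le> b\<close> by (intro mult_left_mono weighted_sum_interpolation) (auto simp: l_def)
    finally show ?thesis .
  qed
  show ?thesis
  proof
    \<comment> \<open>The square of the constant 9 is 81, and
      \<open>(x + y)^2 \<le> 2 * x^2 + 2 * y^2\<close> with equal bounds on both squares adds a
      factor 4.\<close>
    show "0 \<le> 324 * (S * sqrt S)" using S0 by simp
    fix m :: nat and \<beta> :: "nat \<Rightarrow> real" and b :: real
    assume \<beta>: "\<And>j. j \<in> {1..m} \<Longrightarrow> 0 \<le> \<beta> j \<and> \<beta> j \<le> b" and b: "0 \<le> b"
    have rev: "(\<Sum>j=1..m. f (m + 1 - j)) = (\<Sum>j=1..m. f j)" for f :: "nat \<Rightarrow> real"
      by (rule sum.reindex_bij_witness[of _ "\<lambda>j. m + 1 - j" "\<lambda>j. m + 1 - j"]) auto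
    define x where "x = (\<Sum>j=1..m. \<beta> j * log_weight j)"
    define y where "y = (\<Sum>j=1..m. \<beta> j * log_weight (m + 1 - j))"
    have y: "y = (\<Sum>j=1..m. \<beta> (m + 1 - j) * log_weight j)"
      unfolding y_def by (subst rev[symmetric]) (intro sum.cong, auto)
    have "x\<^sup>2 \<le> 81 * (S * sqrt S * b * sqrt (\<Sum>j=1..m. (\<beta> j)\<^sup>2))"
      unfolding x_def by (rule one[OF \<beta> b])
    moreover have "y\<^sup>2 \<le> 81 * (S * sqrt S * b * sqrt (\<Sum>j=1..m. (\<beta> j)\<^sup>2))"
    proof -
      have "y\<^sup>2 \<le> 81 * (S * sqrt S * b * sqrt (\<Sum>j=1..m. (\<beta> (m + 1 - j))\<^sup>2))"
        unfolding y
      proof (rule one[OF _ b])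
        fix j assume "j \<in> {1..m}"
        then have "m + 1 - j \<in> {1..m}" by auto
        then show "0 \<le> \<beta> (m + 1 - j) \<and> \<beta> (m + 1 - j) \<le> b" by (rule \<beta>)
      qed
      then show ?thesis by (simp only: rev[of "\<lambda>j. (\<beta> j)\<^sup>2"])
    qed
    moreover have "(x + y)\<^sup>2 \<le> 2 * x\<^sup>2 + 2 * y\<^sup>2"
      using sum_squares_bound[of x y] by (simp add: power2_sum)
    moreover have "(\<Sum>j=1..m. \<beta> j * (log_weight j + log_weight (m + 1 - j))) = x + y"
      by (simp add: x_def y_def distrib_left sum.distrib)
    ultimately show "(\<Sum>j=1..m. \<beta> j * (log_weight j + log_weight (m + 1 - j)))\<^sup>2
        \<le> 324 * (S * sqrt S) * b * sqrt (\<Sum>j=1..m. (\<beta> j)\<^sup>2)"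
      by simp
  qed
qed

lemma sum_inverse_le_ln:
  assumes "1 \<le> m" shows "(\<Sum>j=1..m. 1 / real j) \<le> 1 + ln (real m)"
proof -
  obtain k where k: "m = Suc k" using assms by (cases m) auto
  have "harm (Suc k) - ln (real (Suc k)) \<le> harm (Suc 0) - ln (real (Suc 0))"
    using decseqD[OF decseq_harm_diff_ln, of 0 k] by simp
  then show ?thesis by (simp add: k harm_def inverse_eq_divide)
qed

lemma sum_reflected_le_ln:
  assumes "1 \<le> m" and "m \<le> n" and "4 \<le> n"
  shows "(\<Sum>j=1..m. 1 / real j + 1 / real (m + 1 - j)) \<le> 4 * ln (real n)"
    and "(\<Sum>j=1..m. log_weight j + log_weight (m + 1 - j)) \<le> 8 * (ln (real n))\<^sup>2"
proof -
  have rev: "(\<Sum>j=1..m. f (m + 1 - j)) = (\<Sum>j=1..m. f j)" for f :: "nat \<Rightarrow> real"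
    by (rule sum.reindex_bij_witness[of _ "\<lambda>j. m + 1 - j" "\<lambda>j. m + 1 - j"]) auto
  \<comment> \<open>\<open>4 \<le> n\<close> is used here: \<open>ln n \<ge> 1\<close> absorbs the
    additive constants, so that \<open>1 + ln m\<close> is at most \<open>2 * ln n\<close>.\<close>
  have "exp 1 \<le> real n" using exp_le assms by linarith
  then have n: "1 \<le> ln (real n)" using assms by (subst ln_ge_iff) auto
  have m: "ln (real m) \<le> ln (real n)" using assms by simp
  have 1: "(\<Sum>j=1..m. 1 / real j) \<le> 2 * ln (real n)"
  proof -
    have "1 \<le> m" using assms by simp
    from sum_inverse_le_ln[OF this] m n show ?thesis by linarith
  qed
  show "(\<Sum>j=1..m. 1 / real j + 1 / real (m + 1 - j)) \<le> 4 * ln (real n)"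
    using 1 unfolding sum.distrib rev[of "\<lambda>j. 1 / real j"] by simp
  have "log_weight j \<le> 2 * ln (real n) * (1 / real j)" if "j \<in> {1..m}" for j
  proof -
    have "ln (real j) \<le> ln (real n)" using that assms by simp
    then have "1 + ln (real j) \<le> 2 * ln (real n)" using n by simp
    then show ?thesis unfolding log_weight_def using that by (simp add: divide_right_mono)
  qed
  then have "(\<Sum>j=1..m. log_weight j) \<le> (\<Sum>j=1..m. 2 * ln (real n) * (1 / real j))"
    by (intro sum_mono)
  also have "\<dots> = 2 * ln (real n) * (\<Sum>j=1..m. 1 / real j)"
    by (simp only: sum_distrib_left)
  also have "\<dots> \<le> 2 * ln (real n) * (2 * ln (real n))"
    using 1 n by (intro mult_left_mono) auto
  finally show "(\<Sum>j=1..m. log_weight j + log_weight (m + 1 - j)) \<le> 8 * (ln (real n))\<^sup>2"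
    unfolding sum.distrib rev[of log_weight] by (simp add: power2_eq_square)
qed

section \<open>The Dirichlet kernel\<close>

text \<open>A crude Jordan inequality. Up to \<pi>/6 the slope of the sine is at least 1/2; beyond,
  the sine is at least 1/2 and \<open>x / 4\<close> is at most \<pi>/8.\<close>

lemma sin_ge_quarter:
  fixes x :: real
  assumes "0 \<le> x" "x \<le> pi / 2"
  shows "x / 4 \<le> sin x"
proof (cases "x \<le> pi / 6")
  case True
  show ?thesis
  proof (cases "x = 0")
    case False
    then have "0 < x" using assms by simp
    then obtain z where z: "0 < z" "z < x" "sin x - sin 0 = (x - 0) * cos z"
      using MVT2[of 0 x sin cos] DERIV_sin by blast
    have "cos (pi / 3) \<le> cos z"
      using z True pi_gt_zero by (intro cos_monotone_0_pi_le) auto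
    then have "1 / 4 \<le> cos z" by (simp add: cos_60)
    then have "x * (1 / 4) \<le> x * cos z" using \<open>0 < x\<close> by (intro mult_left_mono) auto
    then show ?thesis using z by simp
  qed simp
next
  case False
  then have "sin (pi / 6) \<le> sin x"
    using assms by (intro sin_monotone_2pi_le) auto
  moreover have "x / 4 \<le> 1 / 2" using assms pi_less_4 by simp
  ultimately show ?thesis by (simp add: sin_30)
qed

text \<open>The squared modulus is \<open>n\<close> times the Fejer kernel. Summation starts at 1,
  as in the periodogram, which changes the geometric sum from 0 to n - 1 only by a unimodular
  factor.\<close>

definition dirichlet :: "nat \<Rightarrow> real \<Rightarrow> complex" where
  "dirichlet n y = (\<Sum>t=1..n. cis (real t * y))"

lemma continuous_on_dirichlet [continuous_intros]:
  "continuous_on S f \<Longrightarrow> continuous_on S (\<lambda>x. dirichlet n (f x))"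
  unfolding dirichlet_def by (intro continuous_intros)

lemma dirichlet_le: "cmod (dirichlet n y) \<le> real n"
  unfolding dirichlet_def by (rule order_trans[OF norm_sum]) simp

text \<open>The geometric sum in multiplied-out form, valid also where
  \<open>cis y = 1\<close>.\<close>

lemma dirichlet_telescope: "(1 - cis y) * dirichlet n y = cis y - cis (real (Suc n) * y)"
  unfolding dirichlet_def
proof (induction n)
  case (Suc n)
  have "cis y * cis (real (Suc n) * y) = cis (real (Suc (Suc n)) * y)"
    by (simp add: cis_mult algebra_simps)
  moreover have "(\<Sum>t=1..Suc n. cis (real t * y)) = (\<Sum>t=1..n. cis (real t * y)) + cis (real (Suc n) * y)"
    by simp
  ultimately show ?case
    using Suc by (simp only: distrib_left)
      (simp only: left_diff_distrib mult_1 diff_add_eq add_diff_eq diff_add_cancel add_diff_cancel_right')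
qed simp

lemma norm_one_minus_cis: "cmod (1 - cis y) = 2 * \<bar>sin (y / 2)\<bar>"
proof -
  have "(cmod (1 - cis y))\<^sup>2 = (1 - cos y)\<^sup>2 + (sin y)\<^sup>2"
    by (simp add: cmod_def)
  also have "\<dots> = 2 * (1 - cos y)"
    using sin_cos_squared_add[of y] by (simp add: power2_diff)
  also have "\<dots> = (2 * \<bar>sin (y / 2)\<bar>)\<^sup>2"
    using cos_double_sin[of "y / 2"] by (simp add: power_mult_distrib)
  finally show ?thesis by (rule power2_eq_imp_eq) auto
qed

lemma dirichlet_sin: "cmod (dirichlet n y) * \<bar>sin (y / 2)\<bar> \<le> 1"
proof -
  have "cmod (1 - cis y) * cmod (dirichlet n y) \<le> 2"
    using dirichlet_telescope by (metis (no_types) norm_mult norm_triangle_ineq4 norm_cis one_add_one)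
  then show ?thesis by (simp add: norm_one_minus_cis mult_ac)
qed

text \<open>\<open>n * y\<close> is a multiple of 2 \<pi>, so the right side of the telescoped sum
  vanishes; \<open>\<bar>j - k\<bar> < n\<close> puts |y / 2| strictly between 0 and \<pi>, so the
  factor \<open>1 - cis y\<close> does not.\<close>

lemma dirichlet_freq_zero:
  assumes "j \<noteq> k" "j < n" "k < n"
  shows "dirichlet n (2 * pi * (real j - real k) / real n) = 0"
proof -
  have n: "0 < real n" using assms by simp
  define y where "y = 2 * pi * (real j - real k) / real n"
  have ny: "real (Suc n) * y = y + 2 * pi * of_int (int j - int k)"
    using n by (simp add: y_def field_simps)
  have "cis (real (Suc n) * y) = cis y"
    unfolding ny cis_mult[symmetric] by (simp add: cis_multiple_2pi)
  moreover have "sin (y / 2) \<noteq> 0"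
  proof -
    have "y / 2 = pi * ((real j - real k) / real n)" by (simp add: y_def)
    then have "\<bar>y / 2\<bar> = pi * \<bar>(real j - real k) / real n\<bar>" by (simp only: abs_mult) simp
    moreover have "\<bar>(real j - real k) / real n\<bar> < 1" "0 < \<bar>(real j - real k) / real n\<bar>"
      using assms n by (auto simp: abs_if field_simps)
    ultimately have "0 < \<bar>y / 2\<bar>" "\<bar>y / 2\<bar> < pi"
      using mult_strict_left_mono[of "\<bar>(real j - real k) / real n\<bar>" 1 pi]
        mult_pos_pos[OF pi_gt_zero, of "\<bar>(real j - real k) / real n\<bar>"] by simp_all
    then have "0 < sin \<bar>y / 2\<bar>" by (rule sin_gt_zero)
    then show ?thesis by (cases "0 \<le> y") auto
  qed
  then have "1 - cis y \<noteq> 0" using norm_one_minus_cis[of y] by force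
  ultimately show ?thesis using dirichlet_telescope[of y n] by (simp add: y_def)
qed

text \<open>From |sin (y / 2)| >= |y| / 8 and 8^2 = 64. The product form covers
  \<open>y = 0\<close>.\<close>

lemma dirichlet_bound:
  assumes "\<bar>y\<bar> \<le> pi" shows "(cmod (dirichlet n y))\<^sup>2 * y\<^sup>2 \<le> 64"
proof -
  have "\<bar>y\<bar> / 8 \<le> \<bar>sin (y / 2)\<bar>"
    using sin_ge_quarter[of "\<bar>y\<bar> / 2"] assms by (cases "0 \<le> y") auto
  then have "cmod (dirichlet n y) * (\<bar>y\<bar> / 8) \<le> cmod (dirichlet n y) * \<bar>sin (y / 2)\<bar>"
    by (intro mult_left_mono) auto
  then have "cmod (dirichlet n y) * \<bar>y\<bar> \<le> 8" using dirichlet_sin[of n y] by simp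
  then have "(cmod (dirichlet n y) * \<bar>y\<bar>)\<^sup>2 \<le> 8\<^sup>2" by (intro power_mono) auto
  then show ?thesis by (simp add: power_mult_distrib)
qed

text \<open>Periodicity: beyond \<pi> the distance to 0 on the circle is 2 \<pi> - y. The case
  arises since \<open>u - x\<close> ranges up to 2 \<pi>.\<close>

lemma dirichlet_bound_reflected:
  assumes "pi \<le> y" "y \<le> 2 * pi" shows "(cmod (dirichlet n y))\<^sup>2 * (2 * pi - y)\<^sup>2 \<le> 64"
proof -
  have "cis (real t * y) = cis (real t * (y - 2 * pi))" for t
  proof -
    have "cis (real t * (y - 2 * pi)) = cis (real t * y) * cis (- (2 * pi * real t))"
      by (simp add: cis_mult algebra_simps)
    also have "cis (- (2 * pi * real t)) = 1"
      by (simp add: cis_cnj[symmetric] cis_multiple_2pi)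
    finally show ?thesis by simp
  qed
  then have "dirichlet n y = dirichlet n (y - 2 * pi)" by (simp add: dirichlet_def)
  then show ?thesis using dirichlet_bound[of "y - 2 * pi" n] assms by (simp add: power2_commute)
qed

text \<open>
  \<open>min (n\<^sup>2 y) (64 / y)\<close> is replaced by a single function with antiderivative \<open>ln (1 + n y)\<close>.
\<close>

lemma dirichlet_log_bound:
  assumes "\<bar>y\<bar> \<le> pi"
  shows "\<bar>y\<bar> * (cmod (dirichlet n y))\<^sup>2 \<le> 128 * real n / (1 + real n * \<bar>y\<bar>)"
proof (cases "real n * \<bar>y\<bar> \<le> 1")
  case True
  have "(cmod (dirichlet n y))\<^sup>2 \<le> (real n)\<^sup>2"
    by (intro power_mono dirichlet_le) auto
  then have "\<bar>y\<bar> * (cmod (dirichlet n y))\<^sup>2 \<le> \<bar>y\<bar> * (real n)\<^sup>2"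
    by (intro mult_left_mono) auto
  also have "\<dots> = (real n * \<bar>y\<bar>) * real n" by (simp add: power2_eq_square)
  also have "\<dots> \<le> 1 * real n" using True by (intro mult_right_mono) auto
  also have "\<dots> \<le> 128 * real n / (1 + real n * \<bar>y\<bar>)"
  proof -
    have "real n * (1 + real n * \<bar>y\<bar>) \<le> real n * 128" using True by (intro mult_left_mono) auto
    then show ?thesis by (subst pos_le_divide_eq) (auto simp: add_pos_nonneg)
  qed
  finally show ?thesis .
next
  case False
  then have y: "0 < \<bar>y\<bar>" by auto
  have "\<bar>y\<bar> * (cmod (dirichlet n y))\<^sup>2 * (1 + real n * \<bar>y\<bar>)
      \<le> \<bar>y\<bar> * (cmod (dirichlet n y))\<^sup>2 * (2 * real n * \<bar>y\<bar>)"
    using False by (intro mult_left_mono) (linarith, simp)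
  also have "\<dots> = 2 * real n * ((cmod (dirichlet n y))\<^sup>2 * y\<^sup>2)"
    by (simp add: power2_eq_square)
  also have "\<dots> \<le> 2 * real n * 64"
    using dirichlet_bound[OF assms] by (intro mult_left_mono) auto
  finally show ?thesis by (subst pos_le_divide_eq) (auto simp: add_pos_nonneg)
qed

section \<open>Comparison integrals at the origin, in the tail and near the diagonal\<close>

lemma integral_le_interior:
  fixes f g :: "real \<Rightarrow> real"
  assumes "f integrable_on {a..b}" and g: "(g has_integral I) {a..b}"
    and le: "\<And>x. a < x \<Longrightarrow> x < b \<Longrightarrow> f x \<le> g x"
  shows "integral {a..b} f \<le> I"
proof -
  \<comment> \<open>The pointwise estimates fail to cover \<open>x = 0\<close>, where the spectral
    density is unspecified, and near the diagonal \<open>x = \<pi>\<close>, where differentiability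
    is not assumed. Changing \<open>f\<close> at both endpoints does not affect the
    integral.\<close>
  define f' where "f' = (\<lambda>x. if x = a \<or> x = b then g x else f x)"
  have "(f' has_integral integral {a..b} f) {a..b}"
    using integrable_integral[OF assms(1)]
    by (rule has_integral_spike_finite[rotated -1, of _ _ _ "{a, b}"]) (auto simp: f'_def)
  then show ?thesis
    by (rule has_integral_le[OF _ g]) (use le in \<open>force simp: f'_def\<close>)
qed

text \<open>In the application \<theta> is 2 |d|; \<open>\<theta> < 1\<close> makes the singularity
  at 0 integrable.\<close>

lemma has_integral_powr_at_zero:
  fixes u \<theta> :: real
  assumes "0 < u" "\<theta> < 1"
  obtains I where "((\<lambda>x. (x / u) powr (- \<theta>)) has_integral I) {0..u / 2}" and "I \<le> u / (1 - \<theta>)"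
proof
  have "((\<lambda>x. u powr \<theta> * x powr (- \<theta>)) has_integral u powr \<theta> * ((u / 2) powr (- \<theta> + 1) / (- \<theta> + 1))) {0..u / 2}"
    using assms by (intro has_integral_mult_right has_integral_powr_from_0) auto
  then show "((\<lambda>x. (x / u) powr (- \<theta>)) has_integral u powr \<theta> * ((u / 2) powr (- \<theta> + 1) / (- \<theta> + 1))) {0..u / 2}"
    using assms by (elim has_integral_eq[rotated]) (auto simp: powr_divide powr_minus field_simps)
  have "u powr \<theta> * (u / 2) powr (- \<theta> + 1) \<le> u powr \<theta> * u powr (- \<theta> + 1)"
    using assms by (intro mult_left_mono powr_mono2) auto
  also have "\<dots> = u" using assms by (simp flip: powr_add)
  finally show "u powr \<theta> * ((u / 2) powr (- \<theta> + 1) / (- \<theta> + 1)) \<le> u / (1 - \<theta>)"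
    using assms by (simp add: divide_right_mono)
qed

text \<open>Here \<open>\<theta> < 1\<close> gives convergence at infinity, so the bound is free of
  \<open>e\<close>. Starting no earlier than \<open>u / 2\<close> fixes the scale
  \<open>1 / u\<close>.\<close>

lemma has_integral_powr_tail:
  fixes u \<theta> c e :: real
  assumes "0 < u" "0 \<le> \<theta>" "\<theta> < 1" "u / 2 \<le> c" "c \<le> e"
  obtains I where "((\<lambda>x. (x / u) powr \<theta> / x\<^sup>2) has_integral I) {c..e}" and "I \<le> 2 / (u * (1 - \<theta>))"
proof
  let ?F = "\<lambda>x. - (u powr (- \<theta>) * x powr (\<theta> - 1) / (1 - \<theta>))"
  have "((\<lambda>x. u powr (- \<theta>) * x powr (\<theta> - 2)) has_integral ?F e - ?F c) {c..e}"
  proof (intro fundamental_theorem_of_calculus)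
    fix x assume x: "x \<in> {c..e}"
    define k where "k = - (u powr (- \<theta>) / (1 - \<theta>))"
    have "((\<lambda>x. k * x powr (\<theta> - 1)) has_real_derivative k * ((\<theta> - 1) * x powr (\<theta> - 2))) (at x within {c..e})"
      using assms x by (auto intro!: derivative_eq_intros)
    moreover have "k * ((\<theta> - 1) * y) = u powr (- \<theta>) * y" for y
      using assms by (simp add: k_def divide_simps) (simp add: algebra_simps)
    ultimately show "(?F has_vector_derivative u powr (- \<theta>) * x powr (\<theta> - 2)) (at x within {c..e})"
      unfolding has_real_derivative_iff_has_vector_derivative[symmetric] by (simp add: k_def)
  qed (use assms in simp)
  then show "((\<lambda>x. (x / u) powr \<theta> / x\<^sup>2) has_integral ?F e - ?F c) {c..e}"
    using assms by (elim has_integral_eq[rotated]) (auto simp: powr_divide powr_diff powr_minus field_simps)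
  have "?F e - ?F c \<le> u powr (- \<theta>) * c powr (\<theta> - 1) / (1 - \<theta>)"
    using assms by simp
  also have "\<dots> \<le> u powr (- \<theta>) * (u / 2) powr (\<theta> - 1) / (1 - \<theta>)"
    using assms by (intro divide_right_mono mult_left_mono powr_mono2') auto
  also have "u powr (- \<theta>) * (u / 2) powr (\<theta> - 1) = 2 powr (1 - \<theta>) / u"
    using assms by (simp add: powr_divide powr_diff powr_minus field_simps)
  also have "\<dots> \<le> 2 / u"
    using assms powr_mono[of "1 - \<theta>" 1 2] by (intro divide_right_mono) auto
  finally show "?F e - ?F c \<le> 2 / (u * (1 - \<theta>))"
    using assms by (simp add: divide_right_mono)
qed

text \<open>\<open>2 * pi - u - x\<close> is the length of the arc from \<open>- x\<close> to
  \<open>u\<close> through the point \<pi> of the circle.\<close>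

lemma has_integral_inverse_square:
  fixes u c :: real
  assumes "0 \<le> c" "c \<le> pi" "u < pi"
  obtains I where "((\<lambda>x. 1 / (2 * pi - u - x)\<^sup>2) has_integral I) {c..pi}" and "I \<le> 1 / (pi - u)"
proof
  let ?F = "\<lambda>x. 1 / (2 * pi - u - x)"
  show "((\<lambda>x. 1 / (2 * pi - u - x)\<^sup>2) has_integral ?F pi - ?F c) {c..pi}"
    using assms
    by (intro fundamental_theorem_of_calculus)
      (auto intro!: derivative_eq_intros simp flip: has_real_derivative_iff_has_vector_derivative simp: power2_eq_square)
  have "0 \<le> ?F c" using assms by simp
  then show "?F pi - ?F c \<le> 1 / (pi - u)" by simp
qed

lemma has_integral_log_left:
  fixes n :: nat
  assumes "0 < u"
  shows "((\<lambda>x. real n / (1 + real n * \<bar>u - x\<bar>)) has_integral ln (1 + real n * (u / 2))) {u / 2..u}"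
proof -
  let ?F = "\<lambda>x. - ln (1 + real n * (u - x))"
  have "((\<lambda>x. real n / (1 + real n * (u - x))) has_integral ?F u - ?F (u / 2)) {u / 2..u}"
    using assms
    by (intro fundamental_theorem_of_calculus)
      (auto intro!: derivative_eq_intros add_pos_nonneg simp flip: has_real_derivative_iff_has_vector_derivative)
  then have "((\<lambda>x. real n / (1 + real n * (u - x))) has_integral ln (1 + real n * (u / 2))) {u / 2..u}"
    by simp
  then show ?thesis by (rule has_integral_eq[rotated]) auto
qed

lemma has_integral_log_right:
  fixes n :: nat
  assumes "0 < u" "u \<le> v"
  shows "((\<lambda>x. real n / (1 + real n * \<bar>u - x\<bar>)) has_integral ln (1 + real n * (v - u))) {u..v}"
proof -
  let ?F = "\<lambda>x. ln (1 + real n * (x - u))"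
  have "((\<lambda>x. real n / (1 + real n * (x - u))) has_integral ?F v - ?F u) {u..v}"
    using assms
    by (intro fundamental_theorem_of_calculus)
      (auto intro!: derivative_eq_intros add_pos_nonneg simp flip: has_real_derivative_iff_has_vector_derivative)
  then have "((\<lambda>x. real n / (1 + real n * (x - u))) has_integral ln (1 + real n * (v - u))) {u..v}"
    by simp
  then show ?thesis by (rule has_integral_eq[rotated]) auto
qed

section \<open>Deviation of the transfer function\<close>

locale spectral_transfer =
  fixes A :: "real \<Rightarrow> complex" and g :: "real \<Rightarrow> real" and d C0 C1 C2 :: real
  assumes d: "\<bar>d\<bar> < 1 / 2" and C1: "0 < C1"
    and g: "\<And>u. u \<in> {-pi..pi} \<Longrightarrow> C1 \<le> g u \<and> g u \<le> C2"
    and spec: "\<And>u. u \<in> {-pi..pi} \<Longrightarrow> u \<noteq> 0 \<Longrightarrow> spectral_density A u = \<bar>u\<bar> powr (- 2 * d) * g u"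
    and diff: "\<And>u. u \<in> {0<..<pi} \<Longrightarrow> A differentiable (at u) \<and>
           norm (vector_derivative A (at u)) \<le> C0 * \<bar>u\<bar> powr (- 1 - d)"
begin

definition rel_err :: "real \<Rightarrow> real \<Rightarrow> real" where
  "rel_err u x = cmod (A x / A u - 1)"

text \<open>One exponent for both signs of \<open>d\<close>: the ratio
  \<open>t powr (- 2 * d)\<close> is controlled by \<open>t powr (- \<theta>)\<close> for small
  \<open>t\<close> and by \<open>t powr \<theta>\<close> for large \<open>t\<close>.\<close>

definition \<theta> :: real where "\<theta> = 2 * \<bar>d\<bar>"
definition K_far :: real where "K_far = 4 * (3 + 2 * (C2 / C1))"
definition K_near :: real where "K_near = 4 * C0 / sqrt (2 * pi * C1)"

lemma \<theta>: "0 \<le> \<theta>" "\<theta> < 1"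
  using d by (auto simp: \<theta>_def)

lemma C2: "0 < C2"
  using C1 g[of 0] by simp

lemma K_far: "0 \<le> K_far"
  using C1 C2 by (simp add: K_far_def)

lemma C0: "0 \<le> C0"
proof -
  have "0 \<le> C0 * \<bar>pi / 2\<bar> powr (- 1 - d)"
    using diff[of "pi / 2"] norm_ge_zero order_trans by (simp, blast)
  then show ?thesis by (simp add: zero_le_mult_iff)
qed

lemma K_near: "0 \<le> K_near"
  using C0 C1 by (simp add: K_near_def)

lemma transfer_norm:
  assumes "x \<in> {-pi..pi}" "x \<noteq> 0"
  shows "(cmod (A x))\<^sup>2 = 2 * pi * (\<bar>x\<bar> powr (- 2 * d) * g x)"
  using spec[OF assms] by (simp add: spectral_density_def field_simps)

lemma transfer_norm_ge:
  assumes "0 < u" "u < pi"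
  shows "sqrt (2 * pi * C1) * u powr (- d) \<le> cmod (A u)"
proof (rule power2_le_imp_le)
  have "u powr (- d) * u powr (- d) = u powr (- 2 * d)"
    by (simp flip: powr_add)
  then have "(sqrt (2 * pi * C1) * u powr (- d))\<^sup>2 = 2 * pi * (u powr (- 2 * d) * C1)"
    using C1 by (simp add: power_mult_distrib power2_eq_square[of "_ powr _"])
  also have "\<dots> \<le> 2 * pi * (u powr (- 2 * d) * g u)"
    using g[of u] assms by (intro mult_left_mono) auto
  also have "\<dots> = (cmod (A u))\<^sup>2"
    using transfer_norm[of u] assms by simp
  finally show "(sqrt (2 * pi * C1) * u powr (- d))\<^sup>2 \<le> (cmod (A u))\<^sup>2" .
qed simp

lemma transfer_nonzero:
  assumes "0 < u" "u < pi" shows "A u \<noteq> 0"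
proof -
  have "0 < sqrt (2 * pi * C1) * u powr (- d)" using C1 assms by simp
  then show ?thesis using transfer_norm_ge[OF assms] by auto
qed

lemma ratio_bound:
  assumes "0 < u" "u < pi" "x \<in> {-pi..pi}" "x \<noteq> 0"
  shows "(cmod (A x / A u))\<^sup>2 \<le> (C2 / C1) * (\<bar>x\<bar> / u) powr (- 2 * d)"
proof -
  have gu: "C1 \<le> g u" and gx: "g x \<le> C2" "0 \<le> g x" using g[of u] g[of x] C1 assms by auto
  have "(cmod (A x / A u))\<^sup>2 = (2 * pi * (\<bar>x\<bar> powr (- 2 * d) * g x)) / (2 * pi * (u powr (- 2 * d) * g u))"
    using transfer_norm[of x] transfer_norm[of u] assms by (simp add: norm_divide power_divide)
  also have "\<dots> = (\<bar>x\<bar> / u) powr (- 2 * d) * (g x / g u)"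
    using assms by (simp add: powr_divide)
  also have "\<dots> \<le> (\<bar>x\<bar> / u) powr (- 2 * d) * (C2 / C1)"
    using gu gx C1 by (intro mult_left_mono frac_le) auto
  finally show ?thesis by (simp add: mult.commute)
qed

text \<open>Only the size of |A| enters: the squared error is at most 2 |A x / A u|^2 + 2, and a
  number is at most 1 plus its square. Hence \<open>3 + 2 * q * t powr (- 2 * d)\<close> bounds the
  error and its square alike. The bounds depend on |x|, so negative \<open>x\<close> are
  included.\<close>

lemma rel_far:
  assumes "0 < u" "u < pi" "x \<in> {-pi..pi}" "x \<noteq> 0"
  shows "\<bar>x\<bar> \<le> u / 2 \<Longrightarrow> rel_err u x \<le> K_far * (\<bar>x\<bar> / u) powr (- \<theta>)"
    and "\<bar>x\<bar> \<le> u / 2 \<Longrightarrow> (rel_err u x)\<^sup>2 \<le> K_far * (\<bar>x\<bar> / u) powr (- \<theta>)"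
    and "u / 2 \<le> \<bar>x\<bar> \<Longrightarrow> rel_err u x \<le> K_far * (\<bar>x\<bar> / u) powr \<theta>"
    and "u / 2 \<le> \<bar>x\<bar> \<Longrightarrow> (rel_err u x)\<^sup>2 \<le> K_far * (\<bar>x\<bar> / u) powr \<theta>"
proof -
  define q where "q = C2 / C1"
  define t where "t = \<bar>x\<bar> / u"
  have q: "0 \<le> q" and t: "0 < t" using C1 C2 assms by (auto simp: q_def t_def)
  have "(rel_err u x)\<^sup>2 \<le> 2 * (cmod (A x / A u))\<^sup>2 + 2"
  proof -
    have "rel_err u x \<le> cmod (A x / A u) + 1"
      unfolding rel_err_def using norm_triangle_ineq4[of "A x / A u" 1] by simp
    then have "(rel_err u x)\<^sup>2 \<le> (cmod (A x / A u) + 1)\<^sup>2"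
      by (intro power_mono) (auto simp: rel_err_def)
    also have "\<dots> \<le> 2 * (cmod (A x / A u))\<^sup>2 + 2"
      using sum_squares_bound[of "cmod (A x / A u)" 1] by (simp add: power2_sum)
    finally show ?thesis .
  qed
  also have "\<dots> \<le> 2 * (q * t powr (- 2 * d)) + 2"
    using ratio_bound[OF assms] by (simp add: q_def t_def)
  finally have sq: "(rel_err u x)\<^sup>2 \<le> 2 * (q * t powr (- 2 * d)) + 2" .
  have "rel_err u x \<le> 1 + (rel_err u x)\<^sup>2"
    using sum_squares_bound[of "rel_err u x" 1] by (simp add: power2_eq_square) (smt (verit) zero_le_square)
  then have both: "rel_err u x \<le> 3 + 2 * q * t powr (- 2 * d)" "(rel_err u x)\<^sup>2 \<le> 3 + 2 * q * t powr (- 2 * d)"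
    using sq by auto
  {
    assume "\<bar>x\<bar> \<le> u / 2"
    then have t1: "t \<le> 1" using assms by (simp add: t_def)
    have "t powr (- 2 * d) \<le> t powr (- \<theta>)" "1 \<le> t powr (- \<theta>)"
      using t t1 \<theta> powr_mono'[of "- \<theta>" "- 2 * d" t] powr_mono'[of "- \<theta>" 0 t] by (auto simp: \<theta>_def)
    then have "3 + 2 * q * t powr (- 2 * d) \<le> 3 * t powr (- \<theta>) + 2 * q * t powr (- \<theta>)"
      using q by (intro add_mono mult_left_mono) auto
    also have "\<dots> \<le> K_far * t powr (- \<theta>)"
      unfolding distrib_right[symmetric] K_far_def q_def[symmetric] using q by (intro mult_right_mono) auto
    finally have "3 + 2 * q * t powr (- 2 * d) \<le> K_far * t powr (- \<theta>)" .
  } note small = this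
  {
    assume "u / 2 \<le> \<bar>x\<bar>"
    then have t2: "1 / 2 \<le> t" using assms by (simp add: t_def field_simps)
    have th: "1 / 2 \<le> t powr \<theta>"
    proof -
      have "(1 / 2 :: real) = (1 / 2) powr 1" by simp
      also have "\<dots> \<le> (1 / 2) powr \<theta>" using \<theta> by (intro powr_mono') auto
      also have "\<dots> \<le> t powr \<theta>" using t2 \<theta> by (intro powr_mono2) auto
      finally show ?thesis .
    qed
    \<comment> \<open>For positive \<open>d\<close> and \<open>1/2 \<le> t < 1\<close> the left
      power may exceed \<open>t powr \<theta>\<close>, but it is at most
      \<open>1 / t \<le> 2\<close>, while \<open>t powr \<theta> \<ge> 1/2\<close>. This is the
      factor 4 in \<open>K_far\<close>.\<close>
    have "t powr (- 2 * d) \<le> 4 * t powr \<theta>"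
    proof (cases "1 \<le> t")
      case True
      then have "t powr (- 2 * d) \<le> t powr \<theta>" by (intro powr_mono) (auto simp: \<theta>_def)
      then show ?thesis using th by linarith
    next
      case False
      have "t powr (- 2 * d) \<le> t powr (- 1)" using False t d by (intro powr_mono') auto
      also have "\<dots> \<le> 2" using t2 t by (simp add: powr_minus_divide field_simps)
      finally show ?thesis using th by linarith
    qed
    then have "3 + 2 * q * t powr (- 2 * d) \<le> 3 * (4 * t powr \<theta>) + 2 * q * (4 * t powr \<theta>)"
      using q th by (intro add_mono mult_left_mono) auto
    also have "\<dots> = K_far * t powr \<theta>"
      by (simp add: K_far_def q_def algebra_simps)
    finally have "3 + 2 * q * t powr (- 2 * d) \<le> K_far * t powr \<theta>" .
  } note large = this
  show "\<bar>x\<bar> \<le> u / 2 \<Longrightarrow> rel_err u x \<le> K_far * (\<bar>x\<bar> / u) powr (- \<theta>)"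
    "\<bar>x\<bar> \<le> u / 2 \<Longrightarrow> (rel_err u x)\<^sup>2 \<le> K_far * (\<bar>x\<bar> / u) powr (- \<theta>)"
    "u / 2 \<le> \<bar>x\<bar> \<Longrightarrow> rel_err u x \<le> K_far * (\<bar>x\<bar> / u) powr \<theta>"
    "u / 2 \<le> \<bar>x\<bar> \<Longrightarrow> (rel_err u x)\<^sup>2 \<le> K_far * (\<bar>x\<bar> / u) powr \<theta>"
    unfolding t_def[symmetric] using both small large by linarith+
qed

text \<open>The mean value inequality gives a multiple of
  \<open>u powr (- 1 - d) * \<bar>u - x\<bar>\<close>, and the lower bound for |A u| is a multiple
  of \<open>u powr (- d)\<close>; the quotient is of order \<open>\<bar>u - x\<bar> / u\<close>. The
  4 in \<open>K_near\<close> bounds \<open>2 powr (1 + d)\<close>.\<close>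

lemma rel_near:
  assumes "0 < u" "u < pi" "u / 2 \<le> x" "x \<le> 2 * u" "x < pi"
  shows "rel_err u x \<le> K_near * \<bar>u - x\<bar> / u"
proof -
  let ?S = "{u / 2..<pi}"
  define B where "B = 4 * C0 * u powr (- 1 - d)"
  \<comment> \<open>The set \<open>?S\<close> stops short of \<pi>, beyond which the derivative is
    not controlled. Since \<open>- 1 - d < 0\<close>, the derivative bound is largest at the left
    end \<open>u / 2\<close>.\<close>
  have "norm (A x - A u) \<le> B * norm (x - u)"
  proof (rule differentiable_bound[where f' = "\<lambda>z h. h *\<^sub>R vector_derivative A (at z)"])
    fix z assume z: "z \<in> ?S"
    then have z': "z \<in> {0<..<pi}" using assms by auto
    show "(A has_derivative (\<lambda>h. h *\<^sub>R vector_derivative A (at z))) (at z within ?S)"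
      using diff[OF z'] has_derivative_at_withinI
      by (metis has_vector_derivative_def vector_derivative_works)
    have "norm (vector_derivative A (at z)) \<le> C0 * z powr (- 1 - d)"
      using diff[OF z'] z' by simp
    also have "\<dots> \<le> C0 * (u / 2) powr (- 1 - d)"
      using z assms d C0 by (intro mult_left_mono powr_mono2') auto
    also have "(u / 2) powr (- 1 - d) = u powr (- 1 - d) * 2 powr (1 + d)"
      using assms by (simp add: powr_divide powr_minus_divide[of 2 "1 + d"] flip: minus_add_distrib)
        (simp add: powr_minus field_simps flip: powr_add)
    also have "C0 * (u powr (- 1 - d) * 2 powr (1 + d)) \<le> C0 * (u powr (- 1 - d) * 4)"
      using powr_mono[of "1 + d" 2 2] d C0 by (intro mult_left_mono) auto
    finally have nb: "norm (vector_derivative A (at z)) \<le> B"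
      by (simp add: B_def mult_ac)
    show "onorm (\<lambda>h. h *\<^sub>R vector_derivative A (at z)) \<le> B"
    proof (rule onorm_le)
      fix h :: real
      show "norm (h *\<^sub>R vector_derivative A (at z)) \<le> B * norm h"
        using mult_right_mono[OF nb abs_ge_zero[of h]] by (simp add: mult.commute)
    qed
  qed (use assms in auto)
  then have "norm (A x - A u) \<le> B * \<bar>u - x\<bar>" by (simp add: abs_minus_commute)
  moreover have "rel_err u x = norm (A x - A u) / cmod (A u)"
    unfolding rel_err_def using transfer_nonzero[OF assms(1,2)] by (simp add: diff_divide_distrib flip: norm_divide)
  moreover have "0 < sqrt (2 * pi * C1) * u powr (- d)" using C1 assms by simp
  ultimately have "rel_err u x \<le> (B * \<bar>u - x\<bar>) / (sqrt (2 * pi * C1) * u powr (- d))"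
    using transfer_norm_ge[OF assms(1,2)] by (simp only:) (intro frac_le, auto simp: B_def C0)
  also have "\<dots> = (B / u powr (- d)) * \<bar>u - x\<bar> / sqrt (2 * pi * C1)"
    by simp
  also have "B / u powr (- d) = 4 * C0 / u"
  proof -
    have "u powr (- 1 - d) = u powr (- d) / u"
      using assms by (simp add: powr_diff powr_minus_divide)
    then show ?thesis using assms by (simp add: B_def)
  qed
  also have "(4 * C0 / u) * \<bar>u - x\<bar> / sqrt (2 * pi * C1) = K_near * \<bar>u - x\<bar> / u"
    by (simp add: K_near_def)
  finally show ?thesis .
qed

section \<open>Kernel bounds away from the frequency\<close>

lemma kernel_center:
  assumes "0 < u" "u < pi" "\<bar>x\<bar> \<le> u / 2"
  shows "(cmod (dirichlet n (u - x)))\<^sup>2 \<le> 256 / u\<^sup>2"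
proof -
  \<comment> \<open>\<open>z\<close> is the distance of \<open>x\<close> and \<open>u\<close> on the
    circle. It is at least \<open>u / 2\<close> either way around, because 2 \<pi> - 3 u / 2 > u /
    2. This gives 256 = 4 * 64.\<close>
  obtain z where z: "u / 2 \<le> z" "(cmod (dirichlet n (u - x)))\<^sup>2 * z\<^sup>2 \<le> 64"
  proof (cases "u - x \<le> pi")
    case True
    then show ?thesis using dirichlet_bound[of "u - x" n] assms by (intro that[of "u - x"]) auto
  next
    case False
    then show ?thesis using dirichlet_bound_reflected[of "u - x" n] assms by (intro that[of "2 * pi - (u - x)"]) auto
  qed
  have "(cmod (dirichlet n (u - x)))\<^sup>2 * (u / 2)\<^sup>2 \<le> (cmod (dirichlet n (u - x)))\<^sup>2 * z\<^sup>2"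
    using z(1) assms by (intro mult_left_mono power_mono) auto
  also note z(2)
  finally show ?thesis using assms by (simp add: field_simps)
qed

lemma kernel_right:
  assumes "0 < u" "u < pi" "2 * u \<le> x" "x \<le> pi"
  shows "(cmod (dirichlet n (u - x)))\<^sup>2 \<le> 256 / x\<^sup>2"
proof -
  have "(cmod (dirichlet n (u - x)))\<^sup>2 * (x / 2)\<^sup>2 \<le> (cmod (dirichlet n (u - x)))\<^sup>2 * (x - u)\<^sup>2"
    using assms by (intro mult_left_mono power_mono) auto
  also have "\<dots> \<le> 64"
    using dirichlet_bound[of "u - x" n] assms by (simp add: power2_commute)
  finally show ?thesis using assms by (simp add: field_simps)
qed

text \<open>The point \<open>- s\<close> is reached from \<open>u\<close> through 0, at distance
  \<open>u + s\<close>, or through \<pi>, at distance 2 \<pi> - u - s. The second route matters only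
  for \<open>u\<close> near \<pi>, where the weight \<open>(s / u) powr \<theta>\<close> is at most
  2.\<close>

lemma kernel_left:
  assumes "0 < u" "u < pi" "u / 2 \<le> s" "s < pi"
  shows "(cmod (dirichlet n (u + s)))\<^sup>2 * (s / u) powr \<theta>
    \<le> 320 * ((s / u) powr \<theta> / s\<^sup>2) + 128 * (1 / (2 * pi - u - s)\<^sup>2)"
proof -
  let ?D = "(cmod (dirichlet n (u + s)))\<^sup>2" and ?w = "(s / u) powr \<theta>"
  have s: "0 < s" using assms by simp
  have D: "?D \<le> 64 / s\<^sup>2 + 64 / (2 * pi - u - s)\<^sup>2"
  proof (cases "u + s \<le> pi")
    case True
    have "?D * s\<^sup>2 \<le> ?D * (u + s)\<^sup>2"
      using assms by (intro mult_left_mono power_mono) auto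
    also have "\<dots> \<le> 64" using dirichlet_bound[of "u + s" n] assms True by simp
    finally have "?D \<le> 64 / s\<^sup>2" using s by (simp add: field_simps)
    also have "\<dots> \<le> 64 / s\<^sup>2 + 64 / (2 * pi - u - s)\<^sup>2" by simp
    finally show ?thesis .
  next
    case False
    have "?D * (2 * pi - u - s)\<^sup>2 \<le> 64"
      using dirichlet_bound_reflected[of "u + s" n] assms False by (simp add: diff_diff_eq)
    moreover have "2 * pi - u - s > 0" using assms by simp
    ultimately have "?D \<le> 64 / (2 * pi - u - s)\<^sup>2" by (simp add: pos_le_divide_eq)
    also have "\<dots> \<le> 64 / s\<^sup>2 + 64 / (2 * pi - u - s)\<^sup>2" by simp
    finally show ?thesis .
  qed
  show ?thesis
  proof (cases "u \<le> pi / 2")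
    case True
    \<comment> \<open>For \<open>u \<le> pi / 2\<close> the route through \<pi> has length at least
      \<pi>/2 >= s / 2, so its term is absorbed: 320 = 64 + 4 * 64.\<close>
    have "64 / (2 * pi - u - s)\<^sup>2 \<le> 64 / (s / 2)\<^sup>2"
      using True assms s by (intro divide_left_mono power_mono mult_pos_pos) auto
    then have "?D \<le> 320 / s\<^sup>2" using D by (simp add: power_divide)
    then have "?D * ?w \<le> 320 / s\<^sup>2 * ?w" by (intro mult_right_mono) auto
    also have "\<dots> \<le> 320 * (?w / s\<^sup>2) + 128 * (1 / (2 * pi - u - s)\<^sup>2)" by simp
    finally show ?thesis .
  next
    case False
    have "?w \<le> 2 powr \<theta>" using False assms \<theta> by (intro powr_mono2) (auto simp: field_simps)
    also have "\<dots> \<le> 2 powr 1" using \<theta> by (intro powr_mono) auto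
    finally have w: "?w \<le> 2" by simp
    have "?D * ?w \<le> (64 / s\<^sup>2 + 64 / (2 * pi - u - s)\<^sup>2) * ?w"
      using D by (intro mult_right_mono) auto
    also have "\<dots> = 64 / s\<^sup>2 * ?w + 64 / (2 * pi - u - s)\<^sup>2 * ?w" by (rule distrib_right)
    also have "\<dots> \<le> 320 / s\<^sup>2 * ?w + 64 / (2 * pi - u - s)\<^sup>2 * 2"
      using w by (intro add_mono mult_left_mono mult_right_mono divide_right_mono) auto
    finally show ?thesis by simp
  qed
qed

text \<open>
  \<open>A\<close> is not assumed continuous across \<open>\<plusminus>\<pi>\<close>. Points near \<open>-\<pi>\<close> are close to \<open>u\<close> on the circle when \<open>u\<close> is
  near \<open>\<pi>\<close>, which costs the term \<open>1 / (pi - u)\<close>.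
\<close>

lemma far_integrals:
  fixes \<psi> :: "real \<Rightarrow> real" and n :: nat and u :: real
  defines "f \<equiv> \<lambda>x. (cmod (dirichlet n (u - x)))\<^sup>2 * \<psi> x"
  assumes u: "0 < u" "u < pi"
    and small: "\<And>x. x \<in> {-pi..pi} \<Longrightarrow> x \<noteq> 0 \<Longrightarrow> \<bar>x\<bar> \<le> u / 2 \<Longrightarrow> \<psi> x \<le> K_far * (\<bar>x\<bar> / u) powr (- \<theta>)"
    and large: "\<And>x. x \<in> {-pi..pi} \<Longrightarrow> x \<noteq> 0 \<Longrightarrow> u / 2 \<le> \<bar>x\<bar> \<Longrightarrow> \<psi> x \<le> K_far * (\<bar>x\<bar> / u) powr \<theta>"
    and int: "f integrable_on {-pi..pi}"
  shows "integral {-pi..u / 2} f \<le> 1152 * K_far / (1 - \<theta>) * (1 / u + 1 / (pi - u))"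
    and "integral {min (2 * u) pi..pi} f \<le> 512 * K_far / (1 - \<theta>) * (1 / u)"
proof -
  let ?T = "1 / (1 - \<theta>)"
  have T: "1 \<le> ?T" using \<theta> by simp
  have sub: "f integrable_on {a..b}" if "-pi \<le> a" "b \<le> pi" for a b
    using int by (rule integrable_subinterval_real) (use that in auto)
  have small': "f x \<le> 256 * K_far / u\<^sup>2 * (\<bar>x\<bar> / u) powr (- \<theta>)" if "\<bar>x\<bar> \<le> u / 2" "x \<noteq> 0" for x
  proof -
    have "f x \<le> (256 / u\<^sup>2) * (K_far * (\<bar>x\<bar> / u) powr (- \<theta>))"
    proof (cases "0 \<le> \<psi> x")
      case True
      have "x \<in> {-pi..pi}" using that(1) u unfolding atLeastAtMost_iff by linarith
      then show ?thesis unfolding f_def using True that kernel_center[OF u that(1), of n] small[of x]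
        by (intro mult_mono) auto
    next
      case False
      then have "f x \<le> 0" unfolding f_def by (simp add: mult_nonneg_nonpos)
      also have "0 \<le> (256 / u\<^sup>2) * (K_far * (\<bar>x\<bar> / u) powr (- \<theta>))" using K_far by simp
      finally show ?thesis .
    qed
    then show ?thesis by simp
  qed
  obtain I0 where I0: "((\<lambda>x. (x / u) powr (- \<theta>)) has_integral I0) {0..u / 2}" "I0 \<le> u / (1 - \<theta>)"
    using has_integral_powr_at_zero[OF u(1) \<theta>(2)] .
  have I0b: "256 * K_far / u\<^sup>2 * I0 \<le> 256 * K_far * ?T / u"
  proof -
    have "256 * K_far / u\<^sup>2 * I0 \<le> 256 * K_far / u\<^sup>2 * (u / (1 - \<theta>))"
      using I0(2) K_far by (intro mult_left_mono) auto
    then show ?thesis using u by (simp add: power2_eq_square mult.commute)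
  qed
  have b1: "integral {0..u / 2} f \<le> 256 * K_far * ?T / u"
  proof -
    have "integral {0..u / 2} f \<le> 256 * K_far / u\<^sup>2 * I0"
    proof (rule integral_le_interior[OF sub has_integral_mult_right[OF I0(1)]])
      fix x assume "0 < x" "x < u / 2"
      then show "f x \<le> 256 * K_far / u\<^sup>2 * (x / u) powr (- \<theta>)" using small'[of x] by simp
    qed (use u in auto)
    then show ?thesis using I0b by linarith
  qed
  have b2: "integral {- (u / 2)..0} f \<le> 256 * K_far * ?T / u"
  proof -
    have "integral {0..u / 2} (\<lambda>x. f (- x)) \<le> 256 * K_far / u\<^sup>2 * I0"
    proof (rule integral_le_interior[OF _ has_integral_mult_right[OF I0(1)]])
      show "(\<lambda>x. f (- x)) integrable_on {0..u / 2}"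
        using sub[of "- (u / 2)" 0] u Henstock_Kurzweil_Integration.integrable_reflect_real[of f 0 "- (u / 2)"] by simp
      fix x assume "0 < x" "x < u / 2"
      then show "f (- x) \<le> 256 * K_far / u\<^sup>2 * (x / u) powr (- \<theta>)" using small'[of "- x"] by simp
    qed
    then show ?thesis
      using I0b Henstock_Kurzweil_Integration.integral_reflect_real[of 0 "- (u / 2)" f] by simp
  qed
  obtain I1 where I1: "((\<lambda>x. (x / u) powr \<theta> / x\<^sup>2) has_integral I1) {u / 2..pi}" "I1 \<le> 2 / (u * (1 - \<theta>))"
    by (rule has_integral_powr_tail[OF u(1) \<theta>, of "u / 2" pi]) (use u in auto)
  obtain I2 where I2: "((\<lambda>x. 1 / (2 * pi - u - x)\<^sup>2) has_integral I2) {u / 2..pi}" "I2 \<le> 1 / (pi - u)"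
    by (rule has_integral_inverse_square[of "u / 2" u]) (use u in auto)
  have b3: "integral {-pi..- (u / 2)} f \<le> 640 * K_far * ?T / u + 128 * K_far / (pi - u)"
  proof -
    have "integral {u / 2..pi} (\<lambda>x. f (- x)) \<le> (320 * K_far) * I1 + (128 * K_far) * I2"
    proof (rule integral_le_interior[OF _ has_integral_add[OF has_integral_mult_right[OF I1(1)] has_integral_mult_right[OF I2(1)]]])
      show "(\<lambda>x. f (- x)) integrable_on {u / 2..pi}"
        using sub[of "-pi" "- (u / 2)"] u Henstock_Kurzweil_Integration.integrable_reflect_real[of f "- (u / 2)" "-pi"] by simp
      fix s assume s: "u / 2 < s" "s < pi"
      have "f (- s) \<le> (cmod (dirichlet n (u + s)))\<^sup>2 * (K_far * (s / u) powr \<theta>)"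
        unfolding f_def using large[of "- s"] s u by (simp add: mult_left_mono)
      also have "\<dots> = K_far * ((cmod (dirichlet n (u + s)))\<^sup>2 * (s / u) powr \<theta>)" by simp
      also have "\<dots> \<le> K_far * (320 * ((s / u) powr \<theta> / s\<^sup>2) + 128 * (1 / (2 * pi - u - s)\<^sup>2))"
        using s by (intro mult_left_mono kernel_left u K_far) auto
      finally show "f (- s) \<le> 320 * K_far * ((s / u) powr \<theta> / s\<^sup>2) + 128 * K_far * (1 / (2 * pi - u - s)\<^sup>2)"
        by (simp add: algebra_simps)
    qed
    also have "\<dots> \<le> (320 * K_far) * (2 / (u * (1 - \<theta>))) + (128 * K_far) * (1 / (pi - u))"
      using I1(2) I2(2) K_far by (intro add_mono mult_left_mono) auto
    finally show ?thesis
      using Henstock_Kurzweil_Integration.integral_reflect_real[of "- (u / 2)" "-pi" f] by (simp add: mult_ac)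
  qed
  have "integral {-pi..u / 2} f = integral {-pi..- (u / 2)} f + integral {- (u / 2)..0} f + integral {0..u / 2} f"
    using Henstock_Kurzweil_Integration.integral_combine[of "-pi" "- (u / 2)" 0 f]
      Henstock_Kurzweil_Integration.integral_combine[of "-pi" 0 "u / 2" f] sub u by simp
  \<comment> \<open>The pieces contribute 640 = 2 * 320 on the left and 256 on each side of
    0.\<close>
  also have "\<dots> \<le> 1152 * K_far * ?T / u + 128 * K_far / (pi - u)"
    using b1 b2 b3 by (simp add: add_divide_distrib[symmetric])
  also have "128 * K_far / (pi - u) \<le> 1152 * K_far * ?T / (pi - u)"
  proof -
    have "128 * K_far * 1 \<le> 1152 * K_far * ?T" using T K_far by (intro mult_mono) auto
    then show ?thesis using u by (intro divide_right_mono) auto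
  qed
  finally show "integral {-pi..u / 2} f \<le> 1152 * K_far / (1 - \<theta>) * (1 / u + 1 / (pi - u))"
    by (simp add: distrib_left)
  \<comment> \<open>The right end of the region where smoothness is used; for
    \<open>2 * u \<ge> pi\<close> the remaining interval is a single point.\<close>
  let ?v = "min (2 * u) pi"
  obtain I3 where I3: "((\<lambda>x. (x / u) powr \<theta> / x\<^sup>2) has_integral I3) {?v..pi}" "I3 \<le> 2 / (u * (1 - \<theta>))"
    by (rule has_integral_powr_tail[OF u(1) \<theta>, of ?v pi]) (use u in auto)
  have "integral {?v..pi} f \<le> (256 * K_far) * I3"
  proof (rule integral_le_interior[OF sub has_integral_mult_right[OF I3(1)]])
    fix x assume x: "?v < x" "x < pi"
    have "f x \<le> (cmod (dirichlet n (u - x)))\<^sup>2 * (K_far * (x / u) powr \<theta>)"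
      unfolding f_def using large[of x] x u by (intro mult_left_mono) (auto simp: min_def split: if_splits)
    also have "\<dots> \<le> (256 / x\<^sup>2) * (K_far * (x / u) powr \<theta>)"
      using kernel_right[OF u, of x n] x u K_far by (intro mult_right_mono) (auto simp: min_def split: if_splits)
    finally show "f x \<le> 256 * K_far * ((x / u) powr \<theta> / x\<^sup>2)" by simp
  qed (use u in auto)
  also have "\<dots> \<le> (256 * K_far) * (2 / (u * (1 - \<theta>)))"
    using I3(2) K_far by (intro mult_left_mono) auto
  finally show "integral {?v..pi} f \<le> 512 * K_far / (1 - \<theta>) * (1 / u)"
    by (simp add: mult_ac)
qed

text \<open>Large enough for both integrals below: the far regions need (1152 + 512)
  \<open>K_far\<close>, the quadratic near region 1024 \<open>K_near\<^sup>2\<close>, and the linear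
  near region 128 \<open>K_near\<close> on each side of \<open>u\<close>.\<close>

definition K_err :: real where "K_err = (2048 * K_far + 1024 * K_near\<^sup>2) / (1 - \<theta>) + 256 * K_near"

lemma K_err: "0 \<le> K_err"
  unfolding K_err_def using K_far K_near \<theta> by (intro add_nonneg_nonneg divide_nonneg_nonneg) auto

text \<open>Near \<open>u\<close> the factor \<open>(u - x)^2\<close> from the squared error cancels
  the decay of the kernel, so the integrand stays of order \<open>1 / u^2\<close> over a length of
  order \<open>u\<close>. No logarithm arises.\<close>

lemma integral_rel_square:
  fixes n :: nat and u :: real
  defines "f \<equiv> \<lambda>x. (cmod (dirichlet n (u - x)))\<^sup>2 * (rel_err u x)\<^sup>2"
  assumes u: "0 < u" "u < pi" and int: "f integrable_on {-pi..pi}"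
  shows "integral {-pi..pi} f \<le> K_err * (1 / u + 1 / (pi - u))"
proof -
  let ?T = "1 / (1 - \<theta>)"
  have far: "integral {-pi..u / 2} f \<le> 1152 * K_far / (1 - \<theta>) * (1 / u + 1 / (pi - u))"
    unfolding f_def by (rule far_integrals(1)) (use u int rel_far in \<open>auto simp: f_def\<close>)
  obtain I1 where I1: "((\<lambda>x. (x / u) powr \<theta> / x\<^sup>2) has_integral I1) {u / 2..pi}" "I1 \<le> 2 / (u * (1 - \<theta>))"
    by (rule has_integral_powr_tail[OF u(1) \<theta>, of "u / 2" pi]) (use u in auto)
  have sub: "f integrable_on {u / 2..pi}"
    using int by (rule integrable_subinterval_real) (use u in auto)
  have "integral {u / 2..pi} f \<le> (512 * K_near\<^sup>2 + 256 * K_far) * I1"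
  proof (rule integral_le_interior[OF sub has_integral_mult_right[OF I1(1)]])
    fix x assume x: "u / 2 < x" "x < pi"
    show "f x \<le> (512 * K_near\<^sup>2 + 256 * K_far) * ((x / u) powr \<theta> / x\<^sup>2)"
    proof (cases "x \<le> 2 * u")
      case True
      have "rel_err u x \<le> K_near * \<bar>u - x\<bar> / u" using rel_near[OF u] x True by simp
      then have "(rel_err u x)\<^sup>2 \<le> (K_near * \<bar>u - x\<bar> / u)\<^sup>2" by (intro power_mono) (auto simp: rel_err_def)
      then have "f x \<le> (cmod (dirichlet n (u - x)))\<^sup>2 * (K_near * \<bar>u - x\<bar> / u)\<^sup>2"
        unfolding f_def by (intro mult_left_mono) auto
      also have "\<dots> = (K_near\<^sup>2 / u\<^sup>2) * ((cmod (dirichlet n (u - x)))\<^sup>2 * (u - x)\<^sup>2)"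
        by (simp add: power_divide power_mult_distrib)
      also have "\<dots> \<le> (K_near\<^sup>2 / u\<^sup>2) * 64"
        using dirichlet_bound[of "u - x" n] x u by (intro mult_left_mono) auto
      \<comment> \<open>On \<open>u / 2 < x \<le> 2 * u\<close> the bound is rewritten in the shape
        of the tail integrand, using \<open>u \<ge> x / 2\<close> and
        \<open>(x / u) powr \<theta> \<ge> 1/2\<close>, so that one integral serves up to \<pi>. The
        constant is 512 = 64 * 4 * 2.\<close>
      also have "\<dots> \<le> (K_near\<^sup>2 / (x / 2)\<^sup>2) * 64"
        using True x u by (intro mult_right_mono divide_left_mono power_mono mult_pos_pos) auto
      also have "\<dots> = 512 * K_near\<^sup>2 * ((1 / 2) / x\<^sup>2)" by (simp add: power_divide)
      also have "\<dots> \<le> 512 * K_near\<^sup>2 * ((x / u) powr \<theta> / x\<^sup>2)"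
      proof -
        have "(1 / 2 :: real) = (1 / 2) powr 1" by simp
        also have "\<dots> \<le> (1 / 2) powr \<theta>" using \<theta> by (intro powr_mono') auto
        also have "\<dots> \<le> (x / u) powr \<theta>" using x u \<theta> by (intro powr_mono2) (auto simp: field_simps)
        finally show ?thesis by (intro mult_left_mono divide_right_mono) auto
      qed
      also have "\<dots> \<le> (512 * K_near\<^sup>2 + 256 * K_far) * ((x / u) powr \<theta> / x\<^sup>2)"
        using K_far by (intro mult_right_mono) auto
      finally show ?thesis .
    next
      case False
      have "f x \<le> (256 / x\<^sup>2) * (K_far * (x / u) powr \<theta>)"
        unfolding f_def using kernel_right[OF u, of x n] rel_far(4)[OF u, of x] x u False by (intro mult_mono) auto
      also have "\<dots> = 256 * K_far * ((x / u) powr \<theta> / x\<^sup>2)" by simp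
      also have "\<dots> \<le> (512 * K_near\<^sup>2 + 256 * K_far) * ((x / u) powr \<theta> / x\<^sup>2)"
        using K_far by (intro mult_right_mono) auto
      finally show ?thesis .
    qed
  qed
  also have "\<dots> \<le> (512 * K_near\<^sup>2 + 256 * K_far) * (2 / (u * (1 - \<theta>)))"
    using I1(2) K_far by (intro mult_left_mono) auto
  also have "\<dots> = (1024 * K_near\<^sup>2 + 512 * K_far) / (1 - \<theta>) * (1 / u)"
    by (simp add: field_simps)
  also have "\<dots> \<le> (1024 * K_near\<^sup>2 + 512 * K_far) / (1 - \<theta>) * (1 / u + 1 / (pi - u))"
    using K_far \<theta> u by (intro mult_left_mono) auto
  finally have near: "integral {u / 2..pi} f \<le> (1024 * K_near\<^sup>2 + 512 * K_far) / (1 - \<theta>) * (1 / u + 1 / (pi - u))" .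
  have "integral {-pi..pi} f = integral {-pi..u / 2} f + integral {u / 2..pi} f"
    using Henstock_Kurzweil_Integration.integral_combine[of "-pi" "u / 2" pi f] int u by simp
  also have "\<dots> \<le> (1152 * K_far / (1 - \<theta>) + (1024 * K_near\<^sup>2 + 512 * K_far) / (1 - \<theta>)) * (1 / u + 1 / (pi - u))"
    using far near by (simp only: distrib_right)
  also have "\<dots> \<le> K_err * (1 / u + 1 / (pi - u))"
  proof (intro mult_right_mono)
    show "1152 * K_far / (1 - \<theta>) + (1024 * K_near\<^sup>2 + 512 * K_far) / (1 - \<theta>) \<le> K_err"
      unfolding K_err_def add_divide_distrib[symmetric] using K_far K_near \<theta> 
      by (intro add_increasing2[of "256 * K_near"] divide_right_mono) auto
  qed (use u in auto)
  finally show ?thesis .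
qed

text \<open>A single factor \<open>\<bar>u - x\<bar>\<close> leaves the kernel with a first-order
  singularity, smoothed at distance 1 / n; integrating it on both sides of \<open>u\<close> produces
  the logarithm.\<close>

lemma integral_rel:
  fixes n :: nat and u :: real
  defines "f \<equiv> \<lambda>x. (cmod (dirichlet n (u - x)))\<^sup>2 * rel_err u x"
  assumes u: "0 < u" "u < pi" and int: "f integrable_on {-pi..pi}"
  shows "integral {-pi..pi} f \<le> K_err * (1 / u + 1 / (pi - u) + ln (1 + real n * u) / u)"
proof -
  let ?v = "min (2 * u) pi" and ?L = "ln (1 + real n * u)"
  have sub: "f integrable_on {a..b}" if "-pi \<le> a" "b \<le> pi" for a b
    using int by (rule integrable_subinterval_real) (use that in auto)
  have far: "integral {-pi..u / 2} f \<le> 1152 * K_far / (1 - \<theta>) * (1 / u + 1 / (pi - u))"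
    unfolding f_def by (rule far_integrals(1)) (use u int rel_far in \<open>auto simp: f_def\<close>)
  have far2: "integral {?v..pi} f \<le> 512 * K_far / (1 - \<theta>) * (1 / u)"
    unfolding f_def by (rule far_integrals(2)) (use u int rel_far in \<open>auto simp: f_def\<close>)
  have near: "f x \<le> 128 * K_near / u * (real n / (1 + real n * \<bar>u - x\<bar>))" if "u / 2 \<le> x" "x < ?v" for x
  proof -
    have "f x \<le> (cmod (dirichlet n (u - x)))\<^sup>2 * (K_near * \<bar>u - x\<bar> / u)"
      unfolding f_def using rel_near[OF u, of x] that by (intro mult_left_mono) auto
    also have "\<dots> = K_near / u * (\<bar>u - x\<bar> * (cmod (dirichlet n (u - x)))\<^sup>2)" by simp
    also have "\<dots> \<le> K_near / u * (128 * real n / (1 + real n * \<bar>u - x\<bar>))"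
      using dirichlet_log_bound[of "u - x" n] that u K_near by (intro mult_left_mono) auto
    finally show ?thesis by (simp add: mult_ac)
  qed
  have n1: "integral {u / 2..u} f \<le> 128 * K_near / u * ?L"
  proof -
    have "integral {u / 2..u} f \<le> 128 * K_near / u * ln (1 + real n * (u / 2))"
      proof (rule integral_le_interior[OF sub has_integral_mult_right[OF has_integral_log_left[OF u(1)]]])
      fix x assume "u / 2 < x" "x < u"
      then show "f x \<le> 128 * K_near / u * (real n / (1 + real n * \<bar>u - x\<bar>))"
        by (intro near) (use u in auto)
    qed (use u in auto)
    also have "\<dots> \<le> 128 * K_near / u * ?L"
      using u K_near by (intro mult_left_mono) (auto intro!: ln_mono add_pos_nonneg mult_left_mono)
    finally show ?thesis .
  qed
  have n2: "integral {u..?v} f \<le> 128 * K_near / u * ?L"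
  proof -
    have "integral {u..?v} f \<le> 128 * K_near / u * ln (1 + real n * (?v - u))"
      proof (rule integral_le_interior[OF sub has_integral_mult_right[OF has_integral_log_right[OF u(1)]]])
      fix x assume "u < x" "x < ?v"
      then show "f x \<le> 128 * K_near / u * (real n / (1 + real n * \<bar>u - x\<bar>))"
        by (intro near) (use u in auto)
    qed (use u in auto)
    also have "\<dots> \<le> 128 * K_near / u * ?L"
      using u K_near by (intro mult_left_mono) (auto intro!: ln_mono add_pos_nonneg mult_left_mono)
    finally show ?thesis .
  qed
  have "integral {-pi..pi} f = integral {-pi..u / 2} f + integral {u / 2..u} f + integral {u..?v} f + integral {?v..pi} f"
    using Henstock_Kurzweil_Integration.integral_combine[of "-pi" "u / 2" u f]
      Henstock_Kurzweil_Integration.integral_combine[of "-pi" u ?v f]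
      Henstock_Kurzweil_Integration.integral_combine[of "-pi" ?v pi f] sub u by simp
  also have "\<dots> \<le> 1152 * K_far / (1 - \<theta>) * (1 / u + 1 / (pi - u)) + 512 * K_far / (1 - \<theta>) * (1 / u + 1 / (pi - u))
      + 256 * K_near * (?L / u)"
  proof -
    have "512 * K_far / (1 - \<theta>) * (1 / u) \<le> 512 * K_far / (1 - \<theta>) * (1 / u + 1 / (pi - u))"
      using K_far \<theta> u by (intro mult_left_mono) auto
    moreover have "256 * K_near * (?L / u) = 128 * K_near / u * ?L + 128 * K_near / u * ?L" by simp
    ultimately show ?thesis using far far2 n1 n2 by linarith
  qed
  also have "\<dots> \<le> K_err * (1 / u + 1 / (pi - u)) + K_err * (?L / u)"
    unfolding distrib_right[symmetric] K_err_def add_divide_distrib[symmetric] using K_far K_near \<theta> u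
    by (intro add_mono mult_right_mono add_increasing2[of "256 * K_near"] add_increasing[of _ "256 * K_near"] divide_right_mono) auto
  finally show ?thesis by (simp add: distrib_left)
qed

end

section \<open>Fourier coefficients of the filter\<close>

definition partial_transfer :: "(nat \<Rightarrow> real) \<Rightarrow> nat \<Rightarrow> real \<Rightarrow> complex" where
  "partial_transfer a N x = (\<Sum>k<N. cis (- (real k * x)) * of_real (a k))"

text \<open>The truncated filter extended by zero to the integers, so that it can be evaluated at
  every difference \<open>t - p\<close>.\<close>

definition filter_coeff :: "(nat \<Rightarrow> real) \<Rightarrow> nat \<Rightarrow> int \<Rightarrow> complex" where
  "filter_coeff a N k = (if k \<in> {0..<int N} then of_real (a (nat k)) else 0)"

lemma sum_filter_coeff: "(\<Sum>k<N. filter_coeff a N (int k) * cis (real k * x)) = cnj (partial_transfer a N x)"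
  unfolding partial_transfer_def cnj_sum
  by (intro sum.cong refl) (simp add: filter_coeff_def cis_cnj)

lemma convolution_norm:
  fixes \<alpha> :: "int \<Rightarrow> complex"
  assumes supp: "\<And>k. k \<notin> {0..<int N} \<Longrightarrow> \<alpha> k = 0"
  shows "(\<Sum>p\<in>{1 - int N..int n}. (cmod (\<Sum>t=1..n. cis (real t * u) * \<alpha> (int t - p)))\<^sup>2)
    = (\<integral>x. (cmod (dirichlet n (u - x) * (\<Sum>k<N. \<alpha> (int k) * cis (real k * x))))\<^sup>2 \<partial>lebesgue_on {-pi..pi}) / (2 * pi)"
proof -
  have "(\<integral>x. (cmod (dirichlet n (u - x) * (\<Sum>k<N. \<alpha> (int k) * cis (real k * x))))\<^sup>2 \<partial>lebesgue_on {-pi..pi})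
    = 2 * pi * (\<Sum>p\<in>{1 - int N..int n}. (cmod (\<Sum>t=1..n. cis (real t * u) * \<alpha> (int t - p)))\<^sup>2)"
  proof -
    have eq: "dirichlet n (u - x) * (\<Sum>k<N. \<alpha> (int k) * cis (real k * x))
      = (\<Sum>p\<in>{1 - int N..int n}. (\<Sum>t=1..n. cis (real t * u) * \<alpha> (int t - p)) * cis (- (real_of_int p * x)))" for x
      unfolding dirichlet_def by (rule convolution_transform[symmetric]) (rule supp)
    show ?thesis unfolding eq by (rule parseval_finite) simp
  qed
  then show ?thesis by simp
qed

lemma integrable_dirichlet:
  "integrable (lebesgue_on {-pi..pi}) (\<lambda>x. (cmod (dirichlet n (u - x)))\<^sup>2)"
  by (intro continuous_imp_integrable_real continuous_intros)

text \<open>The unit impulse as filter: its convolution consists of \<open>n\<close> exponentials of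
  modulus 1, and its transform is 1.\<close>

lemma integral_dirichlet:
  assumes "1 \<le> n"
  shows "(\<integral>x. (cmod (dirichlet n (u - x)))\<^sup>2 \<partial>lebesgue_on {-pi..pi}) = 2 * pi * real n"
proof -
  define \<alpha> where "\<alpha> k = (of_bool (k = 0) :: complex)" for k :: int
  have pt: "(\<Sum>t=1..n. cis (real t * u) * \<alpha> (int t - p)) = cis (real_of_int p * u)" if "p \<in> {0<..int n}" for p
  proof -
    have "(\<Sum>t=1..n. cis (real t * u) * \<alpha> (int t - p)) = (\<Sum>t=1..n. if t = nat p then cis (real t * u) else 0)"
      using that by (intro sum.cong) (auto simp: \<alpha>_def)
    also have "\<dots> = cis (real_of_int p * u)" using that by (simp, linarith)
    finally show ?thesis .
  qed
  have "real n = (\<Sum>p\<in>{0<..int n}. (cmod (\<Sum>t=1..n. cis (real t * u) * \<alpha> (int t - p)))\<^sup>2)"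
  proof -
    have "(\<Sum>p\<in>{0<..int n}. (cmod (\<Sum>t=1..n. cis (real t * u) * \<alpha> (int t - p)))\<^sup>2) = (\<Sum>p\<in>{0<..int n}. 1)"
      by (intro sum.cong refl) (subst pt, assumption, simp)
    then show ?thesis by simp
  qed
  \<comment> \<open>The window for \<open>N = 1\<close> starts at \<open>p = 0\<close>, one index
    too early; since \<open>t\<close> starts at 1, the impulse is not hit there.\<close>
  also have "\<dots> = (\<Sum>p\<in>{1 - int 1..int n}. (cmod (\<Sum>t=1..n. cis (real t * u) * \<alpha> (int t - p)))\<^sup>2)"
  proof (rule sum.mono_neutral_left)
    have "(\<Sum>t=1..n. cis (real t * u) * \<alpha> (int t - 0)) = 0"
      by (intro sum.neutral) (simp add: \<alpha>_def)
    moreover have "p = 0" if "p \<in> {1 - int 1..int n} - {0<..int n}" for p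
      using that by simp
    ultimately show "\<forall>p\<in>{1 - int 1..int n} - {0<..int n}. (cmod (\<Sum>t=1..n. cis (real t * u) * \<alpha> (int t - p)))\<^sup>2 = 0"
      by fastforce
  qed auto
  also have "\<dots>
      = (\<integral>x. (cmod (dirichlet n (u - x) * (\<Sum>k<1. \<alpha> (int k) * cis (real k * x))))\<^sup>2 \<partial>lebesgue_on {-pi..pi}) / (2 * pi)"
    by (rule convolution_norm) (auto simp: \<alpha>_def)
  finally show ?thesis by (simp add: \<alpha>_def)
qed

locale spectral_filter = spectral_transfer +
  fixes a :: "nat \<Rightarrow> real"
  assumes transfer: "transfer_function a A"
begin

abbreviation "L \<equiv> lebesgue_on {-pi..pi}"

lemma transfer_measurable [measurable]: "A \<in> borel_measurable L"
  using transfer by (simp add: transfer_function_def set_borel_measurable_def borel_measurable_restrict_space_iff)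

lemma partial_transfer_measurable [measurable]: "partial_transfer a N \<in> borel_measurable L"
  unfolding partial_transfer_def
  by (intro continuous_imp_measurable_on_sets_lebesgue continuous_intros) auto

lemma dirichlet_measurable [measurable]: "(\<lambda>x. dirichlet n (u - x)) \<in> borel_measurable L"
  by (intro continuous_imp_measurable_on_sets_lebesgue continuous_intros) auto

lemma transfer_limit:
  "(\<lambda>N. \<integral>\<^sup>+ x. ennreal ((cmod (A x - partial_transfer a N x))\<^sup>2) \<partial>L) \<longlonglongrightarrow> 0"
  using transfer unfolding transfer_function_def partial_transfer_def[symmetric]
  by (simp add: nn_integral_restrict_space)

text \<open>For fixed \<open>n\<close> the kernel is bounded by \<open>n\<close>, so multiplication
  by it preserves mean-square convergence of the partial sums. The case \<open>c = 0\<close> yields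
  the norm of the coefficient vector, \<open>c = 1\<close> its distance from the noise
  vector.\<close>

lemma spectral_limits:
  fixes c :: complex and u :: real and n :: nat
  assumes v: "v \<noteq> 0"
  defines "F \<equiv> \<lambda>N x. dirichlet n (u - x) * (partial_transfer a N x / v - c)"
    and "G \<equiv> \<lambda>x. dirichlet n (u - x) * (A x / v - c)"
  shows "integrable L (\<lambda>x. (cmod (G x))\<^sup>2)"
    and "(\<lambda>N. \<integral>x. (cmod (F N x))\<^sup>2 \<partial>L) \<longlonglongrightarrow> (\<integral>x. (cmod (G x))\<^sup>2 \<partial>L)"
proof -
  have F: "integrable L (\<lambda>x. (cmod (F N x))\<^sup>2)" for N
    unfolding F_def partial_transfer_def using v by (intro continuous_imp_integrable_real continuous_intros) auto
  have [measurable]: "F N \<in> borel_measurable L" "G \<in> borel_measurable L" for N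
    unfolding F_def G_def by measurable
  define K where "K = (real n / cmod v)\<^sup>2"
  have le: "(cmod (G x - F N x))\<^sup>2 \<le> K * (cmod (A x - partial_transfer a N x))\<^sup>2" for x N
  proof -
    have "G x - F N x = dirichlet n (u - x) * ((A x - partial_transfer a N x) / v)"
      by (simp add: G_def F_def algebra_simps diff_divide_distrib)
    then have "cmod (G x - F N x) \<le> real n * (cmod (A x - partial_transfer a N x) / cmod v)"
      using dirichlet_le[of n "u - x"] by (simp add: norm_mult norm_divide mult_right_mono divide_right_mono)
    then have "(cmod (G x - F N x))\<^sup>2 \<le> (real n * (cmod (A x - partial_transfer a N x) / cmod v))\<^sup>2"
      by (intro power_mono) auto
    then show ?thesis by (simp add: K_def power_divide power_mult_distrib)
  qed
  have K: "0 \<le> K" by (simp add: K_def)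
  have "(\<lambda>N. ennreal K * (\<integral>\<^sup>+ x. ennreal ((cmod (A x - partial_transfer a N x))\<^sup>2) \<partial>L)) \<longlonglongrightarrow> ennreal K * 0"
    by (intro ennreal_tendsto_cmult transfer_limit) simp
  then have lim0: "(\<lambda>N. \<integral>\<^sup>+ x. ennreal (K * (cmod (A x - partial_transfer a N x))\<^sup>2) \<partial>L) \<longlonglongrightarrow> 0"
    using K by (simp add: ennreal_mult nn_integral_cmult)
  have lim: "(\<lambda>N. \<integral>\<^sup>+ x. ennreal ((cmod (G x - F N x))\<^sup>2) \<partial>L) \<longlonglongrightarrow> 0"
    by (rule tendsto_sandwich[OF _ _ tendsto_const lim0])
      (auto intro!: always_eventually nn_integral_mono ennreal_leI le)
  show "integrable L (\<lambda>x. (cmod (G x))\<^sup>2)"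
    "(\<lambda>N. \<integral>x. (cmod (F N x))\<^sup>2 \<partial>L) \<longlonglongrightarrow> (\<integral>x. (cmod (G x))\<^sup>2 \<partial>L)"
    using L2_tendsto(1,4)[OF _ _ F lim] by simp_all
qed

text \<open>The conjugate appears because the periodogram is built with \<open>cis (t u)\<close> and
  the transfer function with the opposite sign: the filter acts at \<open>u\<close> through
  \<open>cnj (A u)\<close>.\<close>

definition coeff :: "nat \<Rightarrow> real \<Rightarrow> nat \<Rightarrow> int \<Rightarrow> complex" where
  "coeff n u N p = (\<Sum>t=1..n. cis (real t * u) * filter_coeff a N (int t - p)) / (of_real (sqrt (real n)) * cnj (A u))"

definition fourier_coeff :: "nat \<Rightarrow> real \<Rightarrow> int \<Rightarrow> complex" where
  "fourier_coeff n u p = (if p \<in> {1..int n} then cis (real_of_int p * u) / of_real (sqrt (real n)) else 0)"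

text \<open>At \<open>u = freq n j\<close> this is the expectation of the periodogram of
  \<open>X\<close> divided by the spectral density; \<open>remainder_moments\<close> shows it. The
  next definition is the limit of the squared distance of the coefficient vectors, the \<rho> of the
  overview.\<close>

definition mean_square :: "nat \<Rightarrow> real \<Rightarrow> real" where
  "mean_square n u = (\<integral>x. (cmod (dirichlet n (u - x) * (A x / A u)))\<^sup>2 \<partial>L) / (2 * pi * real n)"

definition mean_error :: "nat \<Rightarrow> real \<Rightarrow> real" where
  "mean_error n u = (\<integral>x. (cmod (dirichlet n (u - x)))\<^sup>2 * (rel_err u x)\<^sup>2 \<partial>L) / (2 * pi * real n)"

text \<open>The term \<open>- 0\<close> matches the shape of \<open>spectral_limits\<close> for
  \<open>c = 0\<close>.\<close>

lemma coeff_norm: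
  assumes "1 \<le> n" "A u \<noteq> 0"
  shows "(\<Sum>p\<in>{1 - int N..int n}. (cmod (coeff n u N p))\<^sup>2)
    = (\<integral>x. (cmod (dirichlet n (u - x) * (partial_transfer a N x / A u - 0)))\<^sup>2 \<partial>L) / (2 * pi * real n)"
proof -
  define \<alpha> where "\<alpha> k = filter_coeff a N k / cnj (A u)" for k
  have "coeff n u N p = (\<Sum>t=1..n. cis (real t * u) * \<alpha> (int t - p)) / of_real (sqrt (real n))" for p
    by (simp add: coeff_def \<alpha>_def sum_divide_distrib mult.commute)
  then have "(\<Sum>p\<in>{1 - int N..int n}. (cmod (coeff n u N p))\<^sup>2)
      = (\<Sum>p\<in>{1 - int N..int n}. (cmod (\<Sum>t=1..n. cis (real t * u) * \<alpha> (int t - p)))\<^sup>2) / real n"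
    by (simp add: norm_divide power_divide flip: sum_divide_distrib)
  also have "\<dots> = (\<integral>x. (cmod (dirichlet n (u - x) * (\<Sum>k<N. \<alpha> (int k) * cis (real k * x))))\<^sup>2 \<partial>L) / (2 * pi) / real n"
    by (subst convolution_norm) (auto simp: \<alpha>_def filter_coeff_def)
  also have "(\<lambda>x. \<Sum>k<N. \<alpha> (int k) * cis (real k * x)) = (\<lambda>x. cnj (partial_transfer a N x / A u))"
    unfolding \<alpha>_def complex_cnj_divide sum_filter_coeff[symmetric] by (simp add: sum_divide_distrib)
  finally show ?thesis by (simp only: norm_mult complex_mod_cnj diff_zero divide_divide_eq_left)
qed

text \<open>The noise is filtered by the unit impulse, so subtracting its coefficients subtracts the
  impulse from the filter and the constant 1 from the transform. \<open>1 \<le> N\<close> places the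
  impulse inside the support window.\<close>

lemma coeff_diff_norm:
  assumes "1 \<le> n" "A u \<noteq> 0" "1 \<le> N"
  shows "(\<Sum>p\<in>{1 - int N..int n}. (cmod (coeff n u N p - fourier_coeff n u p))\<^sup>2)
    = (\<integral>x. (cmod (dirichlet n (u - x) * (partial_transfer a N x / A u - 1)))\<^sup>2 \<partial>L) / (2 * pi * real n)"
proof -
  define \<alpha> where "\<alpha> k = filter_coeff a N k / cnj (A u) - of_bool (k = 0)" for k
  have "coeff n u N p - fourier_coeff n u p = (\<Sum>t=1..n. cis (real t * u) * \<alpha> (int t - p)) / of_real (sqrt (real n))" for p
  proof -
    have "(\<Sum>t=1..n. cis (real t * u) * of_bool (int t - p = 0)) = (\<Sum>t=1..n. if t = nat p \<and> 0 < p then cis (real t * u) else 0)"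
      by (intro sum.cong) auto
    also have "\<dots> = (if p \<in> {1..int n} then cis (real_of_int p * u) else 0)"
      by (auto simp: sum.delta)
    finally have f: "fourier_coeff n u p = (\<Sum>t=1..n. cis (real t * u) * of_bool (int t - p = 0)) / of_real (sqrt (real n))"
      by (simp add: fourier_coeff_def)
    show ?thesis
      unfolding f coeff_def \<alpha>_def by (simp add: sum_divide_distrib sum_subtractf right_diff_distrib diff_divide_distrib mult.commute del: diff_eq_diff_eq)
  qed
  then have "(\<Sum>p\<in>{1 - int N..int n}. (cmod (coeff n u N p - fourier_coeff n u p))\<^sup>2)
      = (\<Sum>p\<in>{1 - int N..int n}. (cmod (\<Sum>t=1..n. cis (real t * u) * \<alpha> (int t - p)))\<^sup>2) / real n"
    by (simp add: norm_divide power_divide flip: sum_divide_distrib)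
  also have "\<dots> = (\<integral>x. (cmod (dirichlet n (u - x) * (\<Sum>k<N. \<alpha> (int k) * cis (real k * x))))\<^sup>2 \<partial>L) / (2 * pi) / real n"
    using assms by (subst convolution_norm) (auto simp: \<alpha>_def filter_coeff_def)
  also have "(\<lambda>x. \<Sum>k<N. \<alpha> (int k) * cis (real k * x)) = (\<lambda>x. cnj (partial_transfer a N x / A u - 1))"
  proof
    fix x
    have "(\<Sum>k<N. of_bool (int k = 0) * cis (real k * x)) = (\<Sum>k<N. if k = 0 then 1 else 0)"
      by (intro sum.cong) auto
    also have "\<dots> = (1 :: complex)" using assms by simp
    finally show "(\<Sum>k<N. \<alpha> (int k) * cis (real k * x)) = cnj (partial_transfer a N x / A u - 1)"
      unfolding \<alpha>_def complex_cnj_divide complex_cnj_diff sum_filter_coeff[symmetric]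
      by (simp add: sum_divide_distrib sum_subtractf left_diff_distrib)
  qed
  finally show ?thesis by (simp only: norm_mult complex_mod_cnj divide_divide_eq_left)
qed

lemma coeff_limits:
  assumes "1 \<le> n" "0 < u" "u < pi"
  shows "(\<lambda>N. \<Sum>p\<in>{1 - int N..int n}. (cmod (coeff n u N p))\<^sup>2) \<longlonglongrightarrow> mean_square n u"
    and "(\<lambda>N. \<Sum>p\<in>{1 - int N..int n}. (cmod (coeff n u N p - fourier_coeff n u p))\<^sup>2) \<longlonglongrightarrow> mean_error n u"
proof -
  note nz = transfer_nonzero[OF assms(2,3)]
  show "(\<lambda>N. \<Sum>p\<in>{1 - int N..int n}. (cmod (coeff n u N p))\<^sup>2) \<longlonglongrightarrow> mean_square n u"
    unfolding coeff_norm[OF assms(1) nz] mean_square_def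
    using spectral_limits(2)[OF nz, of n u 0] assms by (intro tendsto_divide tendsto_const) simp_all
  have "(\<lambda>N. (\<integral>x. (cmod (dirichlet n (u - x) * (partial_transfer a N x / A u - 1)))\<^sup>2 \<partial>L) / (2 * pi * real n))
      \<longlonglongrightarrow> mean_error n u"
    unfolding mean_error_def rel_err_def
    using spectral_limits(2)[OF nz, of n u 1] assms
    by (intro tendsto_divide tendsto_const) (simp_all add: norm_mult power_mult_distrib)
  then show "(\<lambda>N. \<Sum>p\<in>{1 - int N..int n}. (cmod (coeff n u N p - fourier_coeff n u p))\<^sup>2) \<longlonglongrightarrow> mean_error n u"
    by (rule Lim_transform_eventually)
      (use coeff_diff_norm[OF assms(1) nz] in \<open>auto intro!: eventually_sequentiallyI[of 1]\<close>)
qed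

text \<open>The squared kernel integrates to \<open>2 * pi * real n\<close>, so subtracting 1
  becomes subtracting 1 from |A x / A u|^2 under the integral. That difference is at most the
  squared error plus twice the error, hence the factor 3 = 1 + 2.\<close>

lemma mean_error_bound:
  assumes "1 \<le> n" "0 < u" "u < pi"
  shows "mean_error n u \<le> K_err * (1 / u + 1 / (pi - u)) / (2 * pi * real n)"
    and "\<bar>mean_square n u - 1\<bar> \<le> 3 * (K_err * (1 / u + 1 / (pi - u) + ln (1 + real n * u) / u)) / (2 * pi * real n)"
proof -
  let ?D = "\<lambda>x. (cmod (dirichlet n (u - x)))\<^sup>2"
  note nz = transfer_nonzero[OF assms(2,3)]
  have i0: "integrable L (\<lambda>x. ?D x * (cmod (A x / A u))\<^sup>2)"
    using spectral_limits(1)[OF nz, of n u 0] by (simp only: diff_zero norm_mult power_mult_distrib)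
  have i2: "integrable L (\<lambda>x. ?D x * (rel_err u x)\<^sup>2)"
    using spectral_limits(1)[OF nz, of n u 1] by (simp add: norm_mult power_mult_distrib rel_err_def)
  have i1: "integrable L (\<lambda>x. ?D x * rel_err u x)"
  proof (rule Bochner_Integration.integrable_bound)
    show "integrable L (\<lambda>x. ?D x + ?D x * (rel_err u x)\<^sup>2)"
      using i2 integrable_dirichlet by simp
    show "(\<lambda>x. ?D x * rel_err u x) \<in> borel_measurable L"
      unfolding rel_err_def by measurable
    have "r \<le> 1 + r\<^sup>2" if "0 \<le> r" for r :: real
      using sum_squares_bound[of r 1] that by (simp add: power2_eq_square)
    then have "?D x * rel_err u x \<le> ?D x * (1 + (rel_err u x)\<^sup>2)" for x
      by (intro mult_left_mono) (auto simp: rel_err_def)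
    then show "AE x in L. norm (?D x * rel_err u x) \<le> norm (?D x + ?D x * (rel_err u x)\<^sup>2)"
      by (intro always_eventually) (simp add: rel_err_def distrib_left)
  qed
  have hk: "integral\<^sup>L L f = integral {-pi..pi} f" "f integrable_on {-pi..pi}" if "integrable L f" for f :: "real \<Rightarrow> real"
    using lebesgue_integral_eq_integral[OF that] integrable_on_lebesgue_on[OF that] by simp_all
  have b2: "(\<integral>x. ?D x * (rel_err u x)\<^sup>2 \<partial>L) \<le> K_err * (1 / u + 1 / (pi - u))"
    using integral_rel_square[OF assms(2,3)] hk[OF i2] by simp
  have b1: "(\<integral>x. ?D x * rel_err u x \<partial>L) \<le> K_err * (1 / u + 1 / (pi - u) + ln (1 + real n * u) / u)"
    using integral_rel[OF assms(2,3)] hk[OF i1] by simp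
  show "mean_error n u \<le> K_err * (1 / u + 1 / (pi - u)) / (2 * pi * real n)"
    unfolding mean_error_def using b2 by (intro divide_right_mono) auto
  have "mean_square n u - 1 = ((\<integral>x. ?D x * (cmod (A x / A u))\<^sup>2 \<partial>L) - (\<integral>x. ?D x \<partial>L)) / (2 * pi * real n)"
    unfolding mean_square_def norm_mult power_mult_distrib using assms by (simp add: integral_dirichlet diff_divide_distrib)
  also have "(\<integral>x. ?D x * (cmod (A x / A u))\<^sup>2 \<partial>L) - (\<integral>x. ?D x \<partial>L) = (\<integral>x. ?D x * ((cmod (A x / A u))\<^sup>2 - 1) \<partial>L)"
    using i0 integrable_dirichlet by (simp add: right_diff_distrib)
  finally have eq: "mean_square n u - 1 = (\<integral>x. ?D x * ((cmod (A x / A u))\<^sup>2 - 1) \<partial>L) / (2 * pi * real n)" .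
  have "\<bar>\<integral>x. ?D x * ((cmod (A x / A u))\<^sup>2 - 1) \<partial>L\<bar> \<le> (\<integral>x. \<bar>?D x * ((cmod (A x / A u))\<^sup>2 - 1)\<bar> \<partial>L)"
    by (rule integral_abs_bound)
  also have "\<dots> \<le> (\<integral>x. ?D x * (rel_err u x)\<^sup>2 + 2 * (?D x * rel_err u x) \<partial>L)"
  proof (rule integral_mono)
    show "integrable L (\<lambda>x. \<bar>?D x * ((cmod (A x / A u))\<^sup>2 - 1)\<bar>)"
      using i0 integrable_dirichlet[of n u] by (intro integrable_abs) (simp add: right_diff_distrib)
    show "integrable L (\<lambda>x. ?D x * (rel_err u x)\<^sup>2 + 2 * (?D x * rel_err u x))"
      using i1 i2 by simp
    fix x
    have "\<bar>(cmod z)\<^sup>2 - 1\<bar> \<le> (cmod (z - 1))\<^sup>2 + 2 * cmod (z - 1)" for z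
    proof -
      have h: "\<bar>cmod z - 1\<bar> \<le> cmod (z - 1)" using norm_triangle_ineq3[of z 1] by simp
      have "(cmod z)\<^sup>2 - 1 = (cmod z - 1) * ((cmod z - 1) + 2)"
        by (simp add: power2_eq_square algebra_simps)
      then have "\<bar>(cmod z)\<^sup>2 - 1\<bar> = \<bar>cmod z - 1\<bar> * \<bar>(cmod z - 1) + 2\<bar>" by (simp only: abs_mult)
      also have "\<dots> \<le> cmod (z - 1) * (cmod (z - 1) + 2)"
        using h by (intro mult_mono) auto
      finally show ?thesis by (simp add: power2_eq_square algebra_simps)
    qed
    then have "?D x * \<bar>(cmod (A x / A u))\<^sup>2 - 1\<bar> \<le> ?D x * ((rel_err u x)\<^sup>2 + 2 * rel_err u x)"
      unfolding rel_err_def by (intro mult_left_mono) auto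
    then show "\<bar>?D x * ((cmod (A x / A u))\<^sup>2 - 1)\<bar> \<le> ?D x * (rel_err u x)\<^sup>2 + 2 * (?D x * rel_err u x)"
      unfolding abs_mult abs_power2 by (simp only: distrib_left mult.left_commute)
  qed
  also have "\<dots> = (\<integral>x. ?D x * (rel_err u x)\<^sup>2 \<partial>L) + 2 * (\<integral>x. ?D x * rel_err u x \<partial>L)"
    using i1 i2 by simp
  also have "\<dots> \<le> K_err * (1 / u + 1 / (pi - u) + ln (1 + real n * u) / u) + 2 * (K_err * (1 / u + 1 / (pi - u) + ln (1 + real n * u) / u))"
  proof -
    have "K_err * (1 / u + 1 / (pi - u)) \<le> K_err * (1 / u + 1 / (pi - u) + ln (1 + real n * u) / u)"
      using K_err assms by (intro mult_left_mono) auto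
    then show ?thesis using b1 b2 by linarith
  qed
  finally show "\<bar>mean_square n u - 1\<bar> \<le> 3 * (K_err * (1 / u + 1 / (pi - u) + ln (1 + real n * u) / u)) / (2 * pi * real n)"
    unfolding eq abs_divide by (simp add: divide_right_mono)
qed

section \<open>Specialization to the Fourier frequencies\<close>

lemma freq_bounds:
  assumes "j \<in> {1..\<nu> n}"
  shows "0 < freq n j" "freq n j < pi" "1 \<le> n" "j < n"
    and "1 / freq n j / (2 * pi * real n) \<le> 1 / real j"
    and "1 / (pi - freq n j) / (2 * pi * real n) \<le> 1 / real (\<nu> n + 1 - j)"
    and "ln (1 + real n * freq n j) \<le> 8 * (1 + ln (real j))"
proof -
  \<comment> \<open>The range ends at [n/2] - 1, which leaves a gap below \<pi>:
    \<open>\<nu> n + 1 - j\<close> is [n/2] - j, positive and at most n - 2 j, and \<pi> - u is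
    \<pi> (n - 2 j) / n.\<close>
  have j: "1 \<le> j" "2 * j + 2 \<le> n" using assms by (auto simp: \<nu>_def)
  then have n: "0 < real n" "1 \<le> n" "j < n" by auto
  show "1 \<le> n" "j < n" by (rule n)+
  show "0 < freq n j" using j n by (simp add: freq_def)
  have "2 * real j < real n" using j by linarith
  then show "freq n j < pi" using n by (simp add: freq_def field_simps)
  have nf: "real n * freq n j = 2 * pi * real j" using n by (simp add: freq_def)
  have "1 / freq n j / (2 * pi * real n) = 1 / (2 * pi * (real n * freq n j))" by simp
  also have "\<dots> \<le> 1 / real j"
    unfolding nf
  proof (intro divide_left_mono)
    have "1 * 1 \<le> 2 * pi * (2 * pi)" using pi_gt3 by (intro mult_mono) auto
    then have "1 * real j \<le> 2 * pi * (2 * pi) * real j" by (intro mult_right_mono) auto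
    then show "real j \<le> 2 * pi * (2 * pi * real j)" by (simp add: mult_ac)
  qed (use j in auto)
  finally show "1 / freq n j / (2 * pi * real n) \<le> 1 / real j" .
  have "1 / (pi - freq n j) / (2 * pi * real n) = 1 / (2 * pi * (pi * real n - real n * freq n j))"
    by (simp add: algebra_simps)
  also have "\<dots> = 1 / (2 * pi * pi * (real n - 2 * real j))"
    unfolding nf by (simp add: algebra_simps)
  also have "\<dots> \<le> 1 / real (\<nu> n + 1 - j)"
  proof (intro divide_left_mono)
    have "real (\<nu> n + 1 - j) \<le> real (n - 2 * j)" using j by (simp add: \<nu>_def)
    also have "\<dots> = real n - 2 * real j" using j by (simp add: of_nat_diff)
    also have "\<dots> = 1 * (real n - 2 * real j)" by simp
    also have "\<dots> \<le> (2 * pi * pi) * (real n - 2 * real j)"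
    proof (intro mult_right_mono)
      have "1 * 1 \<le> 2 * pi * pi" using pi_gt3 by (intro mult_mono) auto
      then show "1 \<le> 2 * pi * pi" by simp
    qed (use \<open>2 * real j < real n\<close> in simp)
    finally show "real (\<nu> n + 1 - j) \<le> 2 * pi * pi * (real n - 2 * real j)" .
    show "0 < 2 * pi * pi * (real n - 2 * real j) * real (\<nu> n + 1 - j)"
      using assms \<open>2 * real j < real n\<close> by simp
  qed simp
  finally show "1 / (pi - freq n j) / (2 * pi * real n) \<le> 1 / real (\<nu> n + 1 - j)" .
  \<comment> \<open>From 2 \<pi> < 8 and \<open>j \<ge> 1\<close>; the constant 8 of the claim is
    \<open>9 - 1\<close>, a bound for \<open>ln 9\<close>.\<close>
  have "1 + real n * freq n j \<le> 9 * real j"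
  proof -
    have "2 * pi * real j \<le> 8 * real j" using pi_less_4 by (intro mult_right_mono) auto
    then show ?thesis using j unfolding nf by linarith
  qed
  then have "ln (1 + real n * freq n j) \<le> ln (9 * real j)"
    using j unfolding nf by (intro ln_mono) (auto simp: add_pos_nonneg)
  also have "\<dots> = ln 9 + ln (real j)" using j by (simp add: ln_mult)
  also have "\<dots> \<le> 8 * (1 + ln (real j))"
  proof -
    have "ln 9 \<le> (9 :: real) - 1" by (rule ln_le_minus_one) simp
    moreover have "0 \<le> ln (real j)" using j by simp
    ultimately show ?thesis by simp
  qed
  finally show "ln (1 + real n * freq n j) \<le> 8 * (1 + ln (real j))" .
qed

text \<open>The division by \<open>n\<close> turns \<open>1 / u\<close> and
  \<open>1 / (pi - u)\<close> into the reciprocals of the two distances counted in frequencies. The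
  constant is 27 = 3 * (1 + 8), with 8 from the logarithmic term.\<close>

lemma freq_mean_error:
  assumes "j \<in> {1..\<nu> n}"
  shows "mean_error n (freq n j) \<le> K_err * (1 / real j + 1 / real (\<nu> n + 1 - j))"
    and "\<bar>mean_square n (freq n j) - 1\<bar> \<le> 27 * K_err * (log_weight j + log_weight (\<nu> n + 1 - j))"
proof -
  note fb = freq_bounds[OF assms]
  let ?u = "freq n j" and ?m = "\<nu> n + 1 - j"
  note mb = mean_error_bound[OF fb(3,1,2)]
  have "K_err * (1 / ?u + 1 / (pi - ?u)) / (2 * pi * real n) = K_err * (1 / ?u / (2 * pi * real n) + 1 / (pi - ?u) / (2 * pi * real n))"
    by (simp only: times_divide_eq_right[symmetric] add_divide_distrib)
  also have "\<dots> \<le> K_err * (1 / real j + 1 / real ?m)"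
    using fb K_err by (intro mult_left_mono add_mono) auto
  finally show "mean_error n ?u \<le> K_err * (1 / real j + 1 / real ?m)" using mb(1) by linarith
  have lw: "1 / real j \<le> log_weight j" "1 / real ?m \<le> log_weight ?m"
    using assms unfolding atLeastAtMost_iff by (intro log_weight_ge; linarith)+
  have ln: "ln (1 + real n * ?u) / ?u / (2 * pi * real n) \<le> 8 * log_weight j"
  proof -
    have "ln (1 + real n * ?u) / ?u / (2 * pi * real n) = ln (1 + real n * ?u) * (1 / ?u / (2 * pi * real n))" by simp
    also have "\<dots> \<le> (8 * (1 + ln (real j))) * (1 / real j)"
      using fb assms by (intro mult_mono) auto
    finally show ?thesis by (simp add: log_weight_def)
  qed
  have "3 * (K_err * (1 / ?u + 1 / (pi - ?u) + ln (1 + real n * ?u) / ?u)) / (2 * pi * real n)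
    = 3 * K_err * (1 / ?u / (2 * pi * real n) + 1 / (pi - ?u) / (2 * pi * real n) + ln (1 + real n * ?u) / ?u / (2 * pi * real n))"
    by (simp only: times_divide_eq_right[symmetric] add_divide_distrib mult.assoc)
  also have "\<dots> \<le> 3 * K_err * (9 * (log_weight j + log_weight ?m))"
  proof (intro mult_left_mono)
    have "0 \<le> log_weight ?m" using lw(2) by (rule order_trans[rotated]) simp
    moreover have "1 / ?u / (2 * pi * real n) + 1 / (pi - ?u) / (2 * pi * real n) + ln (1 + real n * ?u) / ?u / (2 * pi * real n)
        \<le> log_weight j + log_weight ?m + 8 * log_weight j"
      using order_trans[OF fb(5) lw(1)] order_trans[OF fb(6) lw(2)] ln by (intro add_mono)
    moreover have "0 \<le> log_weight j" using lw(1) by (rule order_trans[rotated]) simp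
    ultimately show "1 / ?u / (2 * pi * real n) + 1 / (pi - ?u) / (2 * pi * real n) + ln (1 + real n * ?u) / ?u / (2 * pi * real n)
        \<le> 9 * (log_weight j + log_weight ?m)"
      unfolding distrib_left by (elim order_trans) simp
  qed (use K_err in simp)
  finally show "\<bar>mean_square n ?u - 1\<bar> \<le> 27 * K_err * (log_weight j + log_weight ?m)"
    using mb(2) by linarith
qed

end

section \<open>Passage to the limit\<close>

lemma norm_sum_square_expand:
  "(cmod (\<Sum>p\<in>I. c p * of_real (z p)))\<^sup>2 = (\<Sum>p\<in>I. \<Sum>q\<in>I. Re (c p * cnj (c q)) * (z p * z q))"
proof -
  have "(cmod (\<Sum>p\<in>I. c p * of_real (z p)))\<^sup>2 = Re ((\<Sum>p\<in>I. c p * of_real (z p)) * cnj (\<Sum>p\<in>I. c p * of_real (z p)))"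
    unfolding complex_norm_square[symmetric] by simp
  also have "\<dots> = (\<Sum>p\<in>I. \<Sum>q\<in>I. Re ((c p * of_real (z p)) * cnj (c q * of_real (z q))))"
    unfolding cnj_sum sum_product by simp
  also have "\<dots> = (\<Sum>p\<in>I. \<Sum>q\<in>I. Re (c p * cnj (c q)) * (z p * z q))"
    by (intro sum.cong refl) (simp add: algebra_simps)
  finally show ?thesis .
qed

text \<open>Fatou's lemma. Mean-square convergence of the process yields only L1 convergence of its
  periodograms, which does not by itself pass second moments to the limit; an upper bound suffices
  here. Pointwise convergence holds along a subsequence, the bounds \<open>V\<close> converge along
  the whole sequence.\<close>

lemma integral_square_le_limit:
  fixes f :: "nat \<Rightarrow> 'a \<Rightarrow> real" and V :: "nat \<Rightarrow> real"
  assumes [measurable]: "\<And>N. f N \<in> borel_measurable M" "g \<in> borel_measurable M"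
    and lim: "AE w in M. (\<lambda>N. f (r N) w) \<longlonglongrightarrow> g w" and r: "strict_mono r"
    and int: "\<And>N. integrable M (\<lambda>w. (f N w)\<^sup>2)"
    and le: "\<And>N. 1 \<le> N \<Longrightarrow> (\<integral>w. (f N w)\<^sup>2 \<partial>M) \<le> V N" and V: "V \<longlonglongrightarrow> v"
  shows "integrable M (\<lambda>w. (g w)\<^sup>2)" and "(\<integral>w. (g w)\<^sup>2 \<partial>M) \<le> v"
proof -
  have "0 \<le> V N" if "1 \<le> N" for N
    using le[OF that] by (rule order_trans[rotated]) simp
  then have v: "0 \<le> v"
    by (intro tendsto_lowerbound[OF V]) (auto intro: eventually_sequentiallyI[of 1])
  have "(\<integral>\<^sup>+ w. ennreal ((g w)\<^sup>2) \<partial>M) = (\<integral>\<^sup>+ w. liminf (\<lambda>N. ennreal ((f (r N) w)\<^sup>2)) \<partial>M)"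
  proof (rule nn_integral_cong_AE)
    show "AE w in M. ennreal ((g w)\<^sup>2) = liminf (\<lambda>N. ennreal ((f (r N) w)\<^sup>2))"
      using lim
    proof eventually_elim
      case (elim w)
      have "(\<lambda>N. ennreal ((f (r N) w)\<^sup>2)) \<longlonglongrightarrow> ennreal ((g w)\<^sup>2)"
        by (intro tendsto_ennrealI tendsto_power elim)
      then show ?case by (rule lim_imp_Liminf[OF sequentially_bot, symmetric])
    qed
  qed
  also have "\<dots> \<le> liminf (\<lambda>N. \<integral>\<^sup>+ w. ennreal ((f (r N) w)\<^sup>2) \<partial>M)"
    by (rule nn_integral_liminf) simp
  also have "\<dots> \<le> liminf (\<lambda>N. ennreal (V (r N)))"
  proof (rule Liminf_mono, rule eventually_sequentiallyI[of 1])
    fix N :: nat assume "1 \<le> N"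
    then have "1 \<le> r N" using seq_suble[OF r, of N] by simp
    then show "(\<integral>\<^sup>+ w. ennreal ((f (r N) w)\<^sup>2) \<partial>M) \<le> ennreal (V (r N))"
      using le[of "r N"] int by (simp add: nn_integral_eq_integral ennreal_leI)
  qed
  also have "\<dots> = ennreal v"
  proof -
    have "(\<lambda>N. ennreal (V (r N))) \<longlonglongrightarrow> ennreal v"
      using LIMSEQ_subseq_LIMSEQ[OF V r] by (intro tendsto_ennrealI) (simp add: comp_def)
    then show ?thesis by (rule lim_imp_Liminf[OF sequentially_bot])
  qed
  finally have le_v: "(\<integral>\<^sup>+ w. ennreal ((g w)\<^sup>2) \<partial>M) \<le> ennreal v" .
  then show "integrable M (\<lambda>w. (g w)\<^sup>2)"
    by (intro integrableI_nonneg) (auto simp: le_less_trans)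
  then show "(\<integral>w. (g w)\<^sup>2 \<partial>M) \<le> v"
    using le_v v by (simp add: nn_integral_eq_integral ennreal_le_iff)
qed

section \<open>Complex linear forms and differences of their squared moduli\<close>

context white_noise
begin

lemma complex_linear_form:
  fixes c :: "int \<Rightarrow> complex"
  assumes "finite I"
  shows "integrable M (\<lambda>w. (cmod (\<Sum>p\<in>I. c p * of_real (\<zeta> p w)))\<^sup>2)"
    and "expectation (\<lambda>w. (cmod (\<Sum>p\<in>I. c p * of_real (\<zeta> p w)))\<^sup>2) = (\<Sum>p\<in>I. (cmod (c p))\<^sup>2)"
proof -
  have eq: "(cmod (\<Sum>p\<in>I. c p * of_real (\<zeta> p w)))\<^sup>2
      = (\<Sum>p\<in>I. Re (c p) * \<zeta> p w)\<^sup>2 + (\<Sum>p\<in>I. Im (c p) * \<zeta> p w)\<^sup>2" for w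
    by (simp add: cmod_power2)
  show "integrable M (\<lambda>w. (cmod (\<Sum>p\<in>I. c p * of_real (\<zeta> p w)))\<^sup>2)"
    "expectation (\<lambda>w. (cmod (\<Sum>p\<in>I. c p * of_real (\<zeta> p w)))\<^sup>2) = (\<Sum>p\<in>I. (cmod (c p))\<^sup>2)"
    unfolding eq using linear_form(3,4)[OF assms] by (simp_all add: cmod_power2 sum.distrib)
qed

text \<open>\<open>Y\<close> is the centered form of the kernel difference: each \<open>e j\<close>
  has norm 1, so the subtracted sum is the trace of \<open>Q\<close>.\<close>

lemma quadratic_difference_variance:
  fixes b :: "'j \<Rightarrow> real" and c e :: "'j \<Rightarrow> int \<Rightarrow> complex"
  assumes "finite I" "finite J"
    and orth: "\<And>j k. j \<in> J \<Longrightarrow> k \<in> J \<Longrightarrow> (\<Sum>q\<in>I. e j q * cnj (e k q)) = of_bool (j = k)"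
  defines "\<rho> \<equiv> \<lambda>j. \<Sum>p\<in>I. (cmod (c j p - e j p))\<^sup>2"
    and "Y \<equiv> \<lambda>w. (\<Sum>j\<in>J. b j * ((cmod (\<Sum>p\<in>I. c j p * of_real (\<zeta> p w)))\<^sup>2 - (cmod (\<Sum>p\<in>I. e j p * of_real (\<zeta> p w)))\<^sup>2))
      - (\<Sum>j\<in>J. b j * ((\<Sum>p\<in>I. (cmod (c j p))\<^sup>2) - 1))"
  shows "integrable M (\<lambda>w. (Y w)\<^sup>2)"
    and "expectation (\<lambda>w. (Y w)\<^sup>2) \<le> (1 + \<kappa>) * (3 * (\<Sum>j\<in>J. \<bar>b j\<bar> * \<rho> j)\<^sup>2 + 6 * (\<Sum>j\<in>J. (b j)\<^sup>2 * \<rho> j))"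
proof -
  define Q where "Q p q = (\<Sum>j\<in>J. b j * (Re (c j p * cnj (c j q)) - Re (e j p * cnj (e j q))))" for p q
  have "(\<Sum>j\<in>J. b j * ((cmod (\<Sum>p\<in>I. c j p * of_real (\<zeta> p w)))\<^sup>2 - (cmod (\<Sum>p\<in>I. e j p * of_real (\<zeta> p w)))\<^sup>2))
      = (\<Sum>p\<in>I. \<Sum>q\<in>I. Q p q * (\<zeta> p w * \<zeta> q w))" for w
  proof -
    have "(\<Sum>j\<in>J. b j * ((cmod (\<Sum>p\<in>I. c j p * of_real (\<zeta> p w)))\<^sup>2 - (cmod (\<Sum>p\<in>I. e j p * of_real (\<zeta> p w)))\<^sup>2))
      = (\<Sum>j\<in>J. \<Sum>p\<in>I. \<Sum>q\<in>I. b j * (Re (c j p * cnj (c j q)) - Re (e j p * cnj (e j q))) * (\<zeta> p w * \<zeta> q w))"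
      unfolding norm_sum_square_expand sum_subtractf[symmetric] sum_distrib_left left_diff_distrib[symmetric] mult.assoc ..
    also have "\<dots> = (\<Sum>p\<in>I. \<Sum>q\<in>I. Q p q * (\<zeta> p w * \<zeta> q w))"
      unfolding Q_def sum_distrib_right by (subst sum.swap) (intro sum.cong refl sum.swap)
    finally show ?thesis .
  qed
  moreover have "(\<Sum>j\<in>J. b j * ((\<Sum>p\<in>I. (cmod (c j p))\<^sup>2) - 1)) = (\<Sum>p\<in>I. Q p p)"
  proof -
    have re: "Re (z * cnj z) = (cmod z)\<^sup>2" for z
      unfolding complex_norm_square[symmetric] by simp
    have "(\<Sum>p\<in>I. (cmod (e j p))\<^sup>2) = 1" if "j \<in> J" for j
    proof -
      have "(\<Sum>p\<in>I. (cmod (e j p))\<^sup>2) = Re (\<Sum>q\<in>I. e j q * cnj (e j q))"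
        unfolding Re_sum re ..
      then show ?thesis using orth[OF that that] by simp
    qed
    then have "(\<Sum>j\<in>J. b j * ((\<Sum>p\<in>I. (cmod (c j p))\<^sup>2) - 1)) = (\<Sum>j\<in>J. b j * ((\<Sum>p\<in>I. (cmod (c j p))\<^sup>2) - (\<Sum>p\<in>I. (cmod (e j p))\<^sup>2)))"
      by (intro sum.cong refl) simp
    also have "\<dots> = (\<Sum>p\<in>I. Q p p)"
      unfolding Q_def re sum_subtractf[symmetric] sum_distrib_left by (rule sum.swap)
    finally show ?thesis .
  qed
  ultimately have Y: "Y w = centered_form Q I (\<lambda>i. \<zeta> i w)" for w
    by (simp add: Y_def centered_form_def)
  have cf: "integrable M (\<lambda>w. (Y w)\<^sup>2)" "expectation (\<lambda>w. (Y w)\<^sup>2) \<le> (1 + \<kappa>) * (\<Sum>p\<in>I. \<Sum>q\<in>I. (Q p q)\<^sup>2)"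
    using centered_form_bound[OF assms(1), of Q] by (simp_all add: Y)
  show "integrable M (\<lambda>w. (Y w)\<^sup>2)" by (rule cf(1))
  have "(1 + \<kappa>) * (\<Sum>p\<in>I. \<Sum>q\<in>I. (Q p q)\<^sup>2) \<le> (1 + \<kappa>) * (3 * (\<Sum>j\<in>J. \<bar>b j\<bar> * \<rho> j)\<^sup>2 + 6 * (\<Sum>j\<in>J. (b j)\<^sup>2 * \<rho> j))"
    unfolding Q_def \<rho>_def using fourth_moment_ge_one by (intro mult_left_mono frobenius_bound assms(2) orth) auto
  with cf(2) show "expectation (\<lambda>w. (Y w)\<^sup>2) \<le> (1 + \<kappa>) * (3 * (\<Sum>j\<in>J. \<bar>b j\<bar> * \<rho> j)\<^sup>2 + 6 * (\<Sum>j\<in>J. (b j)\<^sup>2 * \<rho> j))"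
    by linarith
qed

end

section \<open>Truncations of the process and their limits\<close>

locale filtered_noise = white_noise M \<zeta> \<kappa> + spectral_filter A g d C0 C1 C2 a
  for M :: "'w measure" and \<zeta> \<kappa> A g d C0 C1 C2 a +
  fixes X :: "int \<Rightarrow> 'w \<Rightarrow> real"
  assumes process: "linear_process M a \<zeta> X"
begin

definition truncated :: "nat \<Rightarrow> int \<Rightarrow> 'w \<Rightarrow> real" where
  "truncated N t w = (\<Sum>k<N. a k * \<zeta> (t - int k) w)"

definition dft :: "nat \<Rightarrow> real \<Rightarrow> (int \<Rightarrow> real) \<Rightarrow> complex" where
  "dft n u x = (\<Sum>t=1..n. cis (real t * u) * of_real (x (int t))) / of_real (sqrt (real n))"

lemma process_measurable [measurable]: "X t \<in> borel_measurable M"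
  using process by (simp add: linear_process_def)

lemma truncated_measurable [measurable]: "truncated N t \<in> borel_measurable M"
  unfolding truncated_def by measurable

lemma truncated_limit: "(\<lambda>N. \<integral>\<^sup>+ w. ennreal ((X t w - truncated N t w)\<^sup>2) \<partial>M) \<longlonglongrightarrow> 0"
  using process unfolding linear_process_def truncated_def by blast

lemma truncated_square_integrable: "integrable M (\<lambda>w. (truncated N t w)\<^sup>2)"
  unfolding truncated_def using integrable_noise
  by (intro integrable_square_sum) (auto simp: power_mult_distrib)

lemma dft_truncated:
  "dft n u (\<lambda>t. truncated N t w) / cnj (A u) = (\<Sum>p\<in>{1 - int N..int n}. coeff n u N p * of_real (\<zeta> p w))"
proof -
  have tr: "complex_of_real (truncated N (int t) w) = (\<Sum>p\<in>{1 - int N..int n}. filter_coeff a N (int t - p) * of_real (\<zeta> p w))"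
    if "t \<in> {1..n}" for t
  proof -
    have "(\<Sum>p\<in>{1 - int N..int n}. filter_coeff a N (int t - p) * of_real (\<zeta> (int t - (int t - p)) w))
        = (\<Sum>k<N. filter_coeff a N (int k) * of_real (\<zeta> (int t - int k) w))"
      by (rule sum_shift_support[OF that, where h = "\<lambda>k. filter_coeff a N k * of_real (\<zeta> (int t - k) w)"])
        (auto simp: filter_coeff_def)
    also have "\<dots> = complex_of_real (truncated N (int t) w)"
      unfolding truncated_def of_real_sum by (intro sum.cong refl) (simp add: filter_coeff_def)
    finally show ?thesis by simp
  qed
  have "dft n u (\<lambda>t. truncated N t w) = (\<Sum>t=1..n. \<Sum>p\<in>{1 - int N..int n}. cis (real t * u) * filter_coeff a N (int t - p) * of_real (\<zeta> p w)) / of_real (sqrt (real n))"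
    unfolding dft_def using tr by (simp add: sum_distrib_left mult.assoc)
  also have "\<dots> = (\<Sum>p\<in>{1 - int N..int n}. (\<Sum>t=1..n. cis (real t * u) * filter_coeff a N (int t - p)) * of_real (\<zeta> p w)) / of_real (sqrt (real n))"
    unfolding sum_distrib_right by (subst sum.swap) (rule refl)
  finally show ?thesis
    unfolding coeff_def
    by (simp only: sum_divide_distrib[where A = "{1 - int N..int n}"] times_divide_eq_left divide_divide_eq_left)
qed

text \<open>\<open>N\<close> is free, since the coefficients vanish outside
  \<open>{1..int n}\<close>. The noise can therefore be expanded over the window of any
  truncation.\<close>

lemma dft_noise:
  "dft n u (\<lambda>t. \<zeta> t w) = (\<Sum>p\<in>{1 - int N..int n}. fourier_coeff n u p * of_real (\<zeta> p w))"
proof -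
  have "(\<Sum>p\<in>{1 - int N..int n}. fourier_coeff n u p * of_real (\<zeta> p w)) = (\<Sum>p\<in>{1..int n}. fourier_coeff n u p * of_real (\<zeta> p w))"
    by (intro sum.mono_neutral_right) (auto simp: fourier_coeff_def)
  also have "\<dots> = (\<Sum>t=1..n. fourier_coeff n u (int t) * of_real (\<zeta> (int t) w))"
    by (rule sum.reindex_bij_witness[of _ int nat]) auto
  also have "\<dots> = dft n u (\<lambda>t. \<zeta> t w)"
    unfolding dft_def sum_divide_distrib by (intro sum.cong refl) (simp add: fourier_coeff_def)
  finally show ?thesis by simp
qed

lemma fourier_coeff_orthonormal:
  assumes "j \<in> {1..\<nu> n}" "k \<in> {1..\<nu> n}"
  shows "(\<Sum>q\<in>{1 - int N..int n}. fourier_coeff n (freq n j) q * cnj (fourier_coeff n (freq n k) q)) = of_bool (j = k)"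
proof -
  have n: "1 \<le> n" "j < n" "k < n" using freq_bounds[OF assms(1)] freq_bounds[OF assms(2)] by auto
  have "(\<Sum>q\<in>{1 - int N..int n}. fourier_coeff n (freq n j) q * cnj (fourier_coeff n (freq n k) q))
      = (\<Sum>q\<in>{1..int n}. fourier_coeff n (freq n j) q * cnj (fourier_coeff n (freq n k) q))"
    by (intro sum.mono_neutral_right) (auto simp: fourier_coeff_def)
  also have "\<dots> = (\<Sum>t=1..n. fourier_coeff n (freq n j) (int t) * cnj (fourier_coeff n (freq n k) (int t)))"
    by (rule sum.reindex_bij_witness[of _ int nat]) auto
  also have "\<dots> = (\<Sum>t=1..n. cis (real t * (freq n j - freq n k)) / of_real (real n))"
  proof (intro sum.cong refl)
    fix t assume "t \<in> {1..n}"
    have "complex_of_real (sqrt (real n)) * complex_of_real (sqrt (real n)) = of_real (real n)"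
      by (simp flip: of_real_mult)
    then show "fourier_coeff n (freq n j) (int t) * cnj (fourier_coeff n (freq n k) (int t))
        = cis (real t * (freq n j - freq n k)) / of_real (real n)"
      using \<open>t \<in> {1..n}\<close> by (simp add: fourier_coeff_def cis_cnj cis_mult right_diff_distrib)
  qed
  also have "\<dots> = dirichlet n (freq n j - freq n k) / of_real (real n)"
    by (simp only: dirichlet_def sum_divide_distrib)
  also have "\<dots> = of_bool (j = k)"
  proof (cases "j = k")
    case True
    then show ?thesis using n by (simp add: dirichlet_def)
  next
    case False
    have "freq n j - freq n k = 2 * pi * (real j - real k) / real n"
      by (simp add: freq_def diff_divide_distrib right_diff_distrib)
    then show ?thesis using dirichlet_freq_zero[OF False n(2,3)] False by simp
  qed
  finally show ?thesis .
qed

text \<open>For fixed \<open>n\<close> the transform is a finite linear combination of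
  \<open>X 1, ..., X n\<close>; Cauchy-Schwarz carries mean-square convergence over with a factor
  \<open>K\<close> that depends on \<open>n\<close>, \<open>u\<close> and \<open>v\<close>
  only.\<close>

lemma dft_process_limit:
  shows "integrable M (\<lambda>w. (cmod (dft n u (\<lambda>t. X t w) / v))\<^sup>2)"
    and "(\<lambda>N. expectation (\<lambda>w. (cmod (dft n u (\<lambda>t. truncated N t w) / v))\<^sup>2))
      \<longlonglongrightarrow> expectation (\<lambda>w. (cmod (dft n u (\<lambda>t. X t w) / v))\<^sup>2)"
proof -
  define \<gamma> where "\<gamma> t = cis (real t * u) / of_real (sqrt (real n)) / v" for t :: nat
  have dft: "dft n u x / v = (\<Sum>t=1..n. \<gamma> t * of_real (x (int t)))" for x
    by (simp add: dft_def \<gamma>_def sum_divide_distrib)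
  define K where "K = (\<Sum>t=1..n. (cmod (\<gamma> t))\<^sup>2)"
  have K: "0 \<le> K" by (simp add: K_def sum_nonneg)
  have [measurable]: "(\<lambda>w. \<Sum>t=1..n. \<gamma> t * of_real (truncated N (int t) w)) \<in> borel_measurable M"
    "(\<lambda>w. \<Sum>t=1..n. \<gamma> t * of_real (X (int t) w)) \<in> borel_measurable M" for N
    by measurable
  have cs: "(cmod (\<Sum>t=1..n. \<gamma> t * of_real (h t)))\<^sup>2 \<le> K * (\<Sum>t=1..n. (h t)\<^sup>2)" for h :: "nat \<Rightarrow> real"
  proof -
    have "cmod (\<Sum>t=1..n. \<gamma> t * of_real (h t)) \<le> (\<Sum>t=1..n. cmod (\<gamma> t) * \<bar>h t\<bar>)"
      by (rule order_trans[OF norm_sum]) (simp add: norm_mult)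
    then have "(cmod (\<Sum>t=1..n. \<gamma> t * of_real (h t)))\<^sup>2 \<le> (\<Sum>t=1..n. cmod (\<gamma> t) * \<bar>h t\<bar>)\<^sup>2"
      by (intro power_mono) auto
    also have "\<dots> \<le> K * (\<Sum>t=1..n. (h t)\<^sup>2)"
      unfolding K_def by (rule order_trans[OF Cauchy_Schwarz_ineq_sum]) simp
    finally show ?thesis .
  qed
  have int: "integrable M (\<lambda>w. (cmod (\<Sum>t=1..n. \<gamma> t * of_real (truncated N (int t) w)))\<^sup>2)" for N
  proof (rule Bochner_Integration.integrable_bound)
    show "integrable M (\<lambda>w. K * (\<Sum>t=1..n. (truncated N (int t) w)\<^sup>2))"
      using truncated_square_integrable by simp
    show "AE w in M. norm ((cmod (\<Sum>t=1..n. \<gamma> t * of_real (truncated N (int t) w)))\<^sup>2)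
        \<le> norm (K * (\<Sum>t=1..n. (truncated N (int t) w)\<^sup>2))"
      using cs K by (intro always_eventually) (simp add: sum_nonneg)
  qed measurable
  have "(\<lambda>N. ennreal K * (\<Sum>t=1..n. \<integral>\<^sup>+ w. ennreal ((X (int t) w - truncated N (int t) w)\<^sup>2) \<partial>M)) \<longlonglongrightarrow> ennreal K * (\<Sum>t=1..n. 0)"
    by (intro ennreal_tendsto_cmult tendsto_sum truncated_limit) simp
  then have lim0: "(\<lambda>N. \<integral>\<^sup>+ w. ennreal (K * (\<Sum>t=1..n. (X (int t) w - truncated N (int t) w)\<^sup>2)) \<partial>M) \<longlonglongrightarrow> 0"
    using K by (simp add: ennreal_mult sum_nonneg nn_integral_cmult nn_integral_sum flip: sum_ennreal)
  have diff: "(\<Sum>t=1..n. \<gamma> t * of_real (X (int t) w)) - (\<Sum>t=1..n. \<gamma> t * of_real (truncated N (int t) w))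
      = (\<Sum>t=1..n. \<gamma> t * of_real (X (int t) w - truncated N (int t) w))" for w N
    by (simp add: sum_subtractf right_diff_distrib)
  have lim: "(\<lambda>N. \<integral>\<^sup>+ w. ennreal ((cmod ((\<Sum>t=1..n. \<gamma> t * of_real (X (int t) w))
      - (\<Sum>t=1..n. \<gamma> t * of_real (truncated N (int t) w))))\<^sup>2) \<partial>M) \<longlonglongrightarrow> 0"
    unfolding diff
    by (rule tendsto_sandwich[OF _ _ tendsto_const lim0], simp)
      (intro always_eventually allI nn_integral_mono ennreal_leI cs)
  show "integrable M (\<lambda>w. (cmod (dft n u (\<lambda>t. X t w) / v))\<^sup>2)"
    "(\<lambda>N. expectation (\<lambda>w. (cmod (dft n u (\<lambda>t. truncated N t w) / v))\<^sup>2))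
      \<longlonglongrightarrow> expectation (\<lambda>w. (cmod (dft n u (\<lambda>t. X t w) / v))\<^sup>2)"
    unfolding dft using L2_tendsto(1,4)[OF _ _ int lim] by simp_all
qed

text \<open>The errors at the times \<open>1..n\<close> are summed before a subsequence is
  extracted, so a single subsequence serves all of them.\<close>

lemma truncated_AE_subseq:
  obtains r :: "nat \<Rightarrow> nat" where "strict_mono r"
    and "AE w in M. \<forall>t\<in>{1..n}. (\<lambda>N. truncated (r N) (int t) w) \<longlonglongrightarrow> X (int t) w"
proof -
  define U where "U N w = (\<Sum>t=1..n. (X (int t) w - truncated N (int t) w)\<^sup>2)" for N w
  have l2: "integrable M (\<lambda>w. (X t w - truncated N t w)\<^sup>2)"
    "(\<lambda>N. expectation (\<lambda>w. (X t w - truncated N t w)\<^sup>2)) \<longlonglongrightarrow> 0" for N t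
    using L2_tendsto(2,3)[of "\<lambda>N. truncated N t" M "X t"] truncated_square_integrable truncated_limit by simp_all
  have int: "integrable M (U N)" for N
    unfolding U_def using l2 by simp
  have "(\<lambda>N. \<Sum>t=1..n. expectation (\<lambda>w. (X (int t) w - truncated N (int t) w)\<^sup>2)) \<longlonglongrightarrow> (\<Sum>t=1..n. 0)"
    by (intro tendsto_sum l2)
  then have "(\<lambda>N. \<integral>w. norm (U N w) \<partial>M) \<longlonglongrightarrow> 0"
    unfolding U_def using l2(1) by (simp add: sum_nonneg)
  from tendsto_L1_AE_subseq[OF int this] obtain r where r: "strict_mono r" "AE w in M. (\<lambda>N. U (r N) w) \<longlonglongrightarrow> 0"
    by blast
  show ?thesis
  proof (rule that[OF r(1)])
    show "AE w in M. \<forall>t\<in>{1..n}. (\<lambda>N. truncated (r N) (int t) w) \<longlonglongrightarrow> X (int t) w"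
      using r(2)
    proof eventually_elim
      case (elim w)
      show ?case
      proof
        fix t assume t: "t \<in> {1..n}"
        have "(\<lambda>N. (X (int t) w - truncated (r N) (int t) w)\<^sup>2) \<longlonglongrightarrow> 0"
        proof (rule tendsto_sandwich[OF _ _ tendsto_const elim])
          show "\<forall>\<^sub>F N in sequentially. (X (int t) w - truncated (r N) (int t) w)\<^sup>2 \<le> U (r N) w"
            unfolding U_def using t
            by (intro always_eventually allI member_le_sum[of t _ "\<lambda>t. (X (int t) w - truncated (r _) (int t) w)\<^sup>2"]) auto
        qed simp
        then have "(\<lambda>N. sqrt ((X (int t) w - truncated (r N) (int t) w)\<^sup>2)) \<longlonglongrightarrow> sqrt 0"
          by (intro tendsto_real_sqrt)
        then have "(\<lambda>N. X (int t) w - truncated (r N) (int t) w) \<longlonglongrightarrow> 0"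
          by (simp add: tendsto_rabs_zero_iff)
        then have "(\<lambda>N. X (int t) w - (X (int t) w - truncated (r N) (int t) w)) \<longlonglongrightarrow> X (int t) w - 0"
          by (intro tendsto_diff tendsto_const)
        then show "(\<lambda>N. truncated (r N) (int t) w) \<longlonglongrightarrow> X (int t) w" by simp
      qed
    qed
  qed
qed

text \<open>Only moduli enter, so division by \<open>cnj (A u)\<close> reproduces the spectral
  density and the factors 2 \<pi> cancel.\<close>

lemma remainder_eq:
  "S_X b A X n w - S_\<zeta> b \<zeta> n w
    = (\<Sum>j=1..\<nu> n. b n j * ((cmod (dft n (freq n j) (\<lambda>t. X t w) / cnj (A (freq n j))))\<^sup>2 - (cmod (dft n (freq n j) (\<lambda>t. \<zeta> t w)))\<^sup>2))"
  unfolding S_X_def S_\<zeta>_def sum_subtractf[symmetric] right_diff_distrib[symmetric]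
  by (intro sum.cong refl)
    (simp add: periodogram_def spectral_density_def dft_def norm_divide power_divide norm_mult power_mult_distrib)

text \<open>The mean is identified exactly by mean-square convergence at each frequency, the
  variance is bounded through Fatou. Square integrability of the remainder comes out of the same
  argument.\<close>

lemma remainder_moments:
  fixes b :: "nat \<Rightarrow> nat \<Rightarrow> real" and n :: nat
  defines "R \<equiv> \<lambda>w. S_X b A X n w - S_\<zeta> b \<zeta> n w"
  assumes n: "1 \<le> n"
  shows "integrable M R" and "integrable M (\<lambda>w. (R w)\<^sup>2)"
    and "expectation R = (\<Sum>j=1..\<nu> n. b n j * (mean_square n (freq n j) - 1))"
    and "expectation (\<lambda>w. (R w - expectation R)\<^sup>2) \<le> (1 + \<kappa>) *
      (3 * (\<Sum>j=1..\<nu> n. \<bar>b n j\<bar> * mean_error n (freq n j))\<^sup>2 + 6 * (\<Sum>j=1..\<nu> n. (b n j)\<^sup>2 * mean_error n (freq n j)))"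
proof -
  let ?J = "{1..\<nu> n}" and ?u = "freq n" and ?I = "\<lambda>N. {1 - int N..int n}"
  let ?W = "\<lambda>j w. dft n (?u j) (\<lambda>t. X t w) / cnj (A (?u j))"
    and ?WN = "\<lambda>N j w. dft n (?u j) (\<lambda>t. truncated N t w) / cnj (A (?u j))"
    and ?Z = "\<lambda>j w. dft n (?u j) (\<lambda>t. \<zeta> t w)"
  define m where "m = (\<Sum>j\<in>?J. b n j * (mean_square n (?u j) - 1))"
  define mN where "mN N = (\<Sum>j\<in>?J. b n j * ((\<Sum>p\<in>?I N. (cmod (coeff n (?u j) N p))\<^sup>2) - 1))" for N
  define RN where "RN N w = (\<Sum>j\<in>?J. b n j * ((cmod (?WN N j w))\<^sup>2 - (cmod (?Z j w))\<^sup>2))" for N w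
  define \<rho> where "\<rho> N j = (\<Sum>p\<in>?I N. (cmod (coeff n (?u j) N p - fourier_coeff n (?u j) p))\<^sup>2)" for N j
  define V where "V N = (1 + \<kappa>) * (3 * (\<Sum>j\<in>?J. \<bar>b n j\<bar> * \<rho> N j)\<^sup>2 + 6 * (\<Sum>j\<in>?J. (b n j)\<^sup>2 * \<rho> N j))" for N
  have R: "R w = (\<Sum>j\<in>?J. b n j * ((cmod (?W j w))\<^sup>2 - (cmod (?Z j w))\<^sup>2))" for w
    unfolding R_def by (rule remainder_eq)
  have u: "0 < ?u j" "?u j < pi" if "j \<in> ?J" for j
    using freq_bounds[OF that] by auto
  have Z: "integrable M (\<lambda>w. (cmod (?Z j w))\<^sup>2)" "expectation (\<lambda>w. (cmod (?Z j w))\<^sup>2) = 1" if "j \<in> ?J" for j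
  proof -
    \<comment> \<open>For \<open>N = 0\<close> the window is exactly
      \<open>{1..int n}\<close>.\<close>
    have "(\<Sum>p\<in>?I 0. (cmod (fourier_coeff n (?u j) p))\<^sup>2) = Re (\<Sum>q\<in>?I 0. fourier_coeff n (?u j) q * cnj (fourier_coeff n (?u j) q))"
      unfolding Re_sum complex_norm_square[symmetric] by simp
    also have "\<dots> = 1" unfolding fourier_coeff_orthonormal[OF that that] by simp
    finally show "integrable M (\<lambda>w. (cmod (?Z j w))\<^sup>2)" "expectation (\<lambda>w. (cmod (?Z j w))\<^sup>2) = 1"
      unfolding dft_noise[where N = 0] using complex_linear_form[of "?I 0" "fourier_coeff n (?u j)"] by simp_all
  qed
  have W: "expectation (\<lambda>w. (cmod (?W j w))\<^sup>2) = mean_square n (?u j)" if "j \<in> ?J" for j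
  proof (rule LIMSEQ_unique)
    show "(\<lambda>N. expectation (\<lambda>w. (cmod (?WN N j w))\<^sup>2)) \<longlonglongrightarrow> expectation (\<lambda>w. (cmod (?W j w))\<^sup>2)"
      by (rule dft_process_limit)
    show "(\<lambda>N. expectation (\<lambda>w. (cmod (?WN N j w))\<^sup>2)) \<longlonglongrightarrow> mean_square n (?u j)"
      unfolding dft_truncated by (simp only: complex_linear_form finite_atLeastAtMost_int) (rule coeff_limits[OF n u[OF that]])
  qed
  show iR: "integrable M R"
    unfolding R using dft_process_limit(1) Z(1) by (intro Bochner_Integration.integrable_sum) auto
  have ER: "expectation R = m"
    unfolding R m_def using dft_process_limit(1) Z W by (simp add: Bochner_Integration.integral_sum)
  then show "expectation R = (\<Sum>j=1..\<nu> n. b n j * (mean_square n (freq n j) - 1))"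
    by (simp add: m_def)
  have mlim: "mN \<longlonglongrightarrow> m"
    unfolding mN_def m_def
    by (intro tendsto_sum tendsto_mult tendsto_diff tendsto_const coeff_limits(1) n u) auto
  define V\<^sub>0 where "V\<^sub>0 = (1 + \<kappa>) * (3 * (\<Sum>j\<in>?J. \<bar>b n j\<bar> * mean_error n (?u j))\<^sup>2 + 6 * (\<Sum>j\<in>?J. (b n j)\<^sup>2 * mean_error n (?u j)))"
  have Vlim: "V \<longlonglongrightarrow> V\<^sub>0"
    unfolding V_def V\<^sub>0_def \<rho>_def
    by (intro tendsto_sum tendsto_mult tendsto_add tendsto_power tendsto_const coeff_limits(2) n u) auto
  \<comment> \<open>Both transforms are expanded over the same window depending on \<open>N\<close>,
    as the comparison of the two kernels requires.\<close>
  have var: "integrable M (\<lambda>w. (RN N w - mN N)\<^sup>2)" "expectation (\<lambda>w. (RN N w - mN N)\<^sup>2) \<le> V N" for N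
    unfolding RN_def mN_def V_def \<rho>_def dft_truncated dft_noise[where N = N]
    by (rule quadratic_difference_variance; use fourier_coeff_orthonormal in simp)+
  obtain r where r: "strict_mono r" "AE w in M. \<forall>t\<in>{1..n}. (\<lambda>N. truncated (r N) (int t) w) \<longlonglongrightarrow> X (int t) w"
    by (rule truncated_AE_subseq)
  have [measurable]: "(\<lambda>w. dft n v (\<lambda>t. truncated N t w)) \<in> borel_measurable M"
    "(\<lambda>w. dft n v (\<lambda>t. \<zeta> t w)) \<in> borel_measurable M" for N v
    unfolding dft_def by measurable
  have [measurable]: "RN N \<in> borel_measurable M" "R \<in> borel_measurable M" for N
    using iR unfolding RN_def by auto
  have lim: "AE w in M. (\<lambda>N. RN (r N) w - mN (r N)) \<longlonglongrightarrow> R w - m"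
    using r(2)
  proof eventually_elim
    case (elim w)
    have "(\<lambda>N. dft n v (\<lambda>t. truncated (r N) t w)) \<longlonglongrightarrow> dft n v (\<lambda>t. X t w)" for v
      unfolding dft_def divide_inverse using elim
      by (intro tendsto_mult tendsto_sum tendsto_of_real tendsto_const) auto
    then have "(\<lambda>N. RN (r N) w) \<longlonglongrightarrow> R w"
      unfolding RN_def R divide_inverse
      by (intro tendsto_sum tendsto_mult tendsto_diff tendsto_power tendsto_norm tendsto_const)
    then show ?case
      using LIMSEQ_subseq_LIMSEQ[OF mlim r(1)] by (intro tendsto_diff) (simp_all add: comp_def)
  qed
  have fin: "integrable M (\<lambda>w. (R w - m)\<^sup>2)" "expectation (\<lambda>w. (R w - m)\<^sup>2) \<le> V\<^sub>0"
    using integral_square_le_limit[OF _ _ lim r(1) var(1) var(2) Vlim] by simp_all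
  show "expectation (\<lambda>w. (R w - expectation R)\<^sup>2) \<le> (1 + \<kappa>) *
      (3 * (\<Sum>j=1..\<nu> n. \<bar>b n j\<bar> * mean_error n (freq n j))\<^sup>2 + 6 * (\<Sum>j=1..\<nu> n. (b n j)\<^sup>2 * mean_error n (freq n j)))"
    using fin(2) unfolding ER V\<^sub>0_def .
  have "(R w)\<^sup>2 = (R w - m)\<^sup>2 + 2 * m * R w - m\<^sup>2" for w
    by (simp add: power2_eq_square algebra_simps)
  then show "integrable M (\<lambda>w. (R w)\<^sup>2)"
    using fin(1) iR by simp
qed

end

section \<open>The bounds in terms of the weights\<close>

context filtered_noise
begin

text \<open>Everything reduces to \<open>S\<close>, which governs the variance, and
  \<open>T\<close>, which governs the mean and dominates \<open>S\<close>. \<open>C\<close> is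
  chosen before \<open>b\<close> and \<open>n\<close>. The last two conjuncts feed the little-o
  claims.\<close>

lemma remainder_bounds:
  obtains C where "0 \<le> C"
    and "\<And>b n. 4 \<le> n \<Longrightarrow>
      (let R = \<lambda>w. S_X b A X n w - S_\<zeta> b \<zeta> n w; W = weight_max b n; B = weight_l2 b n; l = ln (real n) in
        0 \<le> W \<and> 0 \<le> B \<and>
        expectation (\<lambda>w. (R w - expectation R)\<^sup>2) \<le> C * W\<^sup>2 * l ^ 3 \<and>
        expectation (\<lambda>w. (R w - expectation R)\<^sup>2) \<le> C * W * B \<and>
        \<bar>expectation R\<bar> \<le> C * W * l\<^sup>2 \<and>
        expectation (\<lambda>w. (R w)\<^sup>2) \<le> C * W\<^sup>2 * l ^ 4 \<and>
        (expectation R)\<^sup>2 \<le> C * W * B \<and>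
        expectation (\<lambda>w. (R w)\<^sup>2) \<le> C * W * B)"
proof -
  obtain K where K: "0 \<le> K" and interp: "\<And>m \<beta> b. (\<And>j. j \<in> {1..m} \<Longrightarrow> 0 \<le> \<beta> j \<and> \<beta> j \<le> b) \<Longrightarrow> 0 \<le> b \<Longrightarrow>
      (\<Sum>j=1..m. \<beta> j * (log_weight j + log_weight (m + 1 - j)))\<^sup>2 \<le> K * b * sqrt (\<Sum>j=1..m. (\<beta> j)\<^sup>2)"
    using log_weight_sum_bound by blast
  have kap: "0 \<le> 1 + \<kappa>" using fourth_moment_ge_one by simp
  \<comment> \<open>48 = 3 * 4^2 and 24 = 6 * 4 come from \<open>S \<le> 4 * K_err * W * l\<close>,
    and 216 = 27 * 8 from the bound for \<open>T\<close>. The prefixes 3 and 6 are those of the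
    Frobenius bound.\<close>
  define c1 where "c1 = (1 + \<kappa>) * (48 * K_err\<^sup>2 + 24 * K_err)"
  define c2 where "c2 = (1 + \<kappa>) * (3 * K_err\<^sup>2 * K + 6 * K_err * sqrt K)"
  define c3 where "c3 = 216 * K_err"
  define c4 where "c4 = (27 * K_err)\<^sup>2 * K"
  define C where "C = c1 + c2 + c3 + c3\<^sup>2 + c4"
  have c: "0 \<le> c1" "0 \<le> c2" "0 \<le> c3" "0 \<le> c4"
    using kap K K_err by (auto simp: c1_def c2_def c3_def c4_def)
  show ?thesis
  proof (rule that)
    show "0 \<le> C" using c by (simp add: C_def)
    fix b :: "nat \<Rightarrow> nat \<Rightarrow> real" and n :: nat
    assume n: "4 \<le> n"
    define m where "m = \<nu> n"
    have m: "1 \<le> m" "m \<le> n" using n by (auto simp: m_def \<nu>_def)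
    define R where "R w = S_X b A X n w - S_\<zeta> b \<zeta> n w" for w
    define W where "W = weight_max b n"
    define B where "B = weight_l2 b n"
    define l where "l = ln (real n)"
    define \<rho> where "\<rho> j = mean_error n (freq n j)" for j
    define T where "T = (\<Sum>j=1..m. \<bar>b n j\<bar> * (log_weight j + log_weight (m + 1 - j)))"
    define S where "S = (\<Sum>j=1..m. \<bar>b n j\<bar> * \<rho> j)"
    have bW: "\<bar>b n j\<bar> \<le> W" if "j \<in> {1..m}" for j
      unfolding W_def weight_max_def using that by (intro Max_ge) (auto simp: m_def)
    have W: "0 \<le> W" using bW[of 1] m by (simp add: order_trans[OF abs_ge_zero])
    have B: "B = sqrt (\<Sum>j=1..m. \<bar>b n j\<bar>\<^sup>2)" "0 \<le> B"
      by (simp_all add: B_def weight_l2_def m_def sum_nonneg)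
    have WB: "W \<le> B"
    proof -
      have "W \<in> (\<lambda>j. \<bar>b n j\<bar>) ` {1..m}"
        unfolding W_def weight_max_def m_def[symmetric] using m by (intro Max_in) auto
      then obtain j where j: "j \<in> {1..m}" "W = \<bar>b n j\<bar>" by auto
      have "\<bar>b n j\<bar>\<^sup>2 \<le> (\<Sum>j=1..m. \<bar>b n j\<bar>\<^sup>2)"
        using j by (intro member_le_sum) auto
      then show ?thesis unfolding B(1) j(2) by (rule real_le_rsqrt)
    qed
    have "exp 1 \<le> real n" using exp_le n by linarith
    then have l: "1 \<le> l" unfolding l_def using n by (subst ln_ge_iff) auto
    have rho: "0 \<le> \<rho> j" "\<rho> j \<le> K_err * (1 / real j + 1 / real (m + 1 - j))" if "j \<in> {1..m}" for j
      unfolding \<rho>_def m_def using freq_mean_error(1)[of j n] that by (auto simp: mean_error_def m_def)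
    have lw: "1 / real j + 1 / real (m + 1 - j) \<le> log_weight j + log_weight (m + 1 - j)" if "j \<in> {1..m}" for j
      using that unfolding atLeastAtMost_iff by (intro add_mono log_weight_ge; linarith)
    have lw0: "0 \<le> log_weight j + log_weight (m + 1 - j)" if "j \<in> {1..m}" for j
      using lw[OF that] by (rule order_trans[rotated]) simp
    have S0: "0 \<le> S" unfolding S_def using rho by (intro sum_nonneg) auto
    have S1: "S \<le> 4 * K_err * W * l"
    proof -
      have "S \<le> (\<Sum>j=1..m. W * (K_err * (1 / real j + 1 / real (m + 1 - j))))"
        unfolding S_def using rho bW W by (intro sum_mono mult_mono) auto
      also have "\<dots> = W * K_err * (\<Sum>j=1..m. 1 / real j + 1 / real (m + 1 - j))"
        by (simp only: sum_distrib_left mult.assoc)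
      also have "\<dots> \<le> W * K_err * (4 * l)"
        unfolding l_def using W K_err m n by (intro mult_left_mono sum_reflected_le_ln) auto
      finally show ?thesis by (simp add: mult_ac)
    qed
    have T0: "0 \<le> T" unfolding T_def using lw0 by (intro sum_nonneg) auto
    have ST: "S \<le> K_err * T"
      unfolding S_def T_def sum_distrib_left
    proof (intro sum_mono)
      fix j assume j: "j \<in> {1..m}"
      have "\<rho> j \<le> K_err * (log_weight j + log_weight (m + 1 - j))"
        using rho(2)[OF j] mult_left_mono[OF lw[OF j] K_err] by linarith
      then show "\<bar>b n j\<bar> * \<rho> j \<le> K_err * (\<bar>b n j\<bar> * (log_weight j + log_weight (m + 1 - j)))"
        by (metis abs_ge_zero mult.left_commute mult_left_mono)
    qed
    have T2: "T\<^sup>2 \<le> K * W * B"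
      unfolding T_def B(1) using bW W by (intro interp) auto
    \<comment> \<open>The variance contains a term linear in \<open>S\<close>, whereas the
      interpolation bounds a square. \<open>W \<le> B\<close> turns it into a linear bound without
      logarithm.\<close>
    have TB: "T \<le> sqrt K * B"
    proof (rule power2_le_imp_le)
      have "K * W * B \<le> K * B * B" using WB K B by (intro mult_right_mono mult_left_mono) auto
      moreover have "(sqrt K * B)\<^sup>2 = K * B * B"
        using K unfolding power_mult_distrib by (simp add: power2_eq_square[of B])
      ultimately show "T\<^sup>2 \<le> (sqrt K * B)\<^sup>2" using T2 by linarith
    qed (use K B in simp)
    have TW: "T \<le> 8 * W * l\<^sup>2"
    proof -
      have "T \<le> (\<Sum>j=1..m. W * (log_weight j + log_weight (m + 1 - j)))"
        unfolding T_def using bW lw0 by (intro sum_mono mult_right_mono) auto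
      also have "\<dots> = W * (\<Sum>j=1..m. log_weight j + log_weight (m + 1 - j))"
        by (simp only: sum_distrib_left)
      also have "\<dots> \<le> W * (8 * l\<^sup>2)"
        unfolding l_def using W m n by (intro mult_left_mono sum_reflected_le_ln) auto
      finally show ?thesis by (simp add: mult_ac)
    qed
    have "1 \<le> n" using n by simp
    note mom = remainder_moments[OF this, of b, folded R_def]
    let ?Var = "expectation (\<lambda>w. (R w - expectation R)\<^sup>2)"
    have var: "?Var \<le> (1 + \<kappa>) * (3 * S\<^sup>2 + 6 * (W * S))"
    proof -
      have "(\<Sum>j=1..m. (b n j)\<^sup>2 * \<rho> j) \<le> W * S"
        unfolding S_def sum_distrib_left
      proof (intro sum_mono)
        fix j assume j: "j \<in> {1..m}"
        have "(b n j)\<^sup>2 * \<rho> j = \<bar>b n j\<bar> * (\<bar>b n j\<bar> * \<rho> j)"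
          by (simp add: power2_eq_square flip: mult.assoc abs_mult)
        also have "\<dots> \<le> W * (\<bar>b n j\<bar> * \<rho> j)"
          using bW[OF j] rho[OF j] by (intro mult_right_mono) auto
        finally show "(b n j)\<^sup>2 * \<rho> j \<le> W * (\<bar>b n j\<bar> * \<rho> j)" .
      qed
      then have "(1 + \<kappa>) * (3 * S\<^sup>2 + 6 * (\<Sum>j=1..m. (b n j)\<^sup>2 * \<rho> j)) \<le> (1 + \<kappa>) * (3 * S\<^sup>2 + 6 * (W * S))"
        using kap by (intro mult_left_mono) auto
      then show ?thesis
        using mom(4) unfolding S_def \<rho>_def m_def by (rule order_trans[rotated])
    qed
    \<comment> \<open>Stronger than required: the sum of \<rho> costs one logarithm, its square
      two.\<close>
    have var1: "?Var \<le> c1 * (W\<^sup>2 * l\<^sup>2)"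
    proof -
      have "S\<^sup>2 \<le> (4 * K_err * W * l)\<^sup>2" using S0 S1 by (intro power_mono)
      moreover have "W * S \<le> (4 * K_err) * (W\<^sup>2 * l\<^sup>2)"
      proof -
        have "W * S \<le> W * (4 * K_err * W * l)" using S1 W by (intro mult_left_mono)
        also have "\<dots> = (4 * K_err * W\<^sup>2 * l) * 1" by (simp add: power2_eq_square)
        also have "\<dots> \<le> (4 * K_err * W\<^sup>2 * l) * l" using l K_err by (intro mult_left_mono) auto
        finally show ?thesis by (simp add: power2_eq_square mult_ac)
      qed
      ultimately have "3 * S\<^sup>2 + 6 * (W * S) \<le> (48 * K_err\<^sup>2 + 24 * K_err) * (W\<^sup>2 * l\<^sup>2)"
        by (simp add: power_mult_distrib distrib_right)
      then have "(1 + \<kappa>) * (3 * S\<^sup>2 + 6 * (W * S)) \<le> c1 * (W\<^sup>2 * l\<^sup>2)"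
        unfolding c1_def mult.assoc using kap by (rule mult_left_mono)
      then show ?thesis using var by linarith
    qed
    have var2: "?Var \<le> c2 * (W * B)"
    proof -
      have "S\<^sup>2 \<le> (K_err * T)\<^sup>2" using S0 ST by (intro power_mono)
      also have "\<dots> = K_err\<^sup>2 * T\<^sup>2" by (rule power_mult_distrib)
      also have "\<dots> \<le> K_err\<^sup>2 * (K * W * B)" using T2 by (intro mult_left_mono) auto
      finally have "S\<^sup>2 \<le> K_err\<^sup>2 * K * (W * B)" by (simp add: mult.assoc)
      moreover have "W * S \<le> K_err * sqrt K * (W * B)"
      proof -
        have "W * S \<le> W * (K_err * (sqrt K * B))"
          using W ST mult_left_mono[OF TB K_err] by (intro mult_left_mono) auto
        then show ?thesis by (simp add: mult_ac)
      qed
      ultimately have "3 * S\<^sup>2 + 6 * (W * S) \<le> (3 * K_err\<^sup>2 * K + 6 * K_err * sqrt K) * (W * B)"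
        by (simp add: distrib_right)
      then have "(1 + \<kappa>) * (3 * S\<^sup>2 + 6 * (W * S)) \<le> c2 * (W * B)"
        unfolding c2_def mult.assoc[of "1 + \<kappa>"] using kap by (rule mult_left_mono)
      then show ?thesis using var by linarith
    qed
    have mean: "\<bar>expectation R\<bar> \<le> 27 * K_err * T"
      unfolding mom(3) T_def sum_distrib_left m_def[symmetric]
    proof (intro order_trans[OF sum_abs] sum_mono)
      fix j assume j: "j \<in> {1..m}"
      have "\<bar>mean_square n (freq n j) - 1\<bar> \<le> 27 * K_err * (log_weight j + log_weight (m + 1 - j))"
        using freq_mean_error(2)[of j n] j by (simp add: m_def)
      then have "\<bar>b n j\<bar> * \<bar>mean_square n (freq n j) - 1\<bar> \<le> \<bar>b n j\<bar> * (27 * K_err * (log_weight j + log_weight (m + 1 - j)))"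
        by (intro mult_left_mono) auto
      then show "\<bar>b n j * (mean_square n (freq n j) - 1)\<bar> \<le> 27 * K_err * (\<bar>b n j\<bar> * (log_weight j + log_weight (m + 1 - j)))"
        unfolding abs_mult by (simp add: mult.left_commute)
    qed
    have mean1: "\<bar>expectation R\<bar> \<le> c3 * (W * l\<^sup>2)"
      using mean mult_left_mono[OF TW, of "27 * K_err"] K_err by (simp add: c3_def mult_ac)
    have mean2: "(expectation R)\<^sup>2 \<le> c4 * (W * B)"
    proof -
      have "\<bar>expectation R\<bar>\<^sup>2 \<le> (27 * K_err * T)\<^sup>2" using mean by (intro power_mono) auto
      also have "\<dots> = (27 * K_err)\<^sup>2 * T\<^sup>2" by (rule power_mult_distrib)
      also have "\<dots> \<le> (27 * K_err)\<^sup>2 * (K * W * B)" using T2 by (intro mult_left_mono) auto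
      finally show ?thesis by (simp add: c4_def mult.assoc)
    qed
    \<comment> \<open>The second moment splits into variance and squared mean; the latter is
      responsible for the fourth power of the logarithm.\<close>
    have second: "expectation (\<lambda>w. (R w)\<^sup>2) = ?Var + (expectation R)\<^sup>2"
      using variance_eq[OF mom(1,2)] by simp
    have mono: "x \<le> C * y" if "x \<le> c * z" "c \<le> C" "z \<le> y" "0 \<le> y" "0 \<le> c" for x y z c :: real
    proof -
      have "x \<le> c * y" using that by (meson mult_left_mono order_trans)
      also have "\<dots> \<le> C * y" using that by (intro mult_right_mono)
      finally show ?thesis .
    qed
    have sq: "0 \<le> c3\<^sup>2" by simp
    have l23: "W\<^sup>2 * l\<^sup>2 \<le> W\<^sup>2 * l ^ 3" "W\<^sup>2 * l\<^sup>2 \<le> W\<^sup>2 * l ^ 4"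
      using l by (intro mult_left_mono power_increasing; simp)+
    have "?Var \<le> C * (W\<^sup>2 * l ^ 3)"
      using c sq l by (intro mono[OF var1 _ l23(1)]) (auto simp: C_def)
    moreover have "?Var \<le> C * (W * B)"
      using c sq W B by (intro mono[OF var2 _ order_refl]) (auto simp: C_def)
    moreover have "\<bar>expectation R\<bar> \<le> C * (W * l\<^sup>2)"
      using c sq W by (intro mono[OF mean1 _ order_refl]) (auto simp: C_def)
    moreover have "(expectation R)\<^sup>2 \<le> C * (W * B)"
      using c sq W B by (intro mono[OF mean2 _ order_refl]) (auto simp: C_def)
    moreover have "expectation (\<lambda>w. (R w)\<^sup>2) \<le> C * (W\<^sup>2 * l ^ 4)"
    proof -
      have "\<bar>expectation R\<bar>\<^sup>2 \<le> (c3 * (W * l\<^sup>2))\<^sup>2" using mean1 by (intro power_mono) auto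
      then have "(expectation R)\<^sup>2 \<le> c3\<^sup>2 * (W\<^sup>2 * l ^ 4)" by (simp add: power_mult_distrib flip: power_mult)
      moreover have "?Var \<le> c1 * (W\<^sup>2 * l ^ 4)"
        using var1 mult_left_mono[OF l23(2) c(1)] by linarith
      ultimately have le: "expectation (\<lambda>w. (R w)\<^sup>2) \<le> (c1 + c3\<^sup>2) * (W\<^sup>2 * l ^ 4)"
        unfolding second distrib_right by linarith
      then show ?thesis using c sq by (intro mono[OF le _ order_refl]) (auto simp: C_def)
    qed
    moreover have "expectation (\<lambda>w. (R w)\<^sup>2) \<le> C * (W * B)"
    proof -
      have le: "expectation (\<lambda>w. (R w)\<^sup>2) \<le> (c2 + c4) * (W * B)"
        using var2 mean2 unfolding second distrib_right by linarith
      then show ?thesis using c sq W B by (intro mono[OF le _ order_refl]) (auto simp: C_def)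
    qed
    ultimately show "let R = \<lambda>w. S_X b A X n w - S_\<zeta> b \<zeta> n w; W = weight_max b n; B = weight_l2 b n; l = ln (real n) in
        0 \<le> W \<and> 0 \<le> B \<and>
        expectation (\<lambda>w. (R w - expectation R)\<^sup>2) \<le> C * W\<^sup>2 * l ^ 3 \<and>
        expectation (\<lambda>w. (R w - expectation R)\<^sup>2) \<le> C * W * B \<and>
        \<bar>expectation R\<bar> \<le> C * W * l\<^sup>2 \<and>
        expectation (\<lambda>w. (R w)\<^sup>2) \<le> C * W\<^sup>2 * l ^ 4 \<and>
        (expectation R)\<^sup>2 \<le> C * W * B \<and>
        expectation (\<lambda>w. (R w)\<^sup>2) \<le> C * W * B"
      using W B(2) unfolding Let_def R_def W_def B_def l_def mult.assoc by blast
  qed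
qed

end

section \<open>Transfer of the moments and the final statement\<close>

lemma (in prob_space) white_noise_iid:
  assumes iid: "iid M \<zeta>" and "expectation (\<zeta> 0) = 0" "expectation (\<lambda>w. (\<zeta> 0 w)\<^sup>2) = 1"
    and int: "integrable M (\<lambda>w. (\<zeta> 0 w) ^ 4)"
  shows "white_noise M \<zeta> (expectation (\<lambda>w. \<zeta> 0 w ^ 4))"
proof
  show indep: "indep_vars (\<lambda>_. borel) \<zeta> UNIV" using iid by (simp add: iid_def)
  have [measurable]: "\<zeta> i \<in> borel_measurable M" for i
    using indep by (auto simp: indep_vars_def)
  have distr: "distr M borel (\<zeta> i) = distr M borel (\<zeta> 0)" for i
    using iid by (simp add: iid_def)
  have eq: "expectation (\<lambda>w. f (\<zeta> i w)) = expectation (\<lambda>w. f (\<zeta> 0 w))"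
    if [measurable]: "f \<in> borel_measurable borel" for f :: "real \<Rightarrow> real" and i
    using integral_distr[of "\<zeta> i" M borel f] integral_distr[of "\<zeta> 0" M borel f] distr[of i] by simp
  fix i
  show "expectation (\<zeta> i) = 0" using eq[of "\<lambda>x. x" i] assms by simp
  show "expectation (\<lambda>w. (\<zeta> i w)\<^sup>2) = 1" using eq[of "\<lambda>x. x\<^sup>2" i] assms by simp
  show "expectation (\<lambda>w. \<zeta> i w ^ 4) = expectation (\<lambda>w. \<zeta> 0 w ^ 4)" using eq[of "\<lambda>x. x ^ 4" i] by simp
  show "integrable M (\<lambda>w. \<zeta> i w ^ 4)"
    using int integrable_distr_eq[of "\<zeta> i" M borel "\<lambda>x. x ^ 4"] integrable_distr_eq[of "\<zeta> 0" M borel "\<lambda>x. x ^ 4"]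
      distr[of i] by simp
qed

text \<open>Integrability is asserted alongside the bounds, since a Bochner integral of a
  non-integrable function is 0 and would satisfy them trivially. The restriction to
  \<open>n \<ge> 4\<close> is the range in which frequencies exist.\<close>

theorem lemma2p1:
  fixes M :: "'w measure"
    and \<zeta> X :: "int \<Rightarrow> 'w \<Rightarrow> real"
    and a :: "nat \<Rightarrow> real"
    and A :: "real \<Rightarrow> complex"
    and g :: "real \<Rightarrow> real"
    and d C1 C2 C0 :: real
    and b :: "nat \<Rightarrow> nat \<Rightarrow> real"
    and R :: "nat \<Rightarrow> 'w \<Rightarrow> real"
  defines "R \<equiv> \<lambda>n w. S_X b A X n w - S_\<zeta> b \<zeta> n w"
  assumes "prob_space M"
    and "iid M \<zeta>"
    and "integral\<^sup>L M (\<zeta> 0) = 0"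
    and "integral\<^sup>L M (\<lambda>w. (\<zeta> 0 w)\<^sup>2) = 1"
    and "integrable M (\<lambda>w. (\<zeta> 0 w) ^ 4)"
    and "summable (\<lambda>k. (a k)\<^sup>2)"
    and "linear_process M a \<zeta> X"
    and "transfer_function a A"
    and "\<bar>d\<bar> < 1 / 2"
    and "continuous_on {-pi..pi} g"
    and "0 < C1"
    and "\<And>u. u \<in> {-pi..pi} \<Longrightarrow> C1 \<le> g u \<and> g u \<le> C2"
    and "\<And>u. u \<in> {-pi..pi} \<Longrightarrow> u \<noteq> 0 \<Longrightarrow>
           spectral_density A u = \<bar>u\<bar> powr (- 2 * d) * g u"
    and "\<And>u. u \<in> {0<..<pi} \<Longrightarrow>
           A differentiable (at u) \<and>
           norm (vector_derivative A (at u)) \<le> C0 * \<bar>u\<bar> powr (- 1 - d)"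
  shows "(\<forall>n. integrable M (\<lambda>w. (R n w)\<^sup>2)) \<and>
    (\<exists>C. \<forall>n\<ge>4.
       integral\<^sup>L M (\<lambda>w. (R n w - integral\<^sup>L M (R n))\<^sup>2) \<le> C * (weight_max b n)\<^sup>2 * ln (real n) ^ 3 \<and>
       integral\<^sup>L M (\<lambda>w. (R n w - integral\<^sup>L M (R n))\<^sup>2) \<le> C * weight_max b n * weight_l2 b n \<and>
       \<bar>integral\<^sup>L M (R n)\<bar> \<le> C * weight_max b n * ln (real n) ^ 2 \<and>
       integral\<^sup>L M (\<lambda>w. (S_X b A X n w - S_\<zeta> b \<zeta> n w)\<^sup>2) \<le> C * (weight_max b n)\<^sup>2 * ln (real n) ^ 4) \<and>
    (weight_max b \<in> o(weight_l2 b) \<longrightarrow>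
       (\<lambda>n. \<bar>integral\<^sup>L M (R n)\<bar>) \<in> o(weight_l2 b) \<and>
       (\<lambda>n. integral\<^sup>L M (\<lambda>w. (S_X b A X n w - S_\<zeta> b \<zeta> n w)\<^sup>2)) \<in> o(\<lambda>n. (weight_l2 b n)\<^sup>2))"
proof -
  interpret prob_space M by fact
  interpret white_noise M \<zeta> "expectation (\<lambda>w. \<zeta> 0 w ^ 4)"
    by (rule white_noise_iid) fact+
  interpret filtered_noise M \<zeta> "expectation (\<lambda>w. \<zeta> 0 w ^ 4)" A g d C0 C1 C2 a X
    by unfold_locales fact+
  have int: "integrable M (\<lambda>w. (R n w)\<^sup>2)" for n
  proof (cases "1 \<le> n")
    case True
    then show ?thesis unfolding R_def by (rule remainder_moments(2))
  next
    \<comment> \<open>Then \<open>n = 0\<close>, the sums over frequencies are empty, and the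
      remainder is 0.\<close>
    case False
    then show ?thesis by (simp add: R_def S_X_def S_\<zeta>_def \<nu>_def)
  qed
  obtain C where C: "0 \<le> C" and bounds: "\<And>b n. 4 \<le> n \<Longrightarrow>
      (let R = \<lambda>w. S_X b A X n w - S_\<zeta> b \<zeta> n w; W = weight_max b n; B = weight_l2 b n; l = ln (real n) in
        0 \<le> W \<and> 0 \<le> B \<and>
        expectation (\<lambda>w. (R w - expectation R)\<^sup>2) \<le> C * W\<^sup>2 * l ^ 3 \<and>
        expectation (\<lambda>w. (R w - expectation R)\<^sup>2) \<le> C * W * B \<and>
        \<bar>expectation R\<bar> \<le> C * W * l\<^sup>2 \<and>
        expectation (\<lambda>w. (R w)\<^sup>2) \<le> C * W\<^sup>2 * l ^ 4 \<and>
        (expectation R)\<^sup>2 \<le> C * W * B \<and>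
        expectation (\<lambda>w. (R w)\<^sup>2) \<le> C * W * B)"
    using remainder_bounds by blast
  note bounds = bounds[of _ b, unfolded Let_def]
  have little_o: "(\<lambda>n. \<bar>expectation (R n)\<bar>) \<in> o(weight_l2 b)"
    "(\<lambda>n. expectation (\<lambda>w. (R n w)\<^sup>2)) \<in> o(\<lambda>n. (weight_l2 b n)\<^sup>2)"
    if small: "weight_max b \<in> o(weight_l2 b)"
  proof -
    have ev: "\<forall>\<^sub>F n in sequentially. 4 \<le> n \<and> C * weight_max b n * weight_l2 b n \<le> e * (weight_l2 b n)\<^sup>2"
      if e: "0 < e" for e
    proof -
      \<comment> \<open>\<open>C + 1\<close> in place of \<open>C\<close>, which may be 0.\<close>
      have "0 < e / (C + 1)" using e C by simp
      from landau_o.smallD[OF small this] eventually_ge_at_top[of 4] show ?thesis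
      proof eventually_elim
        case (elim n)
        have B: "0 \<le> weight_l2 b n" and W: "0 \<le> weight_max b n" using bounds[of n] elim by auto
        have "C * weight_max b n \<le> (C + 1) * (e / (C + 1) * weight_l2 b n)"
          using elim B W C by (intro mult_mono) auto
        then have "C * weight_max b n * weight_l2 b n \<le> e * weight_l2 b n * weight_l2 b n"
          using C B by (intro mult_right_mono) auto
        then show ?case using elim by (simp add: power2_eq_square)
      qed
    qed
    show "(\<lambda>n. \<bar>expectation (R n)\<bar>) \<in> o(weight_l2 b)"
    proof (rule landau_o.smallI)
      fix e :: real assume e: "0 < e"
      \<comment> \<open>The available bound concerns the square of the mean, so smallness is
        required at level \<open>e\<^sup>2\<close>.\<close>
      then have "0 < e\<^sup>2" by simp
      from ev[OF this] show "\<forall>\<^sub>F n in sequentially. norm \<bar>expectation (R n)\<bar> \<le> e * norm (weight_l2 b n)"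
      proof eventually_elim
        case (elim n)
        then have "\<bar>expectation (R n)\<bar>\<^sup>2 \<le> (e * weight_l2 b n)\<^sup>2" and B: "0 \<le> weight_l2 b n"
          using bounds[of n] by (auto simp: power_mult_distrib R_def)
        then have "\<bar>expectation (R n)\<bar> \<le> e * weight_l2 b n"
          using e by (intro power2_le_imp_le[of "\<bar>expectation (R n)\<bar>"]) auto
        then show ?case using B by simp
      qed
    qed
    show "(\<lambda>n. expectation (\<lambda>w. (R n w)\<^sup>2)) \<in> o(\<lambda>n. (weight_l2 b n)\<^sup>2)"
    proof (rule landau_o.smallI)
      fix e :: real assume "0 < e"
      from ev[OF this] show "\<forall>\<^sub>F n in sequentially. norm (expectation (\<lambda>w. (R n w)\<^sup>2)) \<le> e * norm ((weight_l2 b n)\<^sup>2)"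
      proof eventually_elim
        case (elim n)
        then show ?case using bounds[of n] by (simp add: R_def)
      qed
    qed
  qed
  show ?thesis
    using int bounds little_o unfolding R_def by blast
qed

end
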